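(* Let $\mathcal T$ be a physical theory. Then $(\widetilde{\mathcal H}'_{\mathcal T},m,\Psi)$ is a comodule-coalgebra on $(\widetilde{\mathcal H}_{\mathcal T},m,\Delta)$, where $\widetilde{\mathcal H}_{\mathcal T}$ and $\widetilde{\mathcal H}'_{\mathcal T}$ are isomorphic as algebras. Here the coaction is $\Delta:\widetilde{\mathcal H}'_{\mathcal T}\to\widetilde{\mathcal H}_{\mathcal T}\otimes\widetilde{\mathcal H}'_{\mathcal T}$, $\Delta(\bar\Gamma)=\sum_{\bar\gamma\subseteq\bar\Gamma,\ \bar\Gamma/\bar\gamma\in\mathcal T}\bar\gamma\otimes\bar\Gamma/\bar\gamma$.
   Context: **Feynman graphs.** A graph $\Gamma$ is given by a finite set $\mathcal V(\Gamma)$ of vertices, a finite set $\mathcal E(\Gamma)$ of half-edges, a map $\partial:\mathcal E(\Gamma)\to\mathcal V(\Gamma)$ and an involution $\sigma_\Gamma:\mathcal E(\Gamma)\to\mathcal E(\Gamma)$. Half-edges are partitioned into types and $\sigma_\Gamma$ respects types. Fixed points of $\sigma_\Gamma$ are the external edges; pairs $\{e,\sigma_\Gamma(e)\}$ with $e\ne\sigma_\Gamma(e)$ are the internal edges. Graphs are considered up to isomorphism. $\pi_0(\Gamma)$ is the set of connected components. A $1PI$ graph is a connected graph which remains connected when any one internal edge is cut (replaced by two external edges); a graph is locally $1PI$ if all its connected components are $1PI$. The residue $\mathrm{res}\,\Gamma$ is obtained by shrinking each connected component to a point (retaining its external edges). A covering subgraph $\gamma$ of $\Gamma$ is a graph obtained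 from $\Gamma$ by cutting some internal edges (same vertices and half-edges). $\Gamma/\gamma$ is obtained by shrinking each connected component of $\gamma$ inside $\Gamma$ to a point. **Theory.** A theory $\mathcal T$ prescribes a set $\mathcal E(\mathcal T)$ of half-edge types and a set $\mathcal V(\mathcal T)$ of vertex types. The types of the half-edges adjacent to a vertex need not determine its type; vertex types sharing the same collection of half-edge types are distinguished by an integer index. **Specified graphs.** A specified graph of $\mathcal T$ is a couple $\bar\Gamma=(\Gamma,\underline i)$ where $\Gamma$ is a locally $1PI$ superficially divergent graph (the residue of each component is a vertex of $\mathcal T$) with half-edges and vertices of the types prescribed by $\mathcal T$, and $\underline i:\pi_0(\Gamma)\to\mathbb N$ is such that $\underline i(\gamma)$ is one of the indices allowed by the possible types of the vertex obtained by contracting the component $\gamma$. A specified graph $\bar\gamma=(\gamma,\underline j)$ is a specified covering subgraph of $\bar\Gamma=(\Gamma,\underline i)$, written $\bar\gamma\subset\bar\Gamma$, if $\gamma$ is a covering subgraph of $\Gamma$ and $\underline j(\gamma_0)=\underline i(\gamma_0)$ for every component $\gamma_0$ of $\gamma$ that is also a component of $\Gamma$. The contracted graph $\bar\Gamma/\bar\gamma$ is $\Gamma/\gamma$ with the new vertices given the types specified by $\underline j$ (for a component of $\gamma$ reduced to a single vertex, its own type), and with specification $\underline i$. $\bar\Gamma/\bar\gamma\in\mathcal T$ means that $\bar\Gamma/\bar\gamma$ is a specified graph of the theory. **Bialgebras.** $\widetilde V_{\mathcal T}$ is the vector space (over a field $k$) generated by the connected ($1PI$) specified graphs. $\widetilde{\mathcal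 H}_{\mathcal T}=S(\widetilde V_{\mathcal T})$ is spanned by all specified graphs, with product $m$ the disjoint union, unit the empty graph, and coproduct $\Delta(\bar\Gamma)=\sum\bar\gamma\otimes\bar\Gamma/\bar\gamma$, the sum running over all locally $1PI$ specified covering subgraphs $\bar\gamma$ of $\bar\Gamma$ with $\bar\Gamma/\bar\gamma\in\mathcal T$; this is a bialgebra. $\widetilde{\mathcal H}'_{\mathcal T}=\mathcal S(\widetilde V_{\mathcal T})$ is the symmetric algebra (product $m$) equipped with its usual unshuffling coproduct $\Psi$ (the algebra morphism for which the elements of $\widetilde V_{\mathcal T}$ are primitive). **Comodule-coalgebra.** Saying that $(\widetilde{\mathcal H}'_{\mathcal T},m,\Psi)$ is a comodule-coalgebra on $(\widetilde{\mathcal H}_{\mathcal T},m,\Delta)$ means that $\Delta:\widetilde{\mathcal H}'_{\mathcal T}\to\widetilde{\mathcal H}_{\mathcal T}\otimes\widetilde{\mathcal H}'_{\mathcal T}$ is a left coaction and that $\Psi$ is a morphism of left comodules: $$(I\otimes\Psi)\circ\Delta=m^{13}\circ(\Delta\otimes\Delta)\circ\Psi,$$ where $m^{13}:=(m\otimes I\otimes I)\circ\tau^{23}$ and $\tau^{23}$ exchanges the second and third of four tensor factors.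
   Formalization: The theory is assumed to have only finitely many vertex types (indices) for each collection of half-edge types; otherwise the sum defining the coproduct and coaction can be infinite and is undefined. *)

theory Defs
  imports "HOL.Vector_Spaces" "HOL-Library.Multiset" "HOL-Library.FuncSet" "HOL-Library.Poly_Mapping"
    "HOL-Library.Product_Plus"
begin

section \<open>Feynman graphs\<close>

text \<open>
  The fields of a graph are total functions; only their values on \<open>vertices\<close>, respectively
  \<open>half_edges\<close>, are meaningful. The type of a vertex consists of the multiset of the types of the
  half-edges adjacent to it together with an integer index. The first part can be read off the
  graph, so only the index is stored in \<open>vindex\<close>.
\<close>

record ('v, 'e, 'h) fgraph =
  vertices :: "'v set"
  half_edges :: "'e set"
  bdry :: "'e \<Rightarrow> 'v"
  invol :: "'e \<Rightarrow> 'e"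
  etype :: "'e \<Rightarrow> 'h"
  vindex :: "'v \<Rightarrow> nat"

definition feynman_graph :: "('v, 'e, 'h) fgraph \<Rightarrow> bool" where
  "feynman_graph \<Gamma> \<longleftrightarrow>
     finite (vertices \<Gamma>) \<and> finite (half_edges \<Gamma>) \<and>
     bdry \<Gamma> \<in> half_edges \<Gamma> \<rightarrow> vertices \<Gamma> \<and>
     invol \<Gamma> \<in> half_edges \<Gamma> \<rightarrow> half_edges \<Gamma> \<and>
     (\<forall>e\<in>half_edges \<Gamma>. invol \<Gamma> (invol \<Gamma> e) = e \<and> etype \<Gamma> (invol \<Gamma> e) = etype \<Gamma> e)"

definition external :: "('v, 'e, 'h) fgraph \<Rightarrow> 'e set" where
  "external \<Gamma> = {e \<in> half_edges \<Gamma>. invol \<Gamma> e = e}"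

text \<open>The half-edges of the internal edges \<open>{e, \<sigma> e}\<close>.\<close>

definition internal :: "('v, 'e, 'h) fgraph \<Rightarrow> 'e set" where
  "internal \<Gamma> = {e \<in> half_edges \<Gamma>. invol \<Gamma> e \<noteq> e}"

definition adj :: "('v, 'e, 'h) fgraph \<Rightarrow> 'v rel" where
  "adj \<Gamma> = {(bdry \<Gamma> e, bdry \<Gamma> (invol \<Gamma> e)) | e. e \<in> half_edges \<Gamma>}"

definition component_of :: "('v, 'e, 'h) fgraph \<Rightarrow> 'v \<Rightarrow> 'v set" where
  "component_of \<Gamma> v = (adj \<Gamma>)\<^sup>* `` {v}"

text \<open>A connected component is represented by its set of vertices.\<close>

definition pi0 :: "('v, 'e, 'h) fgraph \<Rightarrow> 'v set set" where
  "pi0 \<Gamma> = component_of \<Gamma> ` vertices \<Gamma>"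

definition component :: "('v, 'e, 'h) fgraph \<Rightarrow> 'v set \<Rightarrow> ('v, 'e, 'h) fgraph" where
  "component \<Gamma> C = \<Gamma>\<lparr>vertices := C, half_edges := {e \<in> half_edges \<Gamma>. bdry \<Gamma> e \<in> C}\<rparr>"

definition graph_connected :: "('v, 'e, 'h) fgraph \<Rightarrow> bool" where
  "graph_connected \<Gamma> \<longleftrightarrow> card (pi0 \<Gamma>) = 1"

definition cut :: "('v, 'e, 'h) fgraph \<Rightarrow> 'e set \<Rightarrow> ('v, 'e, 'h) fgraph" where
  "cut \<Gamma> S = \<Gamma>\<lparr>invol := (\<lambda>e. if e \<in> S then e else invol \<Gamma> e)\<rparr>"

definition one_PI :: "('v, 'e, 'h) fgraph \<Rightarrow> bool" where
  "one_PI \<Gamma> \<longleftrightarrow> graph_connected \<Gamma> \<and>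
     (\<forall>e\<in>internal \<Gamma>. graph_connected (cut \<Gamma> {e, invol \<Gamma> e}))"

definition locally_1PI :: "('v, 'e, 'h) fgraph \<Rightarrow> bool" where
  "locally_1PI \<Gamma> \<longleftrightarrow> (\<forall>C\<in>pi0 \<Gamma>. one_PI (component \<Gamma> C))"

definition covering_subgraph :: "('v, 'e, 'h) fgraph \<Rightarrow> ('v, 'e, 'h) fgraph \<Rightarrow> bool" where
  "covering_subgraph \<gamma> \<Gamma> \<longleftrightarrow>
     (\<exists>S. S \<subseteq> internal \<Gamma> \<and> invol \<Gamma> ` S \<subseteq> S \<and> \<gamma> = cut \<Gamma> S)"


section \<open>Theories and specified graphs\<close>

text \<open>A vertex type is a multiset of half-edge types together with an index.\<close>

record 'h qft =
  edge_types :: "'h set"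
  vertex_types :: "('h multiset \<times> nat) set"

text \<open>
  Each collection of half-edge types carries only finitely many indices; otherwise the sum
  that defines the coproduct would be infinite.
\<close>

definition physical_theory :: "'h qft \<Rightarrow> bool" where
  "physical_theory T \<longleftrightarrow>
     (\<forall>(M, n)\<in>vertex_types T. set_mset M \<subseteq> edge_types T) \<and>
     (\<forall>M. finite {n. (M, n) \<in> vertex_types T})"

definition vertex_type :: "('v, 'e, 'h) fgraph \<Rightarrow> 'v \<Rightarrow> 'h multiset \<times> nat" where
  "vertex_type \<Gamma> v =
     (image_mset (etype \<Gamma>) (mset_set {e \<in> half_edges \<Gamma>. bdry \<Gamma> e = v}), vindex \<Gamma> v)"

text \<open>The half-edge types around the vertex obtained by shrinking the component \<open>C\<close> to a point.\<close>

definition residue_star :: "('v, 'e, 'h) fgraph \<Rightarrow> 'v set \<Rightarrow> 'h multiset" where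
  "residue_star \<Gamma> C = image_mset (etype \<Gamma>) (mset_set {e \<in> external \<Gamma>. bdry \<Gamma> e \<in> C})"

definition superficially_divergent :: "'h qft \<Rightarrow> ('v, 'e, 'h) fgraph \<Rightarrow> bool" where
  "superficially_divergent T \<Gamma> \<longleftrightarrow>
     (\<forall>C\<in>pi0 \<Gamma>. \<exists>n. (residue_star \<Gamma> C, n) \<in> vertex_types T)"

text \<open>
  A component without internal edges is a single vertex \<open>v\<close>. Contracting it does not change it,
  hence the only possible type of the resulting vertex is the type of \<open>v\<close> itself.
\<close>

definition allowed_indices :: "'h qft \<Rightarrow> ('v, 'e, 'h) fgraph \<Rightarrow> 'v set \<Rightarrow> nat set" where
  "allowed_indices T \<Gamma> C =
     (if internal (component \<Gamma> C) = {} then vindex \<Gamma> ` C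
      else {n. (residue_star \<Gamma> C, n) \<in> vertex_types T})"

type_synonym ('v, 'e, 'h) spec_graph = "('v, 'e, 'h) fgraph \<times> ('v set \<Rightarrow> nat)"

text \<open>
  Specifications are extensional functions on the set of components, so that a set of specified
  covering subgraphs contains no two copies of the same one.
\<close>

definition wf_spec :: "('v, 'e, 'h) spec_graph \<Rightarrow> bool" where
  "wf_spec G \<longleftrightarrow> feynman_graph (fst G) \<and> snd G \<in> extensional (pi0 (fst G))"

definition specified_graph :: "'h qft \<Rightarrow> ('v, 'e, 'h) spec_graph \<Rightarrow> bool" where
  "specified_graph T G \<longleftrightarrow> (case G of (\<Gamma>, i) \<Rightarrow>
     feynman_graph \<Gamma> \<and> locally_1PI \<Gamma> \<and> superficially_divergent T \<Gamma> \<and>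
     etype \<Gamma> ` half_edges \<Gamma> \<subseteq> edge_types T \<and>
     vertex_type \<Gamma> ` vertices \<Gamma> \<subseteq> vertex_types T \<and>
     i \<in> (\<Pi>\<^sub>E C\<in>pi0 \<Gamma>. allowed_indices T \<Gamma> C))"

text \<open>
  The set \<open>C\<close> of vertices underlies a component of both \<open>\<gamma>\<close> and \<open>\<Gamma>\<close>, and the two
  components are equal as graphs (no edge inside \<open>C\<close> has been cut).
\<close>

definition common_component ::
    "('v, 'e, 'h) fgraph \<Rightarrow> ('v, 'e, 'h) fgraph \<Rightarrow> 'v set \<Rightarrow> bool" where
  "common_component \<gamma> \<Gamma> C \<longleftrightarrow> C \<in> pi0 \<gamma> \<and> C \<in> pi0 \<Gamma> \<and>
     (\<forall>e\<in>half_edges \<Gamma>. bdry \<Gamma> e \<in> C \<longrightarrow> invol \<gamma> e = invol \<Gamma> e)"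

definition spec_covering_subgraph ::
    "'h qft \<Rightarrow> ('v, 'e, 'h) spec_graph \<Rightarrow> ('v, 'e, 'h) spec_graph \<Rightarrow> bool" where
  "spec_covering_subgraph T g G \<longleftrightarrow> (case (g, G) of ((\<gamma>, j), (\<Gamma>, i)) \<Rightarrow>
     specified_graph T (\<gamma>, j) \<and> covering_subgraph \<gamma> \<Gamma> \<and>
     (\<forall>C. common_component \<gamma> \<Gamma> C \<longrightarrow> j C = i C))"

text \<open>
  The vertices of \<open>\<Gamma>/\<gamma>\<close> are the components of \<open>\<gamma>\<close>, and its half-edges are those
  which are external in \<open>\<gamma>\<close>. The index \<open>j C\<close> is the own index of \<open>v\<close> if \<open>C\<close> is a
  single vertex \<open>v\<close> without internal edges. A component \<open>D\<close> of \<open>\<Gamma>/\<gamma>\<close> is a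
  set of components of \<open>\<gamma>\<close> whose union is a component of \<open>\<Gamma>\<close>.
\<close>

definition contract_graph ::
    "('v, 'e, 'h) fgraph \<Rightarrow> ('v, 'e, 'h) spec_graph \<Rightarrow> ('v set, 'e, 'h) fgraph" where
  "contract_graph \<Gamma> g = (case g of (\<gamma>, j) \<Rightarrow>
     \<lparr>vertices = pi0 \<gamma>, half_edges = external \<gamma>,
      bdry = (\<lambda>e. component_of \<gamma> (bdry \<Gamma> e)),
      invol = invol \<Gamma>, etype = etype \<Gamma>, vindex = j\<rparr>)"

definition contract ::
    "('v, 'e, 'h) spec_graph \<Rightarrow> ('v, 'e, 'h) spec_graph \<Rightarrow> ('v set, 'e, 'h) spec_graph" where
  "contract G g = (case G of (\<Gamma>, i) \<Rightarrow>
     (contract_graph \<Gamma> g, \<lambda>D\<in>pi0 (contract_graph \<Gamma> g). i (\<Union>D)))"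

definition coproduct_subgraphs ::
    "'h qft \<Rightarrow> ('v, 'e, 'h) spec_graph \<Rightarrow> ('v, 'e, 'h) spec_graph set" where
  "coproduct_subgraphs T G =
     {g. spec_covering_subgraph T g G \<and> specified_graph T (contract G g)}"

definition spec_component ::
    "('v, 'e, 'h) spec_graph \<Rightarrow> 'v set \<Rightarrow> ('v, 'e, 'h) spec_graph" where
  "spec_component G C = (component (fst G) C, restrict (snd G) {C})"


section \<open>Isomorphism classes and disjoint union\<close>

definition iso_maps :: "('v \<Rightarrow> 'w) \<Rightarrow> ('e \<Rightarrow> 'f) \<Rightarrow>
    ('v, 'e, 'h) spec_graph \<Rightarrow> ('w, 'f, 'h) spec_graph \<Rightarrow> bool" where
  "iso_maps f g G G' \<longleftrightarrow> (case (G, G') of ((\<Gamma>, i), (\<Gamma>', i')) \<Rightarrow>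
     bij_betw f (vertices \<Gamma>) (vertices \<Gamma>') \<and>
     bij_betw g (half_edges \<Gamma>) (half_edges \<Gamma>') \<and>
     (\<forall>e\<in>half_edges \<Gamma>. bdry \<Gamma>' (g e) = f (bdry \<Gamma> e) \<and>
        invol \<Gamma>' (g e) = g (invol \<Gamma> e) \<and> etype \<Gamma>' (g e) = etype \<Gamma> e) \<and>
     (\<forall>v\<in>vertices \<Gamma>. vindex \<Gamma>' (f v) = vindex \<Gamma> v) \<and>
     (\<forall>C\<in>pi0 \<Gamma>. i' (f ` C) = i C))"

definition spec_iso :: "('v, 'e, 'h) spec_graph \<Rightarrow> ('w, 'f, 'h) spec_graph \<Rightarrow> bool" where
  "spec_iso G G' \<longleftrightarrow> wf_spec G \<and> wf_spec G' \<and> (\<exists>f g. iso_maps f g G G')"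

definition empty_spec :: "('v, 'e, 'h) spec_graph" where
  "empty_spec = (\<lparr>vertices = {}, half_edges = {}, bdry = (\<lambda>_. undefined),
     invol = (\<lambda>_. undefined), etype = (\<lambda>_. undefined), vindex = (\<lambda>_. undefined)\<rparr>,
     \<lambda>_. undefined)"

definition union_graph ::
    "('v, 'e, 'h) fgraph \<Rightarrow> ('w, 'f, 'h) fgraph \<Rightarrow> ('v + 'w, 'e + 'f, 'h) fgraph" where
  "union_graph \<Gamma> \<Gamma>' =
     \<lparr>vertices = vertices \<Gamma> <+> vertices \<Gamma>',
      half_edges = half_edges \<Gamma> <+> half_edges \<Gamma>',
      bdry = map_sum (bdry \<Gamma>) (bdry \<Gamma>'), invol = map_sum (invol \<Gamma>) (invol \<Gamma>'),
      etype = case_sum (etype \<Gamma>) (etype \<Gamma>'), vindex = case_sum (vindex \<Gamma>) (vindex \<Gamma>')\<rparr>"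

definition disjoint_union ::
    "('v, 'e, 'h) spec_graph \<Rightarrow> ('w, 'f, 'h) spec_graph \<Rightarrow> ('v + 'w, 'e + 'f, 'h) spec_graph" where
  "disjoint_union G G' =
     (union_graph (fst G) (fst G'),
      \<lambda>C\<in>pi0 (union_graph (fst G) (fst G')).
        if C \<subseteq> range Inl then snd G (Inl -` C) else snd G' (Inr -` C))"

lemma adj_in_vertices:
  assumes "feynman_graph \<Gamma>" "(v, w) \<in> adj \<Gamma>"
  shows "v \<in> vertices \<Gamma>" "w \<in> vertices \<Gamma>"
  using assms by (auto simp: adj_def feynman_graph_def)

lemma component_of_subset:
  assumes "feynman_graph \<Gamma>" "v \<in> vertices \<Gamma>"
  shows "component_of \<Gamma> v \<subseteq> vertices \<Gamma>"
proof
  fix w assume "w \<in> component_of \<Gamma> v"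
  then have "(v, w) \<in> (adj \<Gamma>)\<^sup>*" by (simp add: component_of_def)
  then show "w \<in> vertices \<Gamma>"
    by (induction rule: rtrancl_induct) (use assms adj_in_vertices in auto)
qed

lemma rtrancl_map_image:
  assumes edge: "\<And>x y. x \<in> V \<Longrightarrow> (x, y) \<in> R \<longleftrightarrow> y \<in> V \<and> (f x, f y) \<in> R'"
    and closed: "\<And>x z. x \<in> V \<Longrightarrow> (f x, z) \<in> R' \<Longrightarrow> z \<in> f ` V"
    and v: "v \<in> V"
  shows "R'\<^sup>* `` {f v} = f ` (R\<^sup>* `` {v})"
proof (intro equalityI subsetI)
  fix z assume "z \<in> R'\<^sup>* `` {f v}"
  then have "(f v, z) \<in> R'\<^sup>*" by simp
  then have "\<exists>y\<in>V. z = f y \<and> (v, y) \<in> R\<^sup>*"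
  proof (induction rule: rtrancl_induct)
    case base
    then show ?case using v by auto
  next
    case (step y z)
    then obtain u where u: "u \<in> V" "y = f u" "(v, u) \<in> R\<^sup>*" by auto
    with step closed obtain w where w: "w \<in> V" "z = f w" by blast
    then have "(u, w) \<in> R" using u step edge by auto
    then have "(v, w) \<in> R\<^sup>*" using u by simp
    then show ?case using w by blast
  qed
  then show "z \<in> f ` (R\<^sup>* `` {v})" by auto
next
  fix z assume "z \<in> f ` (R\<^sup>* `` {v})"
  then obtain y where y: "z = f y" "(v, y) \<in> R\<^sup>*" by auto
  from y(2) have "y \<in> V \<and> (f v, f y) \<in> R'\<^sup>*"
    by (induction rule: rtrancl_induct)
      (use v edge in \<open>auto intro: rtrancl.rtrancl_into_rtrancl\<close>)
  then show "z \<in> R'\<^sup>* `` {f v}" using y by simp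
qed

lemma iso_maps_component_of:
  assumes wf: "feynman_graph \<Gamma>" "feynman_graph \<Gamma>'"
    and f: "bij_betw f (vertices \<Gamma>) (vertices \<Gamma>')"
    and g: "bij_betw g (half_edges \<Gamma>) (half_edges \<Gamma>')"
    and str: "\<And>e. e \<in> half_edges \<Gamma> \<Longrightarrow> bdry \<Gamma>' (g e) = f (bdry \<Gamma> e)"
      "\<And>e. e \<in> half_edges \<Gamma> \<Longrightarrow> invol \<Gamma>' (g e) = g (invol \<Gamma> e)"
    and v: "v \<in> vertices \<Gamma>"
  shows "component_of \<Gamma>' (f v) = f ` component_of \<Gamma> v"
proof -
  have inv_in: "invol \<Gamma> e \<in> half_edges \<Gamma>" if "e \<in> half_edges \<Gamma>" for e
    using wf that by (auto simp: feynman_graph_def)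
  have bd_in: "bdry \<Gamma> e \<in> vertices \<Gamma>" if "e \<in> half_edges \<Gamma>" for e
    using wf that by (auto simp: feynman_graph_def)
  have adj': "adj \<Gamma>' = {(f (bdry \<Gamma> e), f (bdry \<Gamma> (invol \<Gamma> e))) | e. e \<in> half_edges \<Gamma>}"
  proof -
    have "half_edges \<Gamma>' = g ` half_edges \<Gamma>" using g by (simp add: bij_betw_def)
    then have "adj \<Gamma>' = (\<lambda>e. (bdry \<Gamma>' (g e), bdry \<Gamma>' (invol \<Gamma>' (g e)))) ` half_edges \<Gamma>"
      unfolding adj_def by auto
    also have "\<dots> = (\<lambda>e. (f (bdry \<Gamma> e), f (bdry \<Gamma> (invol \<Gamma> e)))) ` half_edges \<Gamma>"
      using str inv_in by (intro image_cong) auto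
    finally show ?thesis by auto
  qed
  have inj: "x = y" if "f x = f y" "x \<in> vertices \<Gamma>" "y \<in> vertices \<Gamma>" for x y
    using f that by (auto simp: bij_betw_def inj_on_def)
  show ?thesis unfolding component_of_def
  proof (rule rtrancl_map_image[where V = "vertices \<Gamma>"])
    fix x y assume x: "x \<in> vertices \<Gamma>"
    show "(x, y) \<in> adj \<Gamma> \<longleftrightarrow> y \<in> vertices \<Gamma> \<and> (f x, f y) \<in> adj \<Gamma>'"
    proof
      assume "(x, y) \<in> adj \<Gamma>"
      then show "y \<in> vertices \<Gamma> \<and> (f x, f y) \<in> adj \<Gamma>'"
        using adj_in_vertices[OF wf(1)] unfolding adj' by (auto simp: adj_def)
    next
      assume "y \<in> vertices \<Gamma> \<and> (f x, f y) \<in> adj \<Gamma>'"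
      then obtain e where "y \<in> vertices \<Gamma>" "e \<in> half_edges \<Gamma>" "f x = f (bdry \<Gamma> e)"
        "f y = f (bdry \<Gamma> (invol \<Gamma> e))" unfolding adj' by auto
      then have "x = bdry \<Gamma> e" "y = bdry \<Gamma> (invol \<Gamma> e)"
        using inj x bd_in inv_in by auto
      then show "(x, y) \<in> adj \<Gamma>" using \<open>e \<in> half_edges \<Gamma>\<close> by (auto simp: adj_def)
    qed
  next
    fix x z assume "(f x, z) \<in> adj \<Gamma>'"
    then show "z \<in> f ` vertices \<Gamma>" unfolding adj' using bd_in inv_in by auto
  qed (rule v)
qed

lemma iso_maps_pi0:
  assumes "wf_spec G" "wf_spec G'" "iso_maps f g G G'"
  shows "pi0 (fst G') = (`) f ` pi0 (fst G)"
proof -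
  obtain \<Gamma> i \<Gamma>' i' where [simp]: "G = (\<Gamma>, i)" "G' = (\<Gamma>', i')" by (cases G, cases G') auto
  have *: "component_of \<Gamma>' (f v) = f ` component_of \<Gamma> v" if "v \<in> vertices \<Gamma>" for v
    by (rule iso_maps_component_of[where g = g])
      (use assms that in \<open>auto simp: wf_spec_def iso_maps_def\<close>)
  have "vertices \<Gamma>' = f ` vertices \<Gamma>"
    using assms by (simp add: iso_maps_def bij_betw_def)
  then have "pi0 \<Gamma>' = (\<lambda>v. component_of \<Gamma>' (f v)) ` vertices \<Gamma>"
    by (simp add: pi0_def image_image)
  also have "\<dots> = (\<lambda>v. f ` component_of \<Gamma> v) ` vertices \<Gamma>"
    using * by (intro image_cong) auto
  finally show ?thesis by (simp add: pi0_def image_image)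
qed

lemma pi0_subset: "wf_spec G \<Longrightarrow> C \<in> pi0 (fst G) \<Longrightarrow> C \<subseteq> vertices (fst G)"
  using component_of_subset by (fastforce simp: pi0_def wf_spec_def)

lemma spec_iso_refl: "wf_spec G \<Longrightarrow> spec_iso G G"
  unfolding spec_iso_def iso_maps_def
  by (auto intro!: exI[of _ id] split: prod.splits)

lemma spec_iso_sym:
  assumes "spec_iso G G'"
  shows "spec_iso G' G"
proof -
  obtain \<Gamma> i \<Gamma>' i' where G: "G = (\<Gamma>, i)" "G' = (\<Gamma>', i')" by (cases G, cases G') auto
  from assms obtain f g where wf: "wf_spec G" "wf_spec G'" and fg: "iso_maps f g G G'"
    by (auto simp: spec_iso_def)
  let ?f = "inv_into (vertices \<Gamma>) f" and ?g = "inv_into (half_edges \<Gamma>) g"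
  have f: "bij_betw f (vertices \<Gamma>) (vertices \<Gamma>')" and g: "bij_betw g (half_edges \<Gamma>) (half_edges \<Gamma>')"
    using fg by (auto simp: iso_maps_def G)
  have Hg: "\<exists>e0\<in>half_edges \<Gamma>. e = g e0" if "e \<in> half_edges \<Gamma>'" for e
    using g that by (auto simp: bij_betw_def)
  have Vf: "\<exists>v0\<in>vertices \<Gamma>. v = f v0" if "v \<in> vertices \<Gamma>'" for v
    using f that by (auto simp: bij_betw_def)
  have finv: "?f (f v) = v" if "v \<in> vertices \<Gamma>" for v
    using f that by (simp add: bij_betw_def)
  have ginv: "?g (g e) = e" if "e \<in> half_edges \<Gamma>" for e
    using g that by (simp add: bij_betw_def)
  have bd_in: "bdry \<Gamma> e \<in> vertices \<Gamma>" "invol \<Gamma> e \<in> half_edges \<Gamma>" if "e \<in> half_edges \<Gamma>" for e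
    using wf that by (auto simp: wf_spec_def feynman_graph_def G)
  have str: "bdry \<Gamma>' (g e) = f (bdry \<Gamma> e)" "invol \<Gamma>' (g e) = g (invol \<Gamma> e)"
    "etype \<Gamma>' (g e) = etype \<Gamma> e" if "e \<in> half_edges \<Gamma>" for e
    using fg that by (auto simp: iso_maps_def G)
  have "iso_maps ?f ?g G' G"
    unfolding iso_maps_def G prod.case
  proof (intro conjI ballI)
    fix e assume "e \<in> half_edges \<Gamma>'"
    then obtain e0 where e0: "e0 \<in> half_edges \<Gamma>" "e = g e0" using Hg by blast
    show "bdry \<Gamma> (?g e) = ?f (bdry \<Gamma>' e)" "invol \<Gamma> (?g e) = ?g (invol \<Gamma>' e)"
      "etype \<Gamma> (?g e) = etype \<Gamma>' e"
      using e0(1) by (simp_all add: e0(2) str bd_in finv ginv)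
  next
    fix v assume "v \<in> vertices \<Gamma>'"
    then obtain v0 where v0: "v0 \<in> vertices \<Gamma>" "v = f v0" using Vf by blast
    then show "vindex \<Gamma> (?f v) = vindex \<Gamma>' v"
      using fg by (simp add: finv iso_maps_def G)
  next
    fix C assume "C \<in> pi0 \<Gamma>'"
    then obtain D where D: "D \<in> pi0 \<Gamma>" "C = f ` D" using iso_maps_pi0[OF wf fg] G by auto
    have "D \<subseteq> vertices \<Gamma>" using pi0_subset[OF wf(1)] D by (simp add: G)
    then have "?f ` C = D" using f D(2) by (simp add: bij_betw_def inv_into_image_cancel)
    then show "i (?f ` C) = i' C" using fg D by (simp add: iso_maps_def G)
  qed (intro bij_betw_inv_into f g)+
  then show ?thesis using wf by (auto simp: spec_iso_def)
qed

lemma spec_iso_trans: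
  assumes "spec_iso G G'" "spec_iso G' G''"
  shows "spec_iso G G''"
proof -
  from assms obtain f g f' g' where wf: "wf_spec G" "wf_spec G'" "wf_spec G''"
    and m: "iso_maps f g G G'" "iso_maps f' g' G' G''"
    by (auto simp: spec_iso_def)
  have p: "f ` C \<in> pi0 (fst G')" if "C \<in> pi0 (fst G)" for C
    using iso_maps_pi0[OF wf(1,2) m(1)] that by auto
  have "iso_maps (f' \<circ> f) (g' \<circ> g) G G''"
    using m p unfolding iso_maps_def
    by (auto intro: bij_betw_trans simp: bij_betw_apply image_image[symmetric] split: prod.splits)
  then show ?thesis using wf by (auto simp: spec_iso_def)
qed

lemma wf_empty_spec: "wf_spec empty_spec"
  by (auto simp: wf_spec_def empty_spec_def feynman_graph_def pi0_def extensional_def)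

quotient_type 'h sgraph = "(nat, nat, 'h) spec_graph" / partial: spec_iso
proof (rule part_equivpI)
  show "\<exists>G :: (nat, nat, 'h) spec_graph. spec_iso G G"
    using spec_iso_refl[OF wf_empty_spec] by blast
qed (blast intro: sympI transpI spec_iso_sym spec_iso_trans)+

text \<open>The isomorphism class of a finite graph, for arbitrary types of vertices and half-edges.\<close>

definition iso_class :: "('v, 'e, 'h) spec_graph \<Rightarrow> 'h sgraph" where
  "iso_class G = abs_sgraph (SOME G'. spec_iso G G')"

lemma ex_nat_copy:
  assumes "wf_spec G"
  shows "\<exists>G' :: (nat, nat, 'h) spec_graph. spec_iso (G :: ('v, 'e, 'h) spec_graph) G'"
proof -
  obtain \<Gamma> i where G: "G = (\<Gamma>, i)" by (cases G)
  have wf: "feynman_graph \<Gamma>" using assms by (simp add: G wf_spec_def)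
  then have fin: "finite (vertices \<Gamma>)" "finite (half_edges \<Gamma>)"
    by (auto simp: feynman_graph_def)
  obtain f :: "'v \<Rightarrow> nat" where f: "inj_on f (vertices \<Gamma>)"
    using finite_imp_inj_to_nat_seg[OF fin(1)] by auto
  obtain g :: "'e \<Rightarrow> nat" where g: "inj_on g (half_edges \<Gamma>)"
    using finite_imp_inj_to_nat_seg[OF fin(2)] by auto
  let ?f = "inv_into (vertices \<Gamma>) f" and ?g = "inv_into (half_edges \<Gamma>) g"
  define \<Gamma>' :: "(nat, nat, 'h) fgraph" where
    "\<Gamma>' = \<lparr>vertices = f ` vertices \<Gamma>, half_edges = g ` half_edges \<Gamma>,
      bdry = f \<circ> bdry \<Gamma> \<circ> ?g, invol = g \<circ> invol \<Gamma> \<circ> ?g,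
      etype = etype \<Gamma> \<circ> ?g, vindex = vindex \<Gamma> \<circ> ?f\<rparr>"
  define i' where "i' = (\<lambda>C\<in>pi0 \<Gamma>'. i (?f ` C))"
  have in_G: "bdry \<Gamma> e \<in> vertices \<Gamma>" "invol \<Gamma> e \<in> half_edges \<Gamma>" "invol \<Gamma> (invol \<Gamma> e) = e"
    "etype \<Gamma> (invol \<Gamma> e) = etype \<Gamma> e" if "e \<in> half_edges \<Gamma>" for e
    using wf that by (auto simp: feynman_graph_def)
  have wf': "feynman_graph \<Gamma>'"
    using f g fin in_G by (auto simp: \<Gamma>'_def feynman_graph_def)
  have comp: "component_of \<Gamma>' (f v) = f ` component_of \<Gamma> v" if "v \<in> vertices \<Gamma>" for v
    by (rule iso_maps_component_of[where g = g])
      (use wf wf' f g that in \<open>auto simp: \<Gamma>'_def bij_betw_def\<close>)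
  have p: "f ` C \<in> pi0 \<Gamma>'" if "C \<in> pi0 \<Gamma>" for C
    using that comp by (auto simp: pi0_def \<Gamma>'_def)
  have "?f ` f ` C = C" if "C \<in> pi0 \<Gamma>" for C
    using that pi0_subset[OF assms] inv_into_image_cancel[OF f] by (auto simp: G)
  then have "iso_maps f g G (\<Gamma>', i')"
    using f g p unfolding iso_maps_def G i'_def
    by (auto simp: \<Gamma>'_def bij_betw_def)
  then show ?thesis using assms wf' by (auto simp: spec_iso_def wf_spec_def i'_def)
qed

lemma spec_iso_some: "wf_spec G \<Longrightarrow> spec_iso G (SOME G' :: (nat, nat, 'h) spec_graph. spec_iso G G')"
  using ex_nat_copy by (rule someI_ex)

lemma iso_class_eqI:
  fixes G :: "('v, 'e, 'h) spec_graph" and G' :: "('w, 'f, 'h) spec_graph"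
  shows "spec_iso G G' \<Longrightarrow> iso_class G = iso_class G'"
  unfolding iso_class_def
proof (rule Quotient_rel_abs[OF Quotient_sgraph])
  assume *: "spec_iso G G'"
  then have "wf_spec G" "wf_spec G'" by (auto simp: spec_iso_def)
  then show "spec_iso (SOME N :: (nat, nat, 'h) spec_graph. spec_iso G N)
      (SOME N :: (nat, nat, 'h) spec_graph. spec_iso G' N)"
    by (intro spec_iso_trans[OF spec_iso_sym[OF spec_iso_some] spec_iso_trans[OF * spec_iso_some]])
qed

lemma wf_rep_sgraph: "wf_spec (rep_sgraph x)"
  using Quotient_rep_reflp[OF Quotient_sgraph] by (auto simp: spec_iso_def)

lemma iso_class_rep: "iso_class (rep_sgraph x) = x"
proof -
  have "abs_sgraph (SOME G'. spec_iso (rep_sgraph x) G') = abs_sgraph (rep_sgraph x)"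
    by (rule Quotient_rel_abs[OF Quotient_sgraph])
      (rule spec_iso_sym[OF spec_iso_some[OF wf_rep_sgraph]])
  then show ?thesis
    unfolding iso_class_def using Quotient_abs_rep[OF Quotient_sgraph] by simp
qed

lemma rep_iso_class:
  fixes G :: "('v, 'e, 'h) spec_graph"
  assumes "wf_spec G"
  shows "spec_iso (rep_sgraph (iso_class G)) G"
proof -
  let ?N = "SOME G' :: (nat, nat, 'h) spec_graph. spec_iso G G'"
  have N: "spec_iso ?N G" by (rule spec_iso_sym[OF spec_iso_some[OF assms]])
  have "spec_iso ?N ?N" by (rule spec_iso_trans[OF N spec_iso_sym[OF N]])
  then have "spec_iso (rep_sgraph (abs_sgraph ?N)) ?N"
    by (rule Quotient_rep_abs[OF Quotient_sgraph])
  then show ?thesis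
    unfolding iso_class_def by (rule spec_iso_trans[OF _ N])
qed

lemma feynman_union_graph:
  "feynman_graph \<Gamma> \<Longrightarrow> feynman_graph \<Gamma>' \<Longrightarrow> feynman_graph (union_graph \<Gamma> \<Gamma>')"
  by (auto simp: feynman_graph_def union_graph_def)

lemma wf_disjoint_union: "wf_spec G \<Longrightarrow> wf_spec G' \<Longrightarrow> wf_spec (disjoint_union G G')"
  by (simp add: wf_spec_def disjoint_union_def feynman_union_graph)

lemma adj_union_graph:
  "adj (union_graph \<Gamma> \<Gamma>') = map_prod Inl Inl ` adj \<Gamma> \<union> map_prod Inr Inr ` adj \<Gamma>'"
proof -
  have "adj (union_graph \<Gamma> \<Gamma>') =
      (\<lambda>e. (map_sum (bdry \<Gamma>) (bdry \<Gamma>') e,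
        map_sum (bdry \<Gamma>) (bdry \<Gamma>') (map_sum (invol \<Gamma>) (invol \<Gamma>') e))) `
      (Inl ` half_edges \<Gamma> \<union> Inr ` half_edges \<Gamma>')"
    by (auto simp: adj_def union_graph_def)
  moreover have "adj \<Gamma> = (\<lambda>e. (bdry \<Gamma> e, bdry \<Gamma> (invol \<Gamma> e))) ` half_edges \<Gamma>"
    "adj \<Gamma>' = (\<lambda>e. (bdry \<Gamma>' e, bdry \<Gamma>' (invol \<Gamma>' e))) ` half_edges \<Gamma>'"
    by (auto simp: adj_def)
  ultimately show ?thesis by (simp only: image_Un image_image map_prod_simp map_sum.simps)
qed

lemma component_of_union_Inl:
  "component_of (union_graph \<Gamma> \<Gamma>') (Inl v) = Inl ` component_of \<Gamma> v"
  unfolding component_of_def adj_union_graph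
  by (rule rtrancl_map_image[where V = UNIV]) auto

lemma component_of_union_Inr:
  "component_of (union_graph \<Gamma> \<Gamma>') (Inr v) = Inr ` component_of \<Gamma>' v"
  unfolding component_of_def adj_union_graph
  by (rule rtrancl_map_image[where V = UNIV]) auto

lemma pi0_union_graph:
  "pi0 (union_graph \<Gamma> \<Gamma>') = (`) Inl ` pi0 \<Gamma> \<union> (`) Inr ` pi0 \<Gamma>'"
proof -
  have "vertices (union_graph \<Gamma> \<Gamma>') = Inl ` vertices \<Gamma> \<union> Inr ` vertices \<Gamma>'"
    by (auto simp: union_graph_def)
  then show ?thesis
    by (simp add: pi0_def image_Un image_image component_of_union_Inl component_of_union_Inr)
qed

lemma pi0_nonempty: "C \<in> pi0 \<Gamma> \<Longrightarrow> C \<noteq> {}"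
  by (auto simp: pi0_def component_of_def)

lemma disjoint_union_spec_Inl:
  "C \<in> pi0 (fst G) \<Longrightarrow> snd (disjoint_union G G') (Inl ` C) = snd G C"
  by (auto simp: disjoint_union_def pi0_union_graph inj_vimage_image_eq)

lemma disjoint_union_spec_Inr:
  "C \<in> pi0 (fst G') \<Longrightarrow> snd (disjoint_union G G') (Inr ` C) = snd G' C"
  by (auto simp: disjoint_union_def pi0_union_graph inj_vimage_image_eq dest: pi0_nonempty)

lemma union_graph_sel [simp]:
  "vertices (union_graph \<Gamma> \<Gamma>') = vertices \<Gamma> <+> vertices \<Gamma>'"
  "half_edges (union_graph \<Gamma> \<Gamma>') = half_edges \<Gamma> <+> half_edges \<Gamma>'"
  "bdry (union_graph \<Gamma> \<Gamma>') = map_sum (bdry \<Gamma>) (bdry \<Gamma>')"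
  "invol (union_graph \<Gamma> \<Gamma>') = map_sum (invol \<Gamma>) (invol \<Gamma>')"
  "etype (union_graph \<Gamma> \<Gamma>') = case_sum (etype \<Gamma>) (etype \<Gamma>')"
  "vindex (union_graph \<Gamma> \<Gamma>') = case_sum (vindex \<Gamma>) (vindex \<Gamma>')"
  by (simp_all add: union_graph_def)

lemma fst_disjoint_union [simp]: "fst (disjoint_union G G') = union_graph (fst G) (fst G')"
  by (simp add: disjoint_union_def)

lemma iso_maps_alt:
  "iso_maps f g G G' \<longleftrightarrow>
     bij_betw f (vertices (fst G)) (vertices (fst G')) \<and>
     bij_betw g (half_edges (fst G)) (half_edges (fst G')) \<and>
     (\<forall>e\<in>half_edges (fst G). bdry (fst G') (g e) = f (bdry (fst G) e) \<and>
        invol (fst G') (g e) = g (invol (fst G) e) \<and> etype (fst G') (g e) = etype (fst G) e) \<and>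
     (\<forall>v\<in>vertices (fst G). vindex (fst G') (f v) = vindex (fst G) v) \<and>
     (\<forall>C\<in>pi0 (fst G). snd G' (f ` C) = snd G C)"
  by (simp add: iso_maps_def split: prod.splits)

lemma bij_betw_map_sum:
  "bij_betw f A B \<Longrightarrow> bij_betw g C D \<Longrightarrow> bij_betw (map_sum f g) (A <+> C) (B <+> D)"
proof (rule bij_betw_imageI)
  assume fg: "bij_betw f A B" "bij_betw g C D"
  then show "inj_on (map_sum f g) (A <+> C)"
    by (auto intro!: inj_onI dest!: bij_betw_imp_inj_on dest: inj_onD)
  have "map_sum f g ` (A <+> C) = Inl ` f ` A \<union> Inr ` g ` C"
    by (simp add: Plus_def image_Un image_image)
  then show "map_sum f g ` (A <+> C) = B <+> D"
    using fg by (simp add: bij_betw_imp_surj_on Plus_def)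
qed

lemma disjoint_union_cong:
  assumes "spec_iso A A'" "spec_iso B B'"
  shows "spec_iso (disjoint_union A B) (disjoint_union A' B')"
proof -
  from assms obtain f g f' g' where wf: "wf_spec A" "wf_spec A'" "wf_spec B" "wf_spec B'"
    and m: "iso_maps f g A A'" "iso_maps f' g' B B'"
    by (auto simp: spec_iso_def)
  have p: "f ` C \<in> pi0 (fst A')" if "C \<in> pi0 (fst A)" for C
    using iso_maps_pi0[OF wf(1,2) m(1)] that by auto
  have q: "f' ` C \<in> pi0 (fst B')" if "C \<in> pi0 (fst B)" for C
    using iso_maps_pi0[OF wf(3,4) m(2)] that by auto
  have i1: "map_sum f f' ` Inl ` C = Inl ` f ` C" for C by (auto simp: image_image)
  have i2: "map_sum f f' ` Inr ` C = Inr ` f' ` C" for C by (auto simp: image_image)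
  have "iso_maps (map_sum f f') (map_sum g g') (disjoint_union A B) (disjoint_union A' B')"
    using m p q unfolding iso_maps_alt
    by (auto simp: bij_betw_map_sum pi0_union_graph i1 i2
        disjoint_union_spec_Inl disjoint_union_spec_Inr)
  then show ?thesis using wf by (auto simp: spec_iso_def wf_disjoint_union)
qed

lemma iso_class_disjoint_union_rep:
  assumes "wf_spec A" "wf_spec B"
  shows "iso_class (disjoint_union (rep_sgraph (iso_class A)) (rep_sgraph (iso_class B))) =
    iso_class (disjoint_union A B)"
  using assms by (intro iso_class_eqI disjoint_union_cong rep_iso_class)

lemma disjoint_union_commute:
  assumes "wf_spec A" "wf_spec B"
  shows "spec_iso (disjoint_union A B) (disjoint_union B A)"
proof -
  let ?s = "\<lambda>x. case x of Inl a \<Rightarrow> Inr a | Inr b \<Rightarrow> Inl b"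
  have b: "bij_betw ?s (X <+> Y) (Y <+> X)" for X :: "'x set" and Y :: "'y set"
    by (rule bij_betw_byWitness[where f' = ?s]) (auto simp: Plus_def)
  have "iso_maps ?s ?s (disjoint_union A B) (disjoint_union B A)"
    unfolding iso_maps_alt
    by (auto simp: b pi0_union_graph image_image disjoint_union_spec_Inl disjoint_union_spec_Inr)
  then show ?thesis using assms by (auto simp: spec_iso_def wf_disjoint_union)
qed

lemma disjoint_union_assoc:
  assumes "wf_spec A" "wf_spec B" "wf_spec C"
  shows "spec_iso (disjoint_union (disjoint_union A B) C) (disjoint_union A (disjoint_union B C))"
proof -
  let ?s = "\<lambda>x. case x of Inl y \<Rightarrow> (case y of Inl a \<Rightarrow> Inl a | Inr b \<Rightarrow> Inr (Inl b)) | Inr c \<Rightarrow> Inr (Inr c)"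
  let ?t = "\<lambda>x. case x of Inl a \<Rightarrow> Inl (Inl a) | Inr y \<Rightarrow> (case y of Inl b \<Rightarrow> Inl (Inr b) | Inr c \<Rightarrow> Inr c)"
  have b: "bij_betw ?s ((X <+> Y) <+> Z) (X <+> (Y <+> Z))"
    for X :: "'x set" and Y :: "'y set" and Z :: "'z set"
    by (rule bij_betw_byWitness[where f' = ?t]) (auto simp: Plus_def)
  have i: "?s ` Inl ` Inl ` X = Inl ` X" "?s ` Inl ` Inr ` Y = Inr ` Inl ` Y"
    "?s ` Inr ` Z = Inr ` Inr ` Z" for X :: "'x set" and Y :: "'y set" and Z :: "'z set"
    by (simp_all add: image_image)
  have "iso_maps ?s ?s (disjoint_union (disjoint_union A B) C) (disjoint_union A (disjoint_union B C))"
    unfolding iso_maps_alt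
    by (auto simp: b i pi0_union_graph image_Un disjoint_union_spec_Inl disjoint_union_spec_Inr)
  then show ?thesis using assms by (auto simp: spec_iso_def wf_disjoint_union)
qed

lemma disjoint_union_empty:
  assumes "wf_spec A"
  shows "spec_iso (disjoint_union empty_spec A) A"
proof -
  let ?s = "\<lambda>x. case x of Inl y \<Rightarrow> undefined | Inr c \<Rightarrow> c"
  have b: "bij_betw ?s ({} <+> X) X" for X :: "'x set"
    by (rule bij_betw_byWitness[where f' = Inr]) (auto simp: Plus_def)
  have e: "vertices (fst empty_spec) = {}" "half_edges (fst empty_spec) = {}"
    "pi0 (fst empty_spec) = {}"
    by (auto simp: empty_spec_def pi0_def)
  have "iso_maps ?s ?s (disjoint_union empty_spec A) A"
    unfolding iso_maps_alt
    by (auto simp: b e pi0_union_graph image_image disjoint_union_spec_Inr)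
  then show ?thesis using assms by (auto simp: spec_iso_def wf_disjoint_union wf_empty_spec)
qed

text \<open>
  With this instance, the convolution product of \<open>'h sgraph \<Rightarrow>\<^sub>0 'k\<close> is the bilinear extension
  of the disjoint union, and its unit is the empty graph.
\<close>

instantiation sgraph :: (type) comm_monoid_add
begin

definition zero_sgraph :: "'a sgraph" where
  "zero_sgraph = iso_class (empty_spec :: (nat, nat, 'a) spec_graph)"

definition plus_sgraph :: "'a sgraph \<Rightarrow> 'a sgraph \<Rightarrow> 'a sgraph" where
  "plus_sgraph x y = iso_class (disjoint_union (rep_sgraph x) (rep_sgraph y))"

lemma plus_iso_class:
  "wf_spec A \<Longrightarrow> wf_spec B \<Longrightarrow> iso_class A + iso_class B = iso_class (disjoint_union A B)"
  by (simp add: plus_sgraph_def iso_class_disjoint_union_rep)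

instance
proof
  fix a b c :: "'a sgraph"
  let ?a = "rep_sgraph a" and ?b = "rep_sgraph b" and ?c = "rep_sgraph c"
  have wf: "wf_spec ?a" "wf_spec ?b" "wf_spec ?c" by (rule wf_rep_sgraph)+
  have abc: "a = iso_class ?a" "b = iso_class ?b" "c = iso_class ?c"
    by (simp_all add: iso_class_rep)
  have "iso_class ?a + iso_class ?b + iso_class ?c = iso_class ?a + (iso_class ?b + iso_class ?c)"
    using wf by (simp add: plus_iso_class wf_disjoint_union iso_class_eqI disjoint_union_assoc)
  then show "a + b + c = a + (b + c)" by (simp add: iso_class_rep)
  have "iso_class ?a + iso_class ?b = iso_class ?b + iso_class ?a"
    using wf by (simp add: plus_iso_class iso_class_eqI disjoint_union_commute)
  then show "a + b = b + a" by (simp add: iso_class_rep)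
  have "0 + iso_class ?a = iso_class ?a"
    using wf by (simp add: zero_sgraph_def plus_iso_class wf_empty_spec iso_class_eqI
        disjoint_union_empty)
  then show "0 + a = a" by (simp add: iso_class_rep)
qed

end


section \<open>Free vector spaces, tensor products and comodule-coalgebras\<close>

text \<open>
  The free vector space with basis \<open>'a\<close> is \<open>'a \<Rightarrow>\<^sub>0 'k\<close>. The tensor product of the free
  vector spaces with bases \<open>'a\<close> and \<open>'b\<close> is the free vector space with basis \<open>'a \<times> 'b\<close>,
  where \<open>single (a, b) 1\<close> is \<open>single a 1 \<otimes> single b 1\<close>.
\<close>

definition scale :: "'k::field \<Rightarrow> ('a \<Rightarrow>\<^sub>0 'k) \<Rightarrow> ('a \<Rightarrow>\<^sub>0 'k)" where
  "scale c x = Poly_Mapping.map ((*) c) x"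

definition lin_ext :: "('a \<Rightarrow> ('b \<Rightarrow>\<^sub>0 'k::field)) \<Rightarrow> ('a \<Rightarrow>\<^sub>0 'k) \<Rightarrow> ('b \<Rightarrow>\<^sub>0 'k)" where
  "lin_ext f x = (\<Sum>a\<in>Poly_Mapping.keys x. scale (Poly_Mapping.lookup x a) (f a))"

definition free_on :: "'a set \<Rightarrow> ('a \<Rightarrow>\<^sub>0 'k::field) set" where
  "free_on B = {x. Poly_Mapping.keys x \<subseteq> B}"

definition tensor :: "('a \<Rightarrow>\<^sub>0 'k::field) \<Rightarrow> ('b \<Rightarrow>\<^sub>0 'k) \<Rightarrow> ('a \<times> 'b \<Rightarrow>\<^sub>0 'k)"
    (infixr \<open>\<otimes>\<close> 75) where
  "x \<otimes> y = (\<Sum>a\<in>Poly_Mapping.keys x. \<Sum>b\<in>Poly_Mapping.keys y. Poly_Mapping.single (a, b) (Poly_Mapping.lookup x a * Poly_Mapping.lookup y b))"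

definition tensor_map :: "(('a \<Rightarrow>\<^sub>0 'k::field) \<Rightarrow> ('c \<Rightarrow>\<^sub>0 'k)) \<Rightarrow> (('b \<Rightarrow>\<^sub>0 'k) \<Rightarrow> ('d \<Rightarrow>\<^sub>0 'k)) \<Rightarrow>
    ('a \<times> 'b \<Rightarrow>\<^sub>0 'k) \<Rightarrow> ('c \<times> 'd \<Rightarrow>\<^sub>0 'k)" where
  "tensor_map F G =
     lin_ext (\<lambda>(a, b). F (Poly_Mapping.single a 1) \<otimes> G (Poly_Mapping.single b 1))"

definition tensor_assoc :: "(('a \<times> 'b) \<times> 'c \<Rightarrow>\<^sub>0 'k::field) \<Rightarrow> ('a \<times> 'b \<times> 'c \<Rightarrow>\<^sub>0 'k)" where
  "tensor_assoc = lin_ext (\<lambda>((a, b), c). Poly_Mapping.single (a, b, c) 1)"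

text \<open>\<open>\<epsilon> \<otimes> I\<close>, followed by the identification of \<open>k \<otimes> C\<close> with \<open>C\<close>.\<close>

definition functional_tensor_id ::
    "(('a \<Rightarrow>\<^sub>0 'k::field) \<Rightarrow> 'k) \<Rightarrow> ('a \<times> 'b \<Rightarrow>\<^sub>0 'k) \<Rightarrow> ('b \<Rightarrow>\<^sub>0 'k)" where
  "functional_tensor_id \<epsilon> =
     lin_ext (\<lambda>(a, b). scale (\<epsilon> (Poly_Mapping.single a 1)) (Poly_Mapping.single b 1))"

definition mult_map :: "('a \<times> 'a \<Rightarrow>\<^sub>0 'k::field) \<Rightarrow> ('a::comm_monoid_add \<Rightarrow>\<^sub>0 'k)" where
  "mult_map = lin_ext (\<lambda>(a, b). Poly_Mapping.single a 1 * Poly_Mapping.single b 1)"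

definition tau23 ::
    "(('a \<times> 'b) \<times> ('c \<times> 'd) \<Rightarrow>\<^sub>0 'k::field) \<Rightarrow> (('a \<times> 'c) \<times> ('b \<times> 'd) \<Rightarrow>\<^sub>0 'k)" where
  "tau23 = lin_ext (\<lambda>((a, b), (c, d)). Poly_Mapping.single ((a, c), (b, d)) 1)"

definition m13 ::
    "(('a::comm_monoid_add \<times> 'b) \<times> ('a \<times> 'd) \<Rightarrow>\<^sub>0 'k::field) \<Rightarrow> ('a \<times> ('b \<times> 'd) \<Rightarrow>\<^sub>0 'k)" where
  "m13 = tensor_map mult_map (\<lambda>z. z) \<circ> tau23"

text \<open>
  In the following two definitions \<open>A\<close> and \<open>C\<close> are the bases of the coalgebra \<open>(\<Delta>, \<epsilon>)\<close>
  and of the comodule with coaction \<open>\<rho>\<close>.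
\<close>

definition left_coaction ::
    "'a set \<Rightarrow> (('a \<Rightarrow>\<^sub>0 'k::field) \<Rightarrow> ('a \<times> 'a \<Rightarrow>\<^sub>0 'k)) \<Rightarrow> (('a \<Rightarrow>\<^sub>0 'k) \<Rightarrow> 'k) \<Rightarrow>
     'b set \<Rightarrow> (('b \<Rightarrow>\<^sub>0 'k) \<Rightarrow> ('a \<times> 'b \<Rightarrow>\<^sub>0 'k)) \<Rightarrow> bool" where
  "left_coaction A \<Delta> \<epsilon> C \<rho> \<longleftrightarrow>
     Vector_Spaces.linear scale scale \<rho> \<and>
     \<rho> \<in> free_on C \<rightarrow> free_on (A \<times> C) \<and>
     (\<forall>x\<in>free_on C.
        tensor_assoc (tensor_map \<Delta> (\<lambda>z. z) (\<rho> x)) = tensor_map (\<lambda>z. z) \<rho> (\<rho> x) \<and>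
        functional_tensor_id \<epsilon> (\<rho> x) = x)"

definition comodule_coalgebra ::
    "'a::comm_monoid_add set \<Rightarrow> (('a \<Rightarrow>\<^sub>0 'k::field) \<Rightarrow> ('a \<times> 'a \<Rightarrow>\<^sub>0 'k)) \<Rightarrow>
     (('a \<Rightarrow>\<^sub>0 'k) \<Rightarrow> 'k) \<Rightarrow> 'b set \<Rightarrow> (('b \<Rightarrow>\<^sub>0 'k) \<Rightarrow> ('b \<times> 'b \<Rightarrow>\<^sub>0 'k)) \<Rightarrow>
     (('b \<Rightarrow>\<^sub>0 'k) \<Rightarrow> ('a \<times> 'b \<Rightarrow>\<^sub>0 'k)) \<Rightarrow> bool" where
  "comodule_coalgebra A \<Delta> \<epsilon> C \<Psi> \<rho> \<longleftrightarrow>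
     left_coaction A \<Delta> \<epsilon> C \<rho> \<and>
     (\<forall>x\<in>free_on C.
        tensor_map (\<lambda>z. z) \<Psi> (\<rho> x) = m13 (tensor_map \<rho> \<rho> (\<Psi> x)))"

definition unital_subalgebra :: "('a::comm_monoid_add \<Rightarrow>\<^sub>0 'k::field) set \<Rightarrow> bool" where
  "unital_subalgebra A \<longleftrightarrow> 1 \<in> A \<and>
     (\<forall>x\<in>A. \<forall>y\<in>A. x + y \<in> A \<and> x * y \<in> A) \<and> (\<forall>c. \<forall>x\<in>A. scale c x \<in> A)"

definition algebra_iso ::
    "('a::comm_monoid_add \<Rightarrow>\<^sub>0 'k::field) set \<Rightarrow> ('b::comm_monoid_add \<Rightarrow>\<^sub>0 'k) set \<Rightarrow>
     (('a \<Rightarrow>\<^sub>0 'k) \<Rightarrow> ('b \<Rightarrow>\<^sub>0 'k)) \<Rightarrow> bool" where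
  "algebra_iso A B \<phi> \<longleftrightarrow>
     unital_subalgebra A \<and> unital_subalgebra B \<and> bij_betw \<phi> A B \<and> \<phi> 1 = 1 \<and>
     (\<forall>x\<in>A. \<forall>y\<in>A. \<phi> (x + y) = \<phi> x + \<phi> y \<and> \<phi> (x * y) = \<phi> x * \<phi> y) \<and>
     (\<forall>c. \<forall>x\<in>A. \<phi> (scale c x) = scale c (\<phi> x))"


section \<open>The bialgebras of specified graphs\<close>

text \<open>
  \<open>\<H>\<close> is the span of \<open>spec_basis\<close>, with the disjoint union as product. The space of
  generators \<open>V\<close> is the span of \<open>conn_basis\<close>, and \<open>\<H>'\<close> is the symmetric algebra \<open>S(V)\<close>,
  that is, the polynomial algebra on \<open>conn_basis\<close>: its basis consists of the monomials, which
  are the finite multisets over \<open>conn_basis\<close>, and its product adds multisets.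
\<close>

definition spec_basis :: "'h qft \<Rightarrow> 'h sgraph set" where
  "spec_basis T = {iso_class G | G :: (nat, nat, 'h) spec_graph. specified_graph T G}"

definition conn_basis :: "'h qft \<Rightarrow> 'h sgraph set" where
  "conn_basis T = {iso_class G | G :: (nat, nat, 'h) spec_graph.
     specified_graph T G \<and> graph_connected (fst G)}"

definition sym_basis :: "'h qft \<Rightarrow> 'h sgraph multiset set" where
  "sym_basis T = {M. set_mset M \<subseteq> conn_basis T}"

text \<open>A specified graph as an element of \<open>\<H>\<close> and as an element of \<open>\<H>' = S(V)\<close>.\<close>

definition graph_elem :: "('v, 'e, 'h) spec_graph \<Rightarrow> ('h sgraph \<Rightarrow>\<^sub>0 'k::field)" where
  "graph_elem G = Poly_Mapping.single (iso_class G) 1"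

definition component_classes :: "('v, 'e, 'h) spec_graph \<Rightarrow> 'h sgraph multiset" where
  "component_classes G =
     image_mset (\<lambda>C. iso_class (spec_component G C)) (mset_set (pi0 (fst G)))"

definition sym_elem :: "('v, 'e, 'h) spec_graph \<Rightarrow> ('h sgraph multiset \<Rightarrow>\<^sub>0 'k::field)" where
  "sym_elem G = Poly_Mapping.single (component_classes G) 1"

text \<open>
  The coproduct and the coaction are computed on representatives, here on \<open>rep_sgraph\<close> and on
  an arbitrarily chosen specified graph with the given components.
\<close>

definition coproduct ::
    "'h qft \<Rightarrow> ('h sgraph \<Rightarrow>\<^sub>0 'k::field) \<Rightarrow> ('h sgraph \<times> 'h sgraph \<Rightarrow>\<^sub>0 'k)" where
  "coproduct T = lin_ext (\<lambda>x. let G = rep_sgraph x in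
     \<Sum>g\<in>coproduct_subgraphs T G. graph_elem g \<otimes> graph_elem (contract G g))"

definition coaction ::
    "'h qft \<Rightarrow> ('h sgraph multiset \<Rightarrow>\<^sub>0 'k::field) \<Rightarrow> ('h sgraph \<times> 'h sgraph multiset \<Rightarrow>\<^sub>0 'k)" where
  "coaction T = lin_ext (\<lambda>M.
     let G = (SOME G :: (nat, nat, 'h) spec_graph.
       specified_graph T G \<and> component_classes G = M) in
     \<Sum>g\<in>coproduct_subgraphs T G. graph_elem g \<otimes> sym_elem (contract G g))"

text \<open>The counit of \<open>\<H>\<close>: a graph is mapped to 1 if it has no internal edge, and to 0 otherwise.\<close>

definition counit :: "('h sgraph \<Rightarrow>\<^sub>0 'k::field) \<Rightarrow> 'k" where
  "counit x = (\<Sum>a\<in>Poly_Mapping.keys x. if internal (fst (rep_sgraph a)) = {} then Poly_Mapping.lookup x a else 0)"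

text \<open>The multiplicative map for which every generator \<open>x\<close> is primitive.\<close>

definition unshuffle :: "('b multiset \<Rightarrow>\<^sub>0 'k::field) \<Rightarrow> ('b multiset \<times> 'b multiset \<Rightarrow>\<^sub>0 'k)" where
  "unshuffle = lin_ext (\<lambda>M. \<Prod>x\<in>#M.
     Poly_Mapping.single {#x#} 1 \<otimes> 1 + 1 \<otimes> Poly_Mapping.single {#x#} 1)"

end

theory Submission
  imports Defs
begin

text \<open>
  Everything rests on one fact about graphs, the analogue of the third isomorphism theorem: for a
  covering subgraph \<open>\<delta>\<close> of \<open>\<Gamma>\<close>, the map
  \<open>\<gamma> \<mapsto> \<gamma>/\<delta>\<close> is a bijection from the specified graphs between
  \<open>\<delta>\<close> and \<open>\<Gamma>\<close> to the specified covering subgraphs of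
  \<open>\<Gamma>/\<delta>\<close>, and \<open>(\<Gamma>/\<delta>)/(\<gamma>/\<delta>)\<close> is isomorphic to
  \<open>\<Gamma>/\<gamma>\<close> (\<open>coassociativity_bij\<close>). Both iterated coactions are thus the
  sum of \<open>\<delta> \<otimes> \<gamma>/\<delta> \<otimes> \<Gamma>/\<gamma>\<close> over all chains
  \<open>\<delta> \<subseteq> \<gamma> \<subseteq> \<Gamma>\<close>. The counit selects the one covering
  subgraph without internal edges, whose contraction gives back \<open>\<Gamma>\<close>
  (\<open>edgeless_subgraph\<close>).

  Being 1PI has to pass through this bijection in both directions. Locally 1PI means that no edge
  is a bridge. The components of \<open>\<Gamma>/\<gamma>\<close> are the images of the components of
  \<open>\<Gamma>\<close>, also after an edge outside \<open>\<gamma>\<close> has been cut, so contraction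
  neither creates nor destroys bridges (\<open>bridge_contract_graph\<close>). The specifications are
  handled vertex by vertex (\<open>spec_at_contract_graph\<close>): the vertex types of
  \<open>\<Gamma>/\<gamma>\<close> are the residues of the components of \<open>\<gamma>\<close> with their
  indices, the residues of \<open>\<Gamma>/\<gamma>\<close> are those of \<open>\<Gamma>\<close>, and the
  agreement of the two specifications on common components says that a vertex of
  \<open>\<Gamma>/\<gamma>\<close> without internal edges is specified by its own index.

  A graph is the disjoint union of its components, in a unique way up to isomorphism. Hence the
  specified graphs form the free commutative monoid on the connected ones, which gives the
  isomorphism of algebras. A covering subgraph of a disjoint union is a pair of covering
  subgraphs, so the coaction is multiplicative (\<open>coaction_mult\<close>). So are \<open>\<Psi>\<close>
  and \<open>m\<^sup>1\<^sup>3\<close>, and the condition that \<open>\<Psi>\<close> is a morphism of comodules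
  only has to be verified on generators. There it holds because contractions of connected graphs
  are connected, hence primitive (\<open>coaction_unshuffle\<close>).

  Coproduct and coaction are computed on chosen representatives of isomorphism classes. An
  isomorphism of graphs carries the covering subgraphs of one bijectively to those of the other,
  together with their contractions, so the choice does not matter
  (\<open>coproduct_subgraphs_sum_iso\<close>).
\<close>

section \<open>Linear extension and tensor products of free vector spaces\<close>

lemma lookup_scale: "Poly_Mapping.lookup (scale c x) a = c * Poly_Mapping.lookup x a"
  by (simp add: scale_def Poly_Mapping.map.rep_eq when_def)

lemma scale_simps [simp]:
  "scale 0 x = 0" "scale 1 x = x" "scale c 0 = 0"
  "scale c (Poly_Mapping.single a d) = Poly_Mapping.single a (c * d)"
  "scale c (scale d x) = scale (c * d) x"
  by (auto intro!: poly_mapping_eqI simp: lookup_scale lookup_single when_def mult.assoc)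

lemma scale_add: "scale c (x + y) = scale c x + scale c y"
  by (auto intro!: poly_mapping_eqI simp: lookup_scale lookup_add algebra_simps)

lemma scale_add_left: "scale (c + d) x = scale c x + scale d x"
  by (auto intro!: poly_mapping_eqI simp: lookup_scale lookup_add algebra_simps)

lemma scale_sum: "scale c (\<Sum>a\<in>A. f a) = (\<Sum>a\<in>A. scale c (f a))"
  by (induction A rule: infinite_finite_induct) (auto simp: scale_add)

lemma scale_mult:
  fixes x y :: "'a::comm_monoid_add \<Rightarrow>\<^sub>0 'b::field"
  shows "scale c x * y = scale c (x * y)" "x * scale c y = scale c (x * y)"
proof -
  have s: "scale c z = Poly_Mapping.single 0 c * z"
    for c :: "'d::field" and z :: "'c::monoid_add \<Rightarrow>\<^sub>0 'd::field"
  proof -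
    have "Poly_Mapping.map ((*) c) z = Poly_Mapping.single 0 c * z"
      by (rule mult_map_scale_conv_mult)
    then show ?thesis by (simp add: scale_def)
  qed
  show "scale c x * y = scale c (x * y)" "x * scale c y = scale c (x * y)"
    by (simp_all add: s mult.assoc mult.left_commute)
qed

lemma lin_ext_superset:
  assumes "finite A" "Poly_Mapping.keys x \<subseteq> A"
  shows "lin_ext f x = (\<Sum>a\<in>A. scale (Poly_Mapping.lookup x a) (f a))"
  unfolding lin_ext_def using assms
  by (intro sum.mono_neutral_left) (auto simp: in_keys_iff)

lemma lin_ext_single [simp]: "lin_ext f (Poly_Mapping.single a c) = scale c (f a)"
  by (subst lin_ext_superset[of "{a}"]) auto

lemma lin_ext_zero [simp]: "lin_ext f 0 = 0"
  by (simp add: lin_ext_def)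

lemma lin_ext_add: "lin_ext f (x + y) = lin_ext f x + lin_ext f y"
proof -
  let ?A = "Poly_Mapping.keys x \<union> Poly_Mapping.keys y"
  have "Poly_Mapping.keys (x + y) \<subseteq> ?A" by (rule Poly_Mapping.keys_add)
  then have "lin_ext f (x + y) = (\<Sum>a\<in>?A. scale (Poly_Mapping.lookup (x + y) a) (f a))"
    "lin_ext f x = (\<Sum>a\<in>?A. scale (Poly_Mapping.lookup x a) (f a))"
    "lin_ext f y = (\<Sum>a\<in>?A. scale (Poly_Mapping.lookup y a) (f a))"
    by (intro lin_ext_superset; auto)+
  then show ?thesis by (simp add: lookup_add scale_add_left sum.distrib)
qed

lemma lin_ext_sum: "lin_ext f (\<Sum>a\<in>A. g a) = (\<Sum>a\<in>A. lin_ext f (g a))"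
  by (induction A rule: infinite_finite_induct) (auto simp: lin_ext_add)

lemma lin_ext_scale: "lin_ext f (scale c x) = scale c (lin_ext f x)"
proof -
  have "Poly_Mapping.keys (scale c x) \<subseteq> Poly_Mapping.keys x"
    by (auto simp: in_keys_iff lookup_scale)
  then have "lin_ext f (scale c x) =
      (\<Sum>a\<in>Poly_Mapping.keys x. scale (Poly_Mapping.lookup (scale c x) a) (f a))"
    by (intro lin_ext_superset) auto
  then show ?thesis by (simp add: lin_ext_def[of f x] scale_sum lookup_scale)
qed

lemma lin_ext_lin_ext: "lin_ext f (lin_ext g x) = lin_ext (\<lambda>a. lin_ext f (g a)) x"
  unfolding lin_ext_def[of g] lin_ext_sum lin_ext_scale by (simp add: lin_ext_def)

lemma lin_ext_cong:
  "x \<in> free_on B \<Longrightarrow> (\<And>a. a \<in> B \<Longrightarrow> f a = g a) \<Longrightarrow> lin_ext f x = lin_ext g x"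
  unfolding lin_ext_def free_on_def by (intro sum.cong) auto

lemma lin_ext_singles: "lin_ext (\<lambda>a. Poly_Mapping.single a 1) x = x"
proof (rule poly_mapping_eqI)
  fix b
  have "Poly_Mapping.lookup (lin_ext (\<lambda>a. Poly_Mapping.single a 1) x) b =
      (\<Sum>a\<in>Poly_Mapping.keys x. if a = b then Poly_Mapping.lookup x a else 0)"
    by (simp add: lin_ext_def lookup_sum lookup_single when_def)
  also have "\<dots> = Poly_Mapping.lookup x b"
    by (simp add: in_keys_iff)
  finally show "Poly_Mapping.lookup (lin_ext (\<lambda>a. Poly_Mapping.single a 1) x) b =
    Poly_Mapping.lookup x b" .
qed

lemma vector_space_scale: "vector_space scale"
  by unfold_locales (simp_all add: scale_add scale_add_left)

lemma sum_singles:
  "x = (\<Sum>a\<in>Poly_Mapping.keys x. Poly_Mapping.single a (Poly_Mapping.lookup x a :: 'k::field))"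
  using lin_ext_singles[of x] by (simp add: lin_ext_def)

lemma linear_lin_ext: "Vector_Spaces.linear scale scale (lin_ext f)"
  unfolding Vector_Spaces.linear_iff
  by (simp add: vector_space_scale lin_ext_add lin_ext_scale)

lemma free_on_single [simp]: "a \<in> B \<Longrightarrow> Poly_Mapping.single a c \<in> free_on B"
  by (auto simp: free_on_def)

lemma free_on_zero [simp]: "0 \<in> free_on B"
  by (simp add: free_on_def)

lemma free_on_add: "x \<in> free_on B \<Longrightarrow> y \<in> free_on B \<Longrightarrow> x + y \<in> free_on B"
  unfolding free_on_def using Poly_Mapping.keys_add[of x y] by blast

lemma free_on_scale: "x \<in> free_on B \<Longrightarrow> scale c x \<in> free_on B"
  by (auto simp: free_on_def in_keys_iff lookup_scale)

lemma free_on_sum: "(\<And>a. a \<in> A \<Longrightarrow> f a \<in> free_on B) \<Longrightarrow> (\<Sum>a\<in>A. f a) \<in> free_on B"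
  by (induction A rule: infinite_finite_induct) (auto simp: free_on_add)

lemma free_on_mult:
  assumes "\<And>a b. a \<in> B \<Longrightarrow> b \<in> B \<Longrightarrow> a + b \<in> B" "x \<in> free_on B" "y \<in> free_on B"
  shows "x * y \<in> free_on B"
  using assms Poly_Mapping.keys_mult[of x y] by (fastforce simp: free_on_def)

lemma lin_ext_free_on:
  "x \<in> free_on A \<Longrightarrow> (\<And>a. a \<in> A \<Longrightarrow> f a \<in> free_on B) \<Longrightarrow> lin_ext f x \<in> free_on B"
  unfolding lin_ext_def by (intro free_on_sum free_on_scale) (auto simp: free_on_def)

text \<open>
  A linear map that is multiplicative on a basis closed under addition is an algebra morphism on
  its span. The basis is a set \<open>B\<close> rather than the whole monoid because the coaction is
  only controlled on monomials in specified graphs.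
\<close>

lemma lin_ext_mult:
  fixes f :: "'a::comm_monoid_add \<Rightarrow> ('b::comm_monoid_add \<Rightarrow>\<^sub>0 'k::field)"
  assumes "\<And>a b. a \<in> B \<Longrightarrow> b \<in> B \<Longrightarrow> f (a + b) = f a * f b"
    and "x \<in> free_on B" "y \<in> free_on B"
  shows "lin_ext f (x * y) = lin_ext f x * lin_ext f y"
proof -
  let ?l = Poly_Mapping.lookup and ?X = "Poly_Mapping.keys x" and ?Y = "Poly_Mapping.keys y"
  have "x * y = (\<Sum>a\<in>?X. \<Sum>b\<in>?Y. Poly_Mapping.single (a + b) (?l x a * ?l y b))"
    by (subst sum_singles[of x], subst sum_singles[of y]) (simp add: sum_product mult_single)
  then have "lin_ext f (x * y) = (\<Sum>a\<in>?X. \<Sum>b\<in>?Y. scale (?l x a * ?l y b) (f (a + b)))"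
    by (simp add: lin_ext_sum)
  also have "\<dots> = (\<Sum>a\<in>?X. \<Sum>b\<in>?Y. scale (?l x a) (f a) * scale (?l y b) (f b))"
  proof (intro sum.cong refl)
    fix a b assume "a \<in> ?X" "b \<in> ?Y"
    then have "a \<in> B" "b \<in> B" using assms by (auto simp: free_on_def)
    then show "scale (?l x a * ?l y b) (f (a + b)) = scale (?l x a) (f a) * scale (?l y b) (f b)"
      by (simp add: assms(1) scale_mult mult.commute)
  qed
  also have "\<dots> = lin_ext f x * lin_ext f y"
    by (simp add: lin_ext_def sum_product)
  finally show ?thesis .
qed

lemma tensor_alt: "x \<otimes> y = lin_ext (\<lambda>a. lin_ext (\<lambda>b. Poly_Mapping.single (a, b) 1) y) x"
  by (simp add: tensor_def lin_ext_def scale_sum)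

lemma tensor_single [simp]:
  "Poly_Mapping.single a c \<otimes> Poly_Mapping.single b d = Poly_Mapping.single (a, b) (c * d)"
  by (simp add: tensor_alt)

lemma tensor_sum_left: "(\<Sum>a\<in>A. f a) \<otimes> z = (\<Sum>a\<in>A. f a \<otimes> z)"
  by (simp add: tensor_alt lin_ext_sum)

lemma lin_ext_plus_fun: "lin_ext (\<lambda>a. f a + g a) x = lin_ext f x + lin_ext g x"
  by (simp add: lin_ext_def scale_add sum.distrib)

lemma tensor_add_right: "z \<otimes> (x + y) = z \<otimes> x + z \<otimes> y"
  by (simp add: tensor_alt lin_ext_add lin_ext_plus_fun)

lemma tensor_zero [simp]: "0 \<otimes> x = 0" "x \<otimes> 0 = 0"
  by (simp_all add: tensor_def)

lemma tensor_sum_right: "z \<otimes> (\<Sum>a\<in>A. f a) = (\<Sum>a\<in>A. z \<otimes> f a)"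
  by (induction A rule: infinite_finite_induct) (auto simp: tensor_add_right)

text \<open>
  The product of \<open>'a \<times> 'b \<Rightarrow>\<^sub>0 'k\<close> is the usual product of a tensor product of algebras, so the
  multiplicativity arguments below can use tensor products of algebra morphisms.
\<close>

lemma tensor_mult:
  fixes x x' :: "'a::comm_monoid_add \<Rightarrow>\<^sub>0 'c::field" and y y' :: "'b::comm_monoid_add \<Rightarrow>\<^sub>0 'c"
  shows "(x \<otimes> y) * (x' \<otimes> y') = (x * x') \<otimes> (y * y')"
proof -
  let ?t = "\<lambda>y a. lin_ext (\<lambda>b. Poly_Mapping.single (a, b) 1) y"
  have y: "?t (y * y') (a + a') = ?t y a * ?t y' a'" for a a'
    by (subst (1 2) sum_singles[of y], subst (1 2) sum_singles[of y'])
      (simp add: sum_product mult_single lin_ext_sum)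
  show ?thesis unfolding tensor_alt
    by (subst (1 2) sum_singles[of x], subst (1 2) sum_singles[of x'])
      (simp add: sum_product mult_single lin_ext_sum y scale_mult mult.commute)
qed

lemma tensor_map_single [simp]:
  "tensor_map F G (Poly_Mapping.single (a, b) c) =
    scale c (F (Poly_Mapping.single a 1) \<otimes> G (Poly_Mapping.single b 1))"
  by (simp add: tensor_map_def)

lemma tensor_map_add: "tensor_map F G (x + y) = tensor_map F G x + tensor_map F G y"
  by (simp add: tensor_map_def lin_ext_add)

lemma tensor_map_sum: "tensor_map F G (\<Sum>a\<in>A. f a) = (\<Sum>a\<in>A. tensor_map F G (f a))"
  by (simp add: tensor_map_def lin_ext_sum)

lemma unshuffle_single:
  "unshuffle (Poly_Mapping.single M c) = scale c (\<Prod>x\<in>#M.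
     Poly_Mapping.single {#x#} 1 \<otimes> 1 + 1 \<otimes> Poly_Mapping.single {#x#} 1)"
  by (simp add: unshuffle_def)

lemma linear_expand:
  assumes "Vector_Spaces.linear scale scale F"
  shows "F x = lin_ext (\<lambda>a. F (Poly_Mapping.single a 1)) x"
proof -
  interpret F: Vector_Spaces.linear scale scale F by (rule assms)
  have "F x = F (lin_ext (\<lambda>a. Poly_Mapping.single a 1) x)" by (simp only: lin_ext_singles)
  also have "\<dots> = lin_ext (\<lambda>a. F (Poly_Mapping.single a 1)) x"
    unfolding lin_ext_def F.sum F.scale ..
  finally show ?thesis .
qed

lemma linear_eq_on_free_on:
  assumes "Vector_Spaces.linear scale scale F" "Vector_Spaces.linear scale scale F'"
    and "\<And>a. a \<in> B \<Longrightarrow> F (Poly_Mapping.single a 1) = F' (Poly_Mapping.single a 1)"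
    and "x \<in> free_on B"
  shows "F x = F' x"
  unfolding linear_expand[OF assms(1), of x] linear_expand[OF assms(2), of x]
  using assms(3,4) by (rule lin_ext_cong[rotated])

lemma linear_mult:
  fixes F :: "('a::comm_monoid_add \<Rightarrow>\<^sub>0 'k::field) \<Rightarrow> ('b::comm_monoid_add \<Rightarrow>\<^sub>0 'k)"
  assumes F: "Vector_Spaces.linear scale scale F"
    and "\<And>a b. a \<in> B \<Longrightarrow> b \<in> B \<Longrightarrow> F (Poly_Mapping.single (a + b) 1) =
      F (Poly_Mapping.single a 1) * F (Poly_Mapping.single b 1)"
    and "x \<in> free_on B" "y \<in> free_on B"
  shows "F (x * y) = F x * F y"
  unfolding linear_expand[OF F, of "x * y"] linear_expand[OF F, of x] linear_expand[OF F, of y]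
  using assms(2-4) by (rule lin_ext_mult)

lemma linear_maps:
  "Vector_Spaces.linear scale scale (coaction T)"
  "Vector_Spaces.linear scale scale (tensor_map F G)"
  "Vector_Spaces.linear scale scale tensor_assoc"
  "Vector_Spaces.linear scale scale (functional_tensor_id \<epsilon>)"
  "Vector_Spaces.linear scale scale unshuffle"
  "Vector_Spaces.linear scale scale m13"
  "Vector_Spaces.linear scale scale (\<lambda>x. x)"
proof -
  show "Vector_Spaces.linear scale scale m13"
    unfolding m13_def by (rule Vector_Spaces.linear_compose; unfold tau23_def tensor_map_def; rule linear_lin_ext)
  show "Vector_Spaces.linear scale scale (\<lambda>x. x)"
    by (simp add: Vector_Spaces.linear_iff vector_space_scale)
qed (unfold coaction_def tensor_map_def tensor_assoc_def functional_tensor_id_def unshuffle_def, (rule linear_lin_ext)+)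

lemma linear_comp:
  "Vector_Spaces.linear scale scale F \<Longrightarrow> Vector_Spaces.linear scale scale G \<Longrightarrow>
    Vector_Spaces.linear scale scale (\<lambda>x. F (G x))"
  using Vector_Spaces.linear_compose[of scale scale G scale F] by (simp add: comp_def)

section \<open>Connected components, bridges and contraction\<close>

lemma feynmanD:
  assumes "feynman_graph \<Gamma>" "e \<in> half_edges \<Gamma>"
  shows "bdry \<Gamma> e \<in> vertices \<Gamma>" "invol \<Gamma> e \<in> half_edges \<Gamma>" "invol \<Gamma> (invol \<Gamma> e) = e"
    "etype \<Gamma> (invol \<Gamma> e) = etype \<Gamma> e"
  using assms by (auto simp: feynman_graph_def)

lemma component_of_refl [simp]: "v \<in> component_of \<Gamma> v"
  by (simp add: component_of_def)

lemma component_of_step: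
  "e \<in> half_edges \<Gamma> \<Longrightarrow> bdry \<Gamma> e \<in> component_of \<Gamma> v \<Longrightarrow> bdry \<Gamma> (invol \<Gamma> e) \<in> component_of \<Gamma> v"
  by (auto simp: component_of_def adj_def intro: rtrancl.rtrancl_into_rtrancl)

text \<open>
  Together with \<open>component_of_step\<close> this characterises a component as the least set of
  vertices containing \<open>v\<close> and closed along edges. Apart from symmetry
  (\<open>component_of_eq\<close>), the arguments below use only this description, and no paths.
\<close>

lemma component_of_least:
  assumes "v \<in> A" "\<And>e. e \<in> half_edges \<Gamma> \<Longrightarrow> bdry \<Gamma> e \<in> A \<Longrightarrow> bdry \<Gamma> (invol \<Gamma> e) \<in> A"
  shows "component_of \<Gamma> v \<subseteq> A"
proof
  fix w assume "w \<in> component_of \<Gamma> v"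
  then have "(v, w) \<in> (adj \<Gamma>)\<^sup>*" by (simp add: component_of_def)
  then show "w \<in> A"
    by (induction rule: rtrancl_induct) (use assms in \<open>auto simp: adj_def\<close>)
qed

lemma component_of_eq:
  assumes "feynman_graph \<Gamma>" "w \<in> component_of \<Gamma> v"
  shows "component_of \<Gamma> w = component_of \<Gamma> v"
proof -
  have "sym (adj \<Gamma>)"
  proof (rule symI)
    fix a b assume "(a, b) \<in> adj \<Gamma>"
    then obtain e where "e \<in> half_edges \<Gamma>" "a = bdry \<Gamma> e" "b = bdry \<Gamma> (invol \<Gamma> e)"
      by (auto simp: adj_def)
    then show "(b, a) \<in> adj \<Gamma>"
      using feynmanD[OF assms(1)] unfolding adj_def by (metis (mono_tags, lifting) mem_Collect_eq)
  qed
  then have "sym ((adj \<Gamma>)\<^sup>*)" by (rule sym_rtrancl)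
  moreover have "(v, w) \<in> (adj \<Gamma>)\<^sup>*" using assms by (simp add: component_of_def)
  ultimately show ?thesis
    unfolding component_of_def by (auto dest: symD intro: rtrancl_trans)
qed

lemma component_of_eq_iff:
  "feynman_graph \<Gamma> \<Longrightarrow> component_of \<Gamma> w = component_of \<Gamma> v \<longleftrightarrow> w \<in> component_of \<Gamma> v"
  using component_of_eq component_of_refl by metis

lemma component_of_invol:
  "feynman_graph \<Gamma> \<Longrightarrow> e \<in> half_edges \<Gamma> \<Longrightarrow>
    component_of \<Gamma> (bdry \<Gamma> (invol \<Gamma> e)) = component_of \<Gamma> (bdry \<Gamma> e)"
  by (simp add: component_of_eq_iff component_of_step)

lemma pi0_eq_component_of:
  "feynman_graph \<Gamma> \<Longrightarrow> C \<in> pi0 \<Gamma> \<Longrightarrow> v \<in> C \<Longrightarrow> C = component_of \<Gamma> v"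
  by (auto simp: pi0_def component_of_eq)

lemma pi0_vertices: "feynman_graph \<Gamma> \<Longrightarrow> C \<in> pi0 \<Gamma> \<Longrightarrow> C \<subseteq> vertices \<Gamma>"
  using component_of_subset by (fastforce simp: pi0_def)

lemma Union_pi0: "feynman_graph \<Gamma> \<Longrightarrow> \<Union> (pi0 \<Gamma>) = vertices \<Gamma>"
  using component_of_subset by (fastforce simp: pi0_def intro: component_of_refl)

lemma finite_pi0: "feynman_graph \<Gamma> \<Longrightarrow> finite (pi0 \<Gamma>)"
  by (simp add: pi0_def feynman_graph_def)

lemma component_of_pi0 [intro]: "v \<in> vertices \<Gamma> \<Longrightarrow> component_of \<Gamma> v \<in> pi0 \<Gamma>"
  by (simp add: pi0_def)

lemma cut_sel [simp]:
  "vertices (cut \<Gamma> S) = vertices \<Gamma>" "half_edges (cut \<Gamma> S) = half_edges \<Gamma>"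
  "bdry (cut \<Gamma> S) = bdry \<Gamma>" "etype (cut \<Gamma> S) = etype \<Gamma>" "vindex (cut \<Gamma> S) = vindex \<Gamma>"
  "invol (cut \<Gamma> S) e = (if e \<in> S then e else invol \<Gamma> e)"
  by (simp_all add: cut_def)

lemma cut_cut: "cut (cut \<Gamma> S) S' = cut \<Gamma> (S \<union> S')"
  by (auto simp: cut_def fun_eq_iff)

text \<open>
  Fixed points of the involution are admitted. The edges to be cut may thus already have been
  cut, as happens when single edges of \<open>\<Gamma>/\<gamma>\<close> are removed.
\<close>

definition edge_closed :: "('v, 'e, 'h) fgraph \<Rightarrow> 'e set \<Rightarrow> bool" where
  "edge_closed \<Gamma> S \<longleftrightarrow> S \<subseteq> half_edges \<Gamma> \<and> invol \<Gamma> ` S \<subseteq> S"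

lemma edge_closed_iff:
  "feynman_graph \<Gamma> \<Longrightarrow> edge_closed \<Gamma> S \<Longrightarrow> e \<in> half_edges \<Gamma> \<Longrightarrow> invol \<Gamma> e \<in> S \<longleftrightarrow> e \<in> S"
  unfolding edge_closed_def using feynmanD by (metis image_subset_iff)

lemma edge_closed_edge:
  "feynman_graph \<Gamma> \<Longrightarrow> e \<in> half_edges \<Gamma> \<Longrightarrow> edge_closed \<Gamma> {e, invol \<Gamma> e}"
  by (simp add: edge_closed_def feynmanD)

lemma feynman_cut:
  assumes "feynman_graph \<Gamma>" "edge_closed \<Gamma> S" shows "feynman_graph (cut \<Gamma> S)"
  unfolding feynman_graph_def using assms edge_closed_iff[OF assms]
  by (auto simp: feynman_graph_def)

lemma component_of_cut_subset: "component_of (cut \<Gamma> S) v \<subseteq> component_of \<Gamma> v"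
  by (rule component_of_least) (auto intro: component_of_step)

lemma component_of_cut_Un_subset: "component_of (cut \<Gamma> (S \<union> S')) v \<subseteq> component_of (cut \<Gamma> S) v"
  using component_of_cut_subset[of "cut \<Gamma> S" S' v] by (simp add: cut_cut)

lemma external_cut: "S \<subseteq> half_edges \<Gamma> \<Longrightarrow> external (cut \<Gamma> S) = external \<Gamma> \<union> S"
  by (auto simp: external_def)

lemma internal_cut: "internal (cut \<Gamma> S) = internal \<Gamma> - S"
  by (auto simp: internal_def)

text \<open>
  A graph is locally 1PI if and only if it has no bridges. Unlike the definition through
  components as separate graphs, this one can be checked at a single edge, and it holds trivially
  at an external half-edge.
\<close>

definition bridgeless :: "('v, 'e, 'h) fgraph \<Rightarrow> bool" where
  "bridgeless \<Gamma> \<longleftrightarrow> (\<forall>e\<in>half_edges \<Gamma>.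
     bdry \<Gamma> (invol \<Gamma> e) \<in> component_of (cut \<Gamma> {e, invol \<Gamma> e}) (bdry \<Gamma> e))"

lemma component_sel [simp]:
  "vertices (component \<Gamma> C) = C" "half_edges (component \<Gamma> C) = {e \<in> half_edges \<Gamma>. bdry \<Gamma> e \<in> C}"
  "bdry (component \<Gamma> C) = bdry \<Gamma>" "invol (component \<Gamma> C) = invol \<Gamma>"
  "etype (component \<Gamma> C) = etype \<Gamma>" "vindex (component \<Gamma> C) = vindex \<Gamma>"
  by (simp_all add: component_def)

lemma cut_component: "cut (component \<Gamma> C) S = component (cut \<Gamma> S) C"
  by (rule fgraph.equality) (auto simp: cut_def component_def)

lemma component_of_component:
  assumes "\<And>e. e \<in> half_edges \<Gamma> \<Longrightarrow> bdry \<Gamma> e \<in> A \<Longrightarrow> bdry \<Gamma> (invol \<Gamma> e) \<in> A" "v \<in> A"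
  shows "component_of (component \<Gamma> A) v = component_of \<Gamma> v"
proof
  show "component_of (component \<Gamma> A) v \<subseteq> component_of \<Gamma> v"
    by (rule component_of_least) (auto intro: component_of_step)
  have "component_of \<Gamma> v \<subseteq> A \<inter> component_of (component \<Gamma> A) v"
    by (rule component_of_least) (use assms component_of_step[of _ "component \<Gamma> A"] in auto)
  then show "component_of \<Gamma> v \<subseteq> component_of (component \<Gamma> A) v" by simp
qed

lemma graph_connected_iff:
  assumes "feynman_graph \<Gamma>" "v \<in> vertices \<Gamma>"
  shows "graph_connected \<Gamma> \<longleftrightarrow> component_of \<Gamma> v = vertices \<Gamma>"
proof
  assume "graph_connected \<Gamma>"
  then obtain C where "pi0 \<Gamma> = {C}" by (auto simp: graph_connected_def card_1_singleton_iff)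
  then show "component_of \<Gamma> v = vertices \<Gamma>"
    using component_of_pi0[OF assms(2)] Union_pi0[OF assms(1)] by auto
next
  assume "component_of \<Gamma> v = vertices \<Gamma>"
  then have "component_of \<Gamma> w = vertices \<Gamma>" if "w \<in> vertices \<Gamma>" for w
    using component_of_eq[OF assms(1), of w v] that by simp
  then have "pi0 \<Gamma> = {vertices \<Gamma>}"
    using assms(2) unfolding pi0_def by blast
  then show "graph_connected \<Gamma>" by (simp add: graph_connected_def)
qed

text \<open>
  Cutting an edge of a component \<open>C\<close> leaves it connected exactly if the endpoints of the
  edge stay connected: then the component of an endpoint in the cut graph is closed along all
  edges of \<open>\<Gamma>\<close>, hence is all of \<open>C\<close>.
\<close>

lemma locally_1PI_iff_bridgeless:
  assumes wf: "feynman_graph \<Gamma>"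
  shows "locally_1PI \<Gamma> \<longleftrightarrow> bridgeless \<Gamma>"
proof -
  have closed: "bdry \<Gamma> (invol \<Gamma> e) \<in> C" if "C \<in> pi0 \<Gamma>" "e \<in> half_edges \<Gamma>" "bdry \<Gamma> e \<in> C" for C e
    using that component_of_step by (auto simp: pi0_def)
  have wfC: "feynman_graph (component \<Gamma> C)" if "C \<in> pi0 \<Gamma>" for C
    using wf closed[OF that] finite_subset[OF pi0_vertices[OF wf that]]
    by (auto simp: feynman_graph_def)
  have con: "graph_connected (component \<Gamma> C)" if "C \<in> pi0 \<Gamma>" for C
  proof -
    obtain v where v: "v \<in> vertices \<Gamma>" "C = component_of \<Gamma> v" using \<open>C \<in> pi0 \<Gamma>\<close> by (auto simp: pi0_def)
    have "component_of (component \<Gamma> C) v = component_of \<Gamma> v"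
      by (rule component_of_component[OF closed[OF that]]) (auto simp: v)
    then show ?thesis
      using graph_connected_iff[OF wfC[OF that], of v] by (simp add: v)
  qed
  have bridge: "graph_connected (cut (component \<Gamma> C) {e, invol \<Gamma> e}) \<longleftrightarrow>
      bdry \<Gamma> (invol \<Gamma> e) \<in> component_of (cut \<Gamma> {e, invol \<Gamma> e}) (bdry \<Gamma> e)"
    if "C \<in> pi0 \<Gamma>" and e: "e \<in> half_edges \<Gamma>" "bdry \<Gamma> e \<in> C" for C e
  proof -
    let ?S = "{e, invol \<Gamma> e}" and ?v = "bdry \<Gamma> e"
    let ?X = "component_of (cut \<Gamma> ?S) ?v"
    have C: "C = component_of \<Gamma> ?v" using pi0_eq_component_of[OF wf] that by blast
    have wf': "feynman_graph (cut (component \<Gamma> C) ?S)"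
      using feynman_cut[OF wfC[OF \<open>C \<in> pi0 \<Gamma>\<close>], of ?S] e closed[OF that]
      by (auto simp: edge_closed_def feynmanD[OF wf])
    have "component_of (cut (component \<Gamma> C) ?S) ?v = ?X"
      unfolding cut_component by (rule component_of_component) (use closed[OF that(1)] e in auto)
    then have "graph_connected (cut (component \<Gamma> C) ?S) \<longleftrightarrow> ?X = C"
      using graph_connected_iff[OF wf', of ?v] e by simp
    also have "\<dots> \<longleftrightarrow> bdry \<Gamma> (invol \<Gamma> e) \<in> ?X"
    proof
      assume "?X = C" then show "bdry \<Gamma> (invol \<Gamma> e) \<in> ?X" using closed[OF that] by simp
    next
      assume b: "bdry \<Gamma> (invol \<Gamma> e) \<in> ?X"
      have "component_of \<Gamma> ?v \<subseteq> ?X"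
      proof (rule component_of_least)
        fix e' assume e': "e' \<in> half_edges \<Gamma>" "bdry \<Gamma> e' \<in> ?X"
        show "bdry \<Gamma> (invol \<Gamma> e') \<in> ?X"
          using component_of_step[of e' "cut \<Gamma> ?S"] e' b feynmanD[OF wf e(1)]
          by (cases "e' \<in> ?S") auto
      qed simp
      then show "?X = C" using component_of_cut_subset[of \<Gamma> ?S ?v] C by auto
    qed
    finally show ?thesis .
  qed
  have "locally_1PI \<Gamma> \<longleftrightarrow> (\<forall>C\<in>pi0 \<Gamma>. \<forall>e\<in>half_edges \<Gamma>. bdry \<Gamma> e \<in> C \<longrightarrow> invol \<Gamma> e \<noteq> e \<longrightarrow>
      bdry \<Gamma> (invol \<Gamma> e) \<in> component_of (cut \<Gamma> {e, invol \<Gamma> e}) (bdry \<Gamma> e))"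
    unfolding locally_1PI_def one_PI_def using con bridge by (auto simp: internal_def)
  also have "\<dots> \<longleftrightarrow> bridgeless \<Gamma>"
    unfolding bridgeless_def
  proof (intro iffI ballI impI)
    fix e assume *: "\<forall>C\<in>pi0 \<Gamma>. \<forall>e\<in>half_edges \<Gamma>. bdry \<Gamma> e \<in> C \<longrightarrow> invol \<Gamma> e \<noteq> e \<longrightarrow>
      bdry \<Gamma> (invol \<Gamma> e) \<in> component_of (cut \<Gamma> {e, invol \<Gamma> e}) (bdry \<Gamma> e)" "e \<in> half_edges \<Gamma>"
    show "bdry \<Gamma> (invol \<Gamma> e) \<in> component_of (cut \<Gamma> {e, invol \<Gamma> e}) (bdry \<Gamma> e)"
    proof (cases "invol \<Gamma> e = e")
      case False
      then show ?thesis
        using *(1)[rule_format, OF component_of_pi0[OF feynmanD(1)[OF wf *(2)]] *(2)] by simp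
    qed simp
  qed auto
  finally show ?thesis .
qed

lemma contract_graph_sel [simp]:
  "vertices (contract_graph \<Gamma> (\<gamma>, j)) = pi0 \<gamma>"
  "half_edges (contract_graph \<Gamma> (\<gamma>, j)) = external \<gamma>"
  "bdry (contract_graph \<Gamma> (\<gamma>, j)) e = component_of \<gamma> (bdry \<Gamma> e)"
  "invol (contract_graph \<Gamma> (\<gamma>, j)) = invol \<Gamma>"
  "etype (contract_graph \<Gamma> (\<gamma>, j)) = etype \<Gamma>"
  "vindex (contract_graph \<Gamma> (\<gamma>, j)) = j"
  by (simp_all add: contract_graph_def)

lemma invol_external_cut:
  assumes "feynman_graph \<Gamma>" "edge_closed \<Gamma> S" "e \<in> external (cut \<Gamma> S)"
  shows "invol \<Gamma> e \<in> external (cut \<Gamma> S)"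
  using assms edge_closed_iff[OF assms(1,2), of e] feynmanD[OF assms(1), of e]
  by (auto simp: external_def split: if_splits)

lemma feynman_contract_graph:
  assumes "feynman_graph \<Gamma>" "edge_closed \<Gamma> S"
  shows "feynman_graph (contract_graph \<Gamma> (cut \<Gamma> S, j))"
proof -
  have "finite (external (cut \<Gamma> S))" "external (cut \<Gamma> S) \<subseteq> half_edges \<Gamma>"
    using assms(1) by (auto simp: external_def feynman_graph_def)
  then show ?thesis
    unfolding feynman_graph_def
    using invol_external_cut[OF assms] finite_pi0[OF feynman_cut[OF assms]] feynmanD[OF assms(1)]
    by (auto simp: subset_iff pi0_def)
qed

text \<open>
  Walking along an edge of \<open>\<Gamma>\<close> either follows an edge of \<open>\<Gamma>/\<gamma>\<close> or
  stays inside a component of \<open>\<gamma>\<close>.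
\<close>

lemma component_of_contract_graph:
  assumes wf: "feynman_graph \<Gamma>" and S: "edge_closed \<Gamma> S" and v: "v \<in> vertices \<Gamma>"
  defines "\<gamma> \<equiv> cut \<Gamma> S"
  shows "component_of (contract_graph \<Gamma> (\<gamma>, j)) (component_of \<gamma> v) = component_of \<gamma> ` component_of \<Gamma> v"
    (is "?L = ?R")
proof
  have wf\<gamma>: "feynman_graph \<gamma>" unfolding \<gamma>_def by (rule feynman_cut[OF wf S])
  have sub: "component_of \<gamma> w \<subseteq> component_of \<Gamma> w" for w
    unfolding \<gamma>_def by (rule component_of_cut_subset)
  let ?Q = "contract_graph \<Gamma> (\<gamma>, j)"
  show "?L \<subseteq> ?R"
  proof (rule component_of_least)
    fix e assume e: "e \<in> half_edges ?Q" "bdry ?Q e \<in> ?R"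
    then obtain w where w: "w \<in> component_of \<Gamma> v" "component_of \<gamma> (bdry \<Gamma> e) = component_of \<gamma> w"
      by auto
    then have "bdry \<Gamma> e \<in> component_of \<Gamma> w"
      using sub[of w] component_of_refl[of "bdry \<Gamma> e" \<gamma>] by auto
    then have "bdry \<Gamma> e \<in> component_of \<Gamma> v" using component_of_eq[OF wf w(1)] by simp
    moreover have "e \<in> half_edges \<Gamma>" using e by (simp add: external_def \<gamma>_def)
    ultimately have "bdry \<Gamma> (invol \<Gamma> e) \<in> component_of \<Gamma> v" by (rule component_of_step[rotated])
    then show "bdry ?Q (invol ?Q e) \<in> ?R" by simp
  qed simp
  have "component_of \<Gamma> v \<subseteq> {w. component_of \<gamma> w \<in> ?L}"
  proof (rule component_of_least)
    fix e assume e: "e \<in> half_edges \<Gamma>" "bdry \<Gamma> e \<in> {w. component_of \<gamma> w \<in> ?L}"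
    show "bdry \<Gamma> (invol \<Gamma> e) \<in> {w. component_of \<gamma> w \<in> ?L}"
    proof (cases "e \<in> external \<gamma>")
      case True
      then show ?thesis using component_of_step[of e ?Q] e by simp
    next
      case False
      then have "invol \<gamma> e = invol \<Gamma> e" using e by (auto simp: external_def \<gamma>_def)
      then show ?thesis using component_of_invol[OF wf\<gamma>, of e] e by (simp add: \<gamma>_def)
    qed
  qed simp
  then show "?R \<subseteq> ?L" by auto
qed

lemma Union_component_of_contract_graph:
  assumes wf: "feynman_graph \<Gamma>" and S: "edge_closed \<Gamma> S" and v: "v \<in> vertices \<Gamma>"
  shows "\<Union> (component_of (contract_graph \<Gamma> (cut \<Gamma> S, j)) (component_of (cut \<Gamma> S) v)) = component_of \<Gamma> v"
proof -
  have "component_of (cut \<Gamma> S) w \<subseteq> component_of \<Gamma> v" if "w \<in> component_of \<Gamma> v" for w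
    using component_of_cut_subset[of \<Gamma> S w] component_of_eq[OF wf that] by simp
  then show ?thesis
    unfolding component_of_contract_graph[OF assms] by (auto intro: component_of_refl)
qed

lemma pi0_contract_graph:
  assumes wf: "feynman_graph \<Gamma>" and S: "edge_closed \<Gamma> S"
  shows "pi0 (contract_graph \<Gamma> (cut \<Gamma> S, j)) = (\<lambda>C. component_of (cut \<Gamma> S) ` C) ` pi0 \<Gamma>"
proof -
  have "pi0 (contract_graph \<Gamma> (cut \<Gamma> S, j)) =
    (\<lambda>v. component_of (contract_graph \<Gamma> (cut \<Gamma> S, j)) (component_of (cut \<Gamma> S) v)) ` vertices \<Gamma>"
    by (simp add: pi0_def[of "contract_graph \<Gamma> (cut \<Gamma> S, j)"] pi0_def[of "cut \<Gamma> S"] image_image)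
  also have "\<dots> = (\<lambda>v. component_of (cut \<Gamma> S) ` component_of \<Gamma> v) ` vertices \<Gamma>"
    by (rule image_cong) (simp_all add: component_of_contract_graph[OF assms])
  finally show ?thesis by (simp add: pi0_def image_image)
qed

lemma Union_image_component_of:
  assumes wf: "feynman_graph \<Gamma>" and C: "C \<in> pi0 \<Gamma>"
  shows "\<Union> (component_of (cut \<Gamma> S) ` C) = C"
proof -
  have "component_of (cut \<Gamma> S) w \<subseteq> C" if "w \<in> C" for w
    using component_of_cut_subset[of \<Gamma> S w] pi0_eq_component_of[OF wf C that] by simp
  then show ?thesis by (auto intro: component_of_refl)
qed

lemma cut_contract_graph:
  "cut (contract_graph \<Gamma> (cut \<Gamma> S, j)) R =
    contract_graph (cut \<Gamma> R) (cut (cut \<Gamma> R) S, j)" if "R \<subseteq> S"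
proof -
  have "cut (cut \<Gamma> R) S = cut \<Gamma> S" using that by (simp add: cut_cut Un_absorb1)
  then show ?thesis by (intro fgraph.equality) (auto simp: contract_graph_def cut_def)
qed

text \<open>
  Cutting an edge of \<open>\<Gamma>/\<gamma>\<close> commutes with contracting \<open>\<gamma>\<close>, so by
  the description of the components of \<open>\<Gamma>/\<gamma>\<close> its endpoints stay connected in \<open>\<Gamma>/\<gamma>\<close>
  if and only if they do in \<open>\<Gamma>\<close>.
\<close>

lemma bridge_contract_graph:
  fixes j :: "'v set \<Rightarrow> nat"
  assumes wf: "feynman_graph \<Gamma>" and S: "edge_closed \<Gamma> S" and e: "e \<in> S"
  defines "Q \<equiv> contract_graph \<Gamma> (cut \<Gamma> S, j)"
  shows "bdry Q (invol Q e) \<in> component_of (cut Q {e, invol Q e}) (bdry Q e) \<longleftrightarrow>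
    bdry \<Gamma> (invol \<Gamma> e) \<in> component_of (cut \<Gamma> {e, invol \<Gamma> e}) (bdry \<Gamma> e)"
proof -
  let ?R = "{e, invol \<Gamma> e}" and ?\<gamma> = "cut \<Gamma> S"
  have eE: "e \<in> half_edges \<Gamma>" using S e by (auto simp: edge_closed_def)
  have R: "?R \<subseteq> S" using edge_closed_iff[OF wf S eE] e by simp
  have wfR: "feynman_graph (cut \<Gamma> ?R)" by (rule feynman_cut[OF wf edge_closed_edge[OF wf eE]])
  have SR: "edge_closed (cut \<Gamma> ?R) S" using S R by (auto simp: edge_closed_def)
  have \<gamma>: "cut (cut \<Gamma> ?R) S = ?\<gamma>" using R by (simp only: cut_cut Un_absorb1)
  have wf\<gamma>: "feynman_graph ?\<gamma>" by (rule feynman_cut[OF wf S])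
  have "component_of (cut Q {e, invol Q e}) (bdry Q e) =
      component_of ?\<gamma> ` component_of (cut \<Gamma> ?R) (bdry \<Gamma> e)"
    using component_of_contract_graph[OF wfR SR, of "bdry \<Gamma> e" j] feynmanD[OF wf eE]
      cut_contract_graph[OF R, of \<Gamma> j] by (simp add: Q_def \<gamma>)
  moreover have "w \<in> component_of (cut \<Gamma> ?R) v"
    if "w' \<in> component_of (cut \<Gamma> ?R) v" "component_of ?\<gamma> w = component_of ?\<gamma> w'" for w w' v
  proof -
    have "w \<in> component_of ?\<gamma> w'" using that(2) component_of_refl[of w ?\<gamma>] by simp
    then have "w \<in> component_of (cut \<Gamma> ?R) w'"
      using component_of_cut_subset[of "cut \<Gamma> ?R" S w'] by (auto simp: \<gamma>)
    then show ?thesis using component_of_eq[OF wfR that(1)] by simp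
  qed
  then have "component_of ?\<gamma> w \<in> component_of ?\<gamma> ` component_of (cut \<Gamma> ?R) v \<longleftrightarrow>
      w \<in> component_of (cut \<Gamma> ?R) v" for w v
    by (auto elim!: imageE)
  ultimately show ?thesis by (simp add: Q_def)
qed

lemma bridgeless_contract_graph:
  assumes wf: "feynman_graph \<Gamma>" and S: "edge_closed \<Gamma> S" and b: "bridgeless \<Gamma>"
  shows "bridgeless (contract_graph \<Gamma> (cut \<Gamma> S, j))"
  unfolding bridgeless_def
proof
  let ?Q = "contract_graph \<Gamma> (cut \<Gamma> S, j)"
  fix e assume e: "e \<in> half_edges ?Q"
  show "bdry ?Q (invol ?Q e) \<in> component_of (cut ?Q {e, invol ?Q e}) (bdry ?Q e)"
  proof (cases "e \<in> S")
    case True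
    then show ?thesis
      using bridge_contract_graph[OF wf S, of e j] b S by (auto simp: bridgeless_def edge_closed_def)
  next
    case False
    then have "invol \<Gamma> e = e" using e by (simp add: external_def)
    then show ?thesis by simp
  qed
qed

text \<open>
  An edge that belongs to the subgraph has its endpoints connected within the subgraph without
  it; every other edge is an edge of the quotient.
\<close>

lemma bridgeless_extension:
  assumes wf: "feynman_graph \<Gamma>" and S: "edge_closed \<Gamma> S"
    and b: "bridgeless (cut \<Gamma> S)" "bridgeless (contract_graph \<Gamma> (cut \<Gamma> S, j))"
  shows "bridgeless \<Gamma>"
  unfolding bridgeless_def
proof
  fix e assume e: "e \<in> half_edges \<Gamma>"
  show "bdry \<Gamma> (invol \<Gamma> e) \<in> component_of (cut \<Gamma> {e, invol \<Gamma> e}) (bdry \<Gamma> e)"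
  proof (cases "e \<in> S")
    case True
    then show ?thesis
      using bridge_contract_graph[OF wf S True, of j] b(2) e
      by (auto simp: bridgeless_def external_def)
  next
    case False
    then have "bdry \<Gamma> (invol \<Gamma> e) \<in> component_of (cut (cut \<Gamma> S) {e, invol \<Gamma> e}) (bdry \<Gamma> e)"
      using b(1) e by (auto simp: bridgeless_def)
    then show ?thesis
      using component_of_cut_Un_subset[of \<Gamma> "{e, invol \<Gamma> e}" S] by (auto simp: cut_cut Un_commute)
  qed
qed

section \<open>Specified graphs, vertex by vertex\<close>

definition bare :: "('v, 'e, 'h) fgraph \<Rightarrow> 'v \<Rightarrow> bool" where
  "bare \<Gamma> v \<longleftrightarrow> (\<forall>e\<in>half_edges \<Gamma>. bdry \<Gamma> e = v \<longrightarrow> invol \<Gamma> e = e)"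

lemma component_of_bare: "bare \<Gamma> v \<Longrightarrow> component_of \<Gamma> v = {v}"
  using component_of_least[of v "{v}" \<Gamma>] by (fastforce simp: bare_def)

lemma internal_component_empty_iff:
  assumes wf: "feynman_graph \<Gamma>"
  shows "internal (component \<Gamma> (component_of \<Gamma> v)) = {} \<longleftrightarrow> bare \<Gamma> v"
proof
  assume "internal (component \<Gamma> (component_of \<Gamma> v)) = {}"
  then show "bare \<Gamma> v" by (auto simp: internal_def bare_def)
next
  assume "bare \<Gamma> v"
  then show "internal (component \<Gamma> (component_of \<Gamma> v)) = {}"
    by (simp add: component_of_bare internal_def) (auto simp: bare_def)
qed

lemma residue_star_bare: "bare \<Gamma> v \<Longrightarrow> (residue_star \<Gamma> {v}, vindex \<Gamma> v) = vertex_type \<Gamma> v"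
  unfolding residue_star_def vertex_type_def external_def
  by (auto simp: bare_def intro!: arg_cong[of _ _ "\<lambda>A. image_mset (etype \<Gamma>) (mset_set A)"])

text \<open>
  All conditions on a specified graph are local; they are collected here at the vertex
  \<open>v\<close>, so that they can be transported by embeddings. A component without internal edges is its own residue, so superficial divergence
  and the restriction on the indices merge into one condition on the residue together with its
  index.
\<close>

definition spec_at :: "'h qft \<Rightarrow> ('v, 'e, 'h) fgraph \<Rightarrow> ('v set \<Rightarrow> nat) \<Rightarrow> 'v \<Rightarrow> bool" where
  "spec_at T \<Gamma> i v \<longleftrightarrow> vertex_type \<Gamma> v \<in> vertex_types T \<and>
     (residue_star \<Gamma> (component_of \<Gamma> v), i (component_of \<Gamma> v)) \<in> vertex_types T \<and>
     (bare \<Gamma> v \<longrightarrow> i (component_of \<Gamma> v) = vindex \<Gamma> v) \<and>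
     (\<forall>e\<in>half_edges \<Gamma>. bdry \<Gamma> e = v \<longrightarrow> etype \<Gamma> e \<in> edge_types T \<and>
        bdry \<Gamma> (invol \<Gamma> e) \<in> component_of (cut \<Gamma> {e, invol \<Gamma> e}) v)"

lemma specified_graph_iff:
  "specified_graph T (\<Gamma>, i) \<longleftrightarrow> wf_spec (\<Gamma>, i) \<and> (\<forall>v\<in>vertices \<Gamma>. spec_at T \<Gamma> i v)"
proof (cases "feynman_graph \<Gamma>")
  case wf: True
  have V: "bdry \<Gamma> e \<in> vertices \<Gamma>" if "e \<in> half_edges \<Gamma>" for e
    using feynmanD[OF wf that] by simp
  have B: "bridgeless \<Gamma> \<longleftrightarrow> (\<forall>v\<in>vertices \<Gamma>. \<forall>e\<in>half_edges \<Gamma>. bdry \<Gamma> e = v \<longrightarrow>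
      bdry \<Gamma> (invol \<Gamma> e) \<in> component_of (cut \<Gamma> {e, invol \<Gamma> e}) v)"
    unfolding bridgeless_def using V by blast
  have E: "etype \<Gamma> ` half_edges \<Gamma> \<subseteq> edge_types T \<longleftrightarrow> (\<forall>v\<in>vertices \<Gamma>. \<forall>e\<in>half_edges \<Gamma>.
      bdry \<Gamma> e = v \<longrightarrow> etype \<Gamma> e \<in> edge_types T)"
    using V by blast
  have I: "i \<in> (\<Pi>\<^sub>E C\<in>pi0 \<Gamma>. allowed_indices T \<Gamma> C) \<longleftrightarrow> i \<in> extensional (pi0 \<Gamma>) \<and>
      (\<forall>v\<in>vertices \<Gamma>. i (component_of \<Gamma> v) \<in> allowed_indices T \<Gamma> (component_of \<Gamma> v))"
    by (auto simp: PiE_iff pi0_def)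
  have D: "superficially_divergent T \<Gamma> \<longleftrightarrow>
      (\<forall>v\<in>vertices \<Gamma>. \<exists>n. (residue_star \<Gamma> (component_of \<Gamma> v), n) \<in> vertex_types T)"
    by (auto simp: superficially_divergent_def pi0_def)
  have A: "vertex_type \<Gamma> v \<in> vertex_types T \<and>
        (\<exists>n. (residue_star \<Gamma> (component_of \<Gamma> v), n) \<in> vertex_types T) \<and>
        i (component_of \<Gamma> v) \<in> allowed_indices T \<Gamma> (component_of \<Gamma> v) \<longleftrightarrow>
      vertex_type \<Gamma> v \<in> vertex_types T \<and>
        (residue_star \<Gamma> (component_of \<Gamma> v), i (component_of \<Gamma> v)) \<in> vertex_types T \<and>
        (bare \<Gamma> v \<longrightarrow> i (component_of \<Gamma> v) = vindex \<Gamma> v)" for v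
  proof (cases "bare \<Gamma> v")
    case True
    then show ?thesis
      using internal_component_empty_iff[OF wf, of v] residue_star_bare[OF True]
      unfolding allowed_indices_def component_of_bare[OF True]
      by (auto simp: vertex_type_def)
  next
    case False
    then show ?thesis
      using internal_component_empty_iff[OF wf, of v] by (auto simp: allowed_indices_def)
  qed
  have "specified_graph T (\<Gamma>, i) \<longleftrightarrow> i \<in> extensional (pi0 \<Gamma>) \<and> bridgeless \<Gamma> \<and>
      etype \<Gamma> ` half_edges \<Gamma> \<subseteq> edge_types T \<and>
      (\<forall>v\<in>vertices \<Gamma>. vertex_type \<Gamma> v \<in> vertex_types T \<and>
        (\<exists>n. (residue_star \<Gamma> (component_of \<Gamma> v), n) \<in> vertex_types T) \<and>
        i (component_of \<Gamma> v) \<in> allowed_indices T \<Gamma> (component_of \<Gamma> v))"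
    unfolding specified_graph_def prod.case I D locally_1PI_iff_bridgeless[OF wf]
    using wf by blast
  then show ?thesis
    unfolding A unfolding B E spec_at_def wf_spec_def fst_conv snd_conv using wf by blast
qed (simp add: specified_graph_def wf_spec_def)

lemma specified_graph_wf: "specified_graph T G \<Longrightarrow> wf_spec G"
  by (cases G) (simp add: specified_graph_iff)

section \<open>Embeddings\<close>

text \<open>
  An isomorphism onto a union of components: the last condition says that no half-edge attached
  to the image is missed. Isomorphisms of graphs and the inclusions into a disjoint union are
  treated together in this way.
\<close>

definition graph_embedding :: "('v \<Rightarrow> 'w) \<Rightarrow> ('e \<Rightarrow> 'f) \<Rightarrow>
    ('v, 'e, 'h) fgraph \<Rightarrow> ('w, 'f, 'h) fgraph \<Rightarrow> bool" where
  "graph_embedding f g \<Gamma> \<Gamma>' \<longleftrightarrow> inj_on f (vertices \<Gamma>) \<and> inj_on g (half_edges \<Gamma>) \<and>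
     f ` vertices \<Gamma> \<subseteq> vertices \<Gamma>' \<and> g ` half_edges \<Gamma> \<subseteq> half_edges \<Gamma>' \<and>
     (\<forall>e\<in>half_edges \<Gamma>. bdry \<Gamma>' (g e) = f (bdry \<Gamma> e) \<and>
        invol \<Gamma>' (g e) = g (invol \<Gamma> e) \<and> etype \<Gamma>' (g e) = etype \<Gamma> e) \<and>
     (\<forall>v\<in>vertices \<Gamma>. vindex \<Gamma>' (f v) = vindex \<Gamma> v) \<and>
     (\<forall>e'\<in>half_edges \<Gamma>'. bdry \<Gamma>' e' \<in> f ` vertices \<Gamma> \<longrightarrow> e' \<in> g ` half_edges \<Gamma>)"

lemma graph_embeddingD:
  assumes "graph_embedding f g \<Gamma> \<Gamma>'"
  shows "inj_on f (vertices \<Gamma>)" "inj_on g (half_edges \<Gamma>)"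
    "v \<in> vertices \<Gamma> \<Longrightarrow> f v \<in> vertices \<Gamma>'" "e \<in> half_edges \<Gamma> \<Longrightarrow> g e \<in> half_edges \<Gamma>'"
    "e \<in> half_edges \<Gamma> \<Longrightarrow> bdry \<Gamma>' (g e) = f (bdry \<Gamma> e)"
    "e \<in> half_edges \<Gamma> \<Longrightarrow> invol \<Gamma>' (g e) = g (invol \<Gamma> e)"
    "e \<in> half_edges \<Gamma> \<Longrightarrow> etype \<Gamma>' (g e) = etype \<Gamma> e"
    "v \<in> vertices \<Gamma> \<Longrightarrow> vindex \<Gamma>' (f v) = vindex \<Gamma> v"
    "e' \<in> half_edges \<Gamma>' \<Longrightarrow> bdry \<Gamma>' e' \<in> f ` vertices \<Gamma> \<Longrightarrow> e' \<in> g ` half_edges \<Gamma>"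
  using assms unfolding graph_embedding_def by blast+

text \<open>
  Vertex types, residues and closedness along edges are all determined by sets of half-edges
  attached to given vertices, so it suffices to know how these sets are transported.
\<close>

lemma embedding_half_edges:
  assumes wf: "feynman_graph \<Gamma>" and em: "graph_embedding f g \<Gamma> \<Gamma>'" and A: "A \<subseteq> vertices \<Gamma>"
    and P: "\<And>e. e \<in> half_edges \<Gamma> \<Longrightarrow> P' (g e) \<longleftrightarrow> P e"
  shows "{e' \<in> half_edges \<Gamma>'. bdry \<Gamma>' e' \<in> f ` A \<and> P' e'} = g ` {e \<in> half_edges \<Gamma>. bdry \<Gamma> e \<in> A \<and> P e}"
    (is "?L = ?R")
proof (intro equalityI subsetI)
  fix e' assume e': "e' \<in> ?L"
  then obtain e where e: "e \<in> half_edges \<Gamma>" "e' = g e"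
    using graph_embeddingD(9)[OF em, of e'] A by auto
  then have "f (bdry \<Gamma> e) \<in> f ` A" using e' graph_embeddingD(5)[OF em] by auto
  then have "bdry \<Gamma> e \<in> A"
    using inj_on_image_mem_iff[OF graph_embeddingD(1)[OF em]] A feynmanD(1)[OF wf e(1)] by blast
  then show "e' \<in> ?R" using e e' P by auto
next
  fix e' assume "e' \<in> ?R"
  then show "e' \<in> ?L" using graph_embeddingD(4,5)[OF em] P by auto
qed

lemma embedding_component_of:
  assumes wf: "feynman_graph \<Gamma>" and em: "graph_embedding f g \<Gamma> \<Gamma>'" and v: "v \<in> vertices \<Gamma>"
  shows "component_of \<Gamma>' (f v) = f ` component_of \<Gamma> v"
proof
  note C = component_of_subset[OF wf v]
  show "component_of \<Gamma>' (f v) \<subseteq> f ` component_of \<Gamma> v"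
  proof (rule component_of_least)
    fix e' assume "e' \<in> half_edges \<Gamma>'" "bdry \<Gamma>' e' \<in> f ` component_of \<Gamma> v"
    then obtain e where e: "e \<in> half_edges \<Gamma>" "bdry \<Gamma> e \<in> component_of \<Gamma> v" "e' = g e"
      using embedding_half_edges[OF wf em C, of "\<lambda>_. True" "\<lambda>_. True"] by auto
    then show "bdry \<Gamma>' (invol \<Gamma>' e') \<in> f ` component_of \<Gamma> v"
      using graph_embeddingD(5,6)[OF em] component_of_step[OF e(1,2)] feynmanD(2)[OF wf] by auto
  qed simp
  have "component_of \<Gamma> v \<subseteq> {w. f w \<in> component_of \<Gamma>' (f v)}"
  proof (rule component_of_least)
    fix e assume e: "e \<in> half_edges \<Gamma>" "bdry \<Gamma> e \<in> {w. f w \<in> component_of \<Gamma>' (f v)}"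
    then show "bdry \<Gamma> (invol \<Gamma> e) \<in> {w. f w \<in> component_of \<Gamma>' (f v)}"
      using component_of_step[of "g e" \<Gamma>' "f v"] graph_embeddingD(4,5,6)[OF em] feynmanD(2)[OF wf]
      by auto
  qed simp
  then show "f ` component_of \<Gamma> v \<subseteq> component_of \<Gamma>' (f v)" by auto
qed

lemma embedding_pi0:
  assumes "feynman_graph \<Gamma>" "graph_embedding f g \<Gamma> \<Gamma>'" "C \<in> pi0 \<Gamma>"
  shows "f ` C \<in> pi0 \<Gamma>'"
proof -
  obtain v where v: "v \<in> vertices \<Gamma>" "C = component_of \<Gamma> v" using assms(3) by (auto simp: pi0_def)
  then have "f ` C = component_of \<Gamma>' (f v)" using embedding_component_of[OF assms(1,2)] by simp
  then show ?thesis using graph_embeddingD(3)[OF assms(2) v(1)] by auto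
qed

lemma embedding_cut:
  assumes "graph_embedding f g \<Gamma> \<Gamma>'" "\<And>e. e \<in> half_edges \<Gamma> \<Longrightarrow> g e \<in> S' \<longleftrightarrow> e \<in> S"
  shows "graph_embedding f g (cut \<Gamma> S) (cut \<Gamma>' S')"
  using assms unfolding graph_embedding_def by auto

lemma embedding_image_mset:
  assumes "graph_embedding f g \<Gamma> \<Gamma>'" "A \<subseteq> half_edges \<Gamma>"
  shows "image_mset (etype \<Gamma>') (mset_set (g ` A)) = image_mset (etype \<Gamma>) (mset_set A)"
proof (cases "finite A")
  case True
  have "inj_on g A" using graph_embeddingD(2)[OF assms(1)] assms(2) by (rule inj_on_subset)
  then have "mset_set (g ` A) = image_mset g (mset_set A)" by (rule image_mset_mset_set[symmetric])
  then show ?thesis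
    using True assms graph_embeddingD(7)[OF assms(1)]
    by (auto simp: multiset.map_comp comp_def intro!: image_mset_cong)
next
  case False
  then have "infinite (g ` A)"
    using graph_embeddingD(2)[OF assms(1)] assms(2) finite_imageD inj_on_subset by blast
  then show ?thesis using False by simp
qed

lemma embedding_residue_star:
  assumes wf: "feynman_graph \<Gamma>" and em: "graph_embedding f g \<Gamma> \<Gamma>'" and A: "A \<subseteq> vertices \<Gamma>"
  shows "residue_star \<Gamma>' (f ` A) = residue_star \<Gamma> A"
proof -
  have "invol \<Gamma>' (g e) = g e \<longleftrightarrow> invol \<Gamma> e = e" if "e \<in> half_edges \<Gamma>" for e
    using that graph_embeddingD(2,6)[OF em] feynmanD(2)[OF wf that] by (auto dest: inj_onD)
  then have "{e' \<in> half_edges \<Gamma>'. bdry \<Gamma>' e' \<in> f ` A \<and> invol \<Gamma>' e' = e'} =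
      g ` {e \<in> half_edges \<Gamma>. bdry \<Gamma> e \<in> A \<and> invol \<Gamma> e = e}"
    by (intro embedding_half_edges[OF wf em A])
  then have "{e \<in> external \<Gamma>'. bdry \<Gamma>' e \<in> f ` A} = g ` {e \<in> external \<Gamma>. bdry \<Gamma> e \<in> A}"
    by (auto simp: external_def conj_ac)
  moreover have "{e \<in> external \<Gamma>. bdry \<Gamma> e \<in> A} \<subseteq> half_edges \<Gamma>" by (auto simp: external_def)
  ultimately show ?thesis
    unfolding residue_star_def using embedding_image_mset[OF em] by simp
qed

text \<open>
  Every ingredient of \<open>spec_at\<close> depends only on the component of \<open>v\<close>, which is
  carried onto a component.
\<close>

lemma embedding_spec_at:
  assumes wf: "feynman_graph \<Gamma>" and em: "graph_embedding f g \<Gamma> \<Gamma>'" and v: "v \<in> vertices \<Gamma>"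
    and i: "i' (f ` component_of \<Gamma> v) = i (component_of \<Gamma> v)"
  shows "spec_at T \<Gamma>' i' (f v) \<longleftrightarrow> spec_at T \<Gamma> i v"
proof -
  note C = embedding_component_of[OF wf em v]
  have E: "e' \<in> half_edges \<Gamma>' \<and> bdry \<Gamma>' e' = f v \<longleftrightarrow> (\<exists>e\<in>half_edges \<Gamma>. bdry \<Gamma> e = v \<and> e' = g e)" for e'
    using embedding_half_edges[OF wf em, of "{v}" "\<lambda>_. True" "\<lambda>_. True"] v by (auto simp: set_eq_iff)
  have "{e \<in> half_edges \<Gamma>'. bdry \<Gamma>' e = f v} = g ` {e \<in> half_edges \<Gamma>. bdry \<Gamma> e = v}"
    using E by (auto simp: set_eq_iff)
  then have 1: "vertex_type \<Gamma>' (f v) = vertex_type \<Gamma> v"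
    using embedding_image_mset[OF em, of "{e \<in> half_edges \<Gamma>. bdry \<Gamma> e = v}"]
      graph_embeddingD(8)[OF em v] by (simp add: vertex_type_def)
  have 2: "residue_star \<Gamma>' (component_of \<Gamma>' (f v)) = residue_star \<Gamma> (component_of \<Gamma> v)"
    unfolding C by (rule embedding_residue_star[OF wf em component_of_subset[OF wf v]])
  have inv: "invol \<Gamma>' (g e) = g e \<longleftrightarrow> invol \<Gamma> e = e" if "e \<in> half_edges \<Gamma>" for e
    using that graph_embeddingD(2,6)[OF em] feynmanD(2)[OF wf that] by (auto dest: inj_onD)
  have "bare \<Gamma>' (f v) \<longleftrightarrow> (\<forall>e'. e' \<in> half_edges \<Gamma>' \<and> bdry \<Gamma>' e' = f v \<longrightarrow> invol \<Gamma>' e' = e')"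
    by (auto simp: bare_def)
  also have "\<dots> \<longleftrightarrow> bare \<Gamma> v" unfolding E using inv by (auto simp: bare_def)
  finally have 3: "bare \<Gamma>' (f v) \<longleftrightarrow> bare \<Gamma> v" .
  have 4: "bdry \<Gamma>' (invol \<Gamma>' (g e)) \<in> component_of (cut \<Gamma>' {g e, invol \<Gamma>' (g e)}) (f v) \<longleftrightarrow>
      bdry \<Gamma> (invol \<Gamma> e) \<in> component_of (cut \<Gamma> {e, invol \<Gamma> e}) v" if e: "e \<in> half_edges \<Gamma>" for e
  proof -
    let ?S = "{e, invol \<Gamma> e}"
    have "g x \<in> {g e, invol \<Gamma>' (g e)} \<longleftrightarrow> x \<in> ?S" if "x \<in> half_edges \<Gamma>" for x
      using that e graph_embeddingD(2,6)[OF em] feynmanD(2)[OF wf e] by (auto dest: inj_onD)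
    from embedding_cut[OF em this]
    have em': "graph_embedding f g (cut \<Gamma> ?S) (cut \<Gamma>' {g e, invol \<Gamma>' (g e)})" .
    have wf': "feynman_graph (cut \<Gamma> ?S)" by (rule feynman_cut[OF wf edge_closed_edge[OF wf e]])
    have "component_of (cut \<Gamma>' {g e, invol \<Gamma>' (g e)}) (f v) = f ` component_of (cut \<Gamma> ?S) v"
      by (rule embedding_component_of[OF wf' em']) (simp add: v)
    moreover have "bdry \<Gamma>' (invol \<Gamma>' (g e)) = f (bdry \<Gamma> (invol \<Gamma> e))"
      using graph_embeddingD(5,6)[OF em] feynmanD(2)[OF wf e] e by simp
    moreover have "component_of (cut \<Gamma> ?S) v \<subseteq> vertices \<Gamma>"
      using component_of_subset[OF wf', of v] v by simp
    moreover have "bdry \<Gamma> (invol \<Gamma> e) \<in> vertices \<Gamma>" using feynmanD[OF wf] e by simp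
    ultimately show ?thesis
      using inj_on_image_mem_iff[OF graph_embeddingD(1)[OF em]] by simp
  qed
  let ?ok' = "\<lambda>e'. etype \<Gamma>' e' \<in> edge_types T \<and>
    bdry \<Gamma>' (invol \<Gamma>' e') \<in> component_of (cut \<Gamma>' {e', invol \<Gamma>' e'}) (f v)"
  let ?ok = "\<lambda>e. etype \<Gamma> e \<in> edge_types T \<and>
    bdry \<Gamma> (invol \<Gamma> e) \<in> component_of (cut \<Gamma> {e, invol \<Gamma> e}) v"
  have "(\<forall>e'\<in>half_edges \<Gamma>'. bdry \<Gamma>' e' = f v \<longrightarrow> ?ok' e') \<longleftrightarrow>
      (\<forall>e'. e' \<in> half_edges \<Gamma>' \<and> bdry \<Gamma>' e' = f v \<longrightarrow> ?ok' e')"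
    by blast
  also have "\<dots> \<longleftrightarrow> (\<forall>e\<in>half_edges \<Gamma>. bdry \<Gamma> e = v \<longrightarrow> ?ok e)"
    unfolding E using 4 graph_embeddingD(7)[OF em] by auto
  finally have 5: "(\<forall>e'\<in>half_edges \<Gamma>'. bdry \<Gamma>' e' = f v \<longrightarrow> ?ok' e') \<longleftrightarrow>
      (\<forall>e\<in>half_edges \<Gamma>. bdry \<Gamma> e = v \<longrightarrow> ?ok e)" .
  show ?thesis
    unfolding spec_at_def 1 2 3 5 graph_embeddingD(8)[OF em v] unfolding C i by simp
qed

lemma iso_maps_embedding: "iso_maps f g G G' \<Longrightarrow> graph_embedding f g (fst G) (fst G')"
  by (auto simp: iso_maps_alt graph_embedding_def bij_betw_def)

lemma spec_iso_specified:
  fixes G :: "('v, 'e, 'h) spec_graph" and G' :: "('w, 'f, 'h) spec_graph"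
  assumes "spec_iso G G'"
  shows "specified_graph T G' \<longleftrightarrow> specified_graph T G"
proof -
  obtain f g where wf: "wf_spec G" "wf_spec G'" and m: "iso_maps f g G G'"
    using assms by (auto simp: spec_iso_def)
  have V: "vertices (fst G') = f ` vertices (fst G)" using m by (simp add: iso_maps_alt bij_betw_def)
  have "spec_at T (fst G') (snd G') (f v) \<longleftrightarrow> spec_at T (fst G) (snd G) v" if "v \<in> vertices (fst G)" for v
    by (rule embedding_spec_at[OF _ iso_maps_embedding[OF m] that])
      (use wf m component_of_pi0[OF that] in \<open>auto simp: wf_spec_def iso_maps_alt\<close>)
  then show ?thesis
    using wf V by (cases G, cases G') (simp add: specified_graph_iff)
qed

lemma Inl_embedding: "graph_embedding Inl Inl \<Gamma> (union_graph \<Gamma> \<Gamma>')"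
  by (auto simp: graph_embedding_def)

lemma Inr_embedding: "graph_embedding Inr Inr \<Gamma>' (union_graph \<Gamma> \<Gamma>')"
  by (auto simp: graph_embedding_def)

lemma specified_disjoint_union:
  assumes wf: "wf_spec G" "wf_spec H"
  shows "specified_graph T (disjoint_union G H) \<longleftrightarrow> specified_graph T G \<and> specified_graph T H"
proof -
  let ?U = "disjoint_union G H"
  have l: "spec_at T (fst ?U) (snd ?U) (Inl v) \<longleftrightarrow> spec_at T (fst G) (snd G) v"
    if "v \<in> vertices (fst G)" for v
    using embedding_spec_at[OF _ Inl_embedding that, of "snd ?U" "snd G" T "fst H"] wf that
      disjoint_union_spec_Inl[OF component_of_pi0[OF that], of H]
    by (simp add: wf_spec_def)
  have r: "spec_at T (fst ?U) (snd ?U) (Inr v) \<longleftrightarrow> spec_at T (fst H) (snd H) v"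
    if "v \<in> vertices (fst H)" for v
    using embedding_spec_at[OF _ Inr_embedding that, of "snd ?U" "snd H" T "fst G"] wf that
      disjoint_union_spec_Inr[OF component_of_pi0[OF that], of G]
    by (simp add: wf_spec_def)
  have U: "specified_graph T ?U \<longleftrightarrow> (\<forall>v\<in>vertices (fst ?U). spec_at T (fst ?U) (snd ?U) v)"
    using wf_disjoint_union[OF wf] specified_graph_iff[of T "fst ?U" "snd ?U"] by (simp only: prod.collapse simp_thms)
  have G: "specified_graph T G \<longleftrightarrow> (\<forall>v\<in>vertices (fst G). spec_at T (fst G) (snd G) v)"
    "specified_graph T H \<longleftrightarrow> (\<forall>v\<in>vertices (fst H). spec_at T (fst H) (snd H) v)"
    using wf specified_graph_iff[of T "fst G" "snd G"] specified_graph_iff[of T "fst H" "snd H"]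
    by simp_all
  show ?thesis unfolding U G using l r by auto
qed

section \<open>Decomposition into components\<close>

text \<open>
  The components of a graph are split off one after the other, which leaves arbitrary unions of
  components as intermediate graphs.
\<close>

definition spec_part :: "('v, 'e, 'h) spec_graph \<Rightarrow> 'v set set \<Rightarrow> ('v, 'e, 'h) spec_graph" where
  "spec_part G U = (component (fst G) (\<Union>U), restrict (snd G) U)"

lemma spec_component_eq_part: "spec_component G C = spec_part G {C}"
  by (simp add: spec_component_def spec_part_def)

lemma spec_part_pi0_wf:
  assumes wf: "wf_spec G" and U: "U \<subseteq> pi0 (fst G)"
  shows "pi0 (component (fst G) (\<Union>U)) = U" "wf_spec (spec_part G U)"
proof -
  let ?\<Gamma> = "fst G"
  have wf\<Gamma>: "feynman_graph ?\<Gamma>" using wf by (simp add: wf_spec_def)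
  have eq: "C = component_of ?\<Gamma> v" if "C \<in> U" "v \<in> C" for C v
    using pi0_eq_component_of[OF wf\<Gamma>] that U by blast
  have closed: "bdry ?\<Gamma> (invol ?\<Gamma> e) \<in> \<Union>U" if e: "e \<in> half_edges ?\<Gamma>" "bdry ?\<Gamma> e \<in> \<Union>U" for e
  proof -
    obtain C where C: "C \<in> U" "bdry ?\<Gamma> e \<in> C" using e by auto
    then have "bdry ?\<Gamma> (invol ?\<Gamma> e) \<in> C"
      using eq[OF C] component_of_step[OF e(1), of "bdry ?\<Gamma> e"] by simp
    then show ?thesis using C by blast
  qed
  have V: "\<Union>U \<subseteq> vertices ?\<Gamma>" using U Union_pi0[OF wf\<Gamma>] by blast
  have "feynman_graph (component ?\<Gamma> (\<Union>U))"
    using wf\<Gamma> closed finite_subset[OF V] by (auto simp: feynman_graph_def)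
  moreover have "component_of (component ?\<Gamma> (\<Union>U)) v = component_of ?\<Gamma> v" if "v \<in> \<Union>U" for v
    using component_of_component[OF closed that] .
  then have "pi0 (component ?\<Gamma> (\<Union>U)) = component_of ?\<Gamma> ` \<Union>U"
    unfolding pi0_def by simp
  moreover have "component_of ?\<Gamma> ` \<Union>U = U"
  proof (intro equalityI subsetI)
    fix C assume "C \<in> component_of ?\<Gamma> ` \<Union>U"
    then show "C \<in> U" using eq by auto
  next
    fix C assume C: "C \<in> U"
    then obtain v where "v \<in> C" using pi0_nonempty[of C ?\<Gamma>] U by blast
    then show "C \<in> component_of ?\<Gamma> ` \<Union>U" using eq[OF C, of v] C by blast
  qed
  ultimately show "pi0 (component ?\<Gamma> (\<Union>U)) = U" "wf_spec (spec_part G U)"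
    by (simp_all add: wf_spec_def spec_part_def)
qed

lemma spec_part_Un:
  assumes wf: "wf_spec G" and U: "U \<subseteq> pi0 (fst G)" "W \<subseteq> pi0 (fst G)" "U \<inter> W = {}"
  shows "spec_iso (disjoint_union (spec_part G U) (spec_part G W)) (spec_part G (U \<union> W))"
proof -
  let ?\<Gamma> = "fst G"
  have wf\<Gamma>: "feynman_graph ?\<Gamma>" using wf by (simp add: wf_spec_def)
  have dis: "\<Union>U \<inter> \<Union>W = {}"
    using pi0_eq_component_of[OF wf\<Gamma>] U by blast
  let ?s = "case_sum (\<lambda>x. x) (\<lambda>x. x)"
  have b: "bij_betw ?s (X <+> Y) (X \<union> Y)" if "X \<inter> Y = {}" for X Y :: "'x set"
    using that by (auto simp: bij_betw_def inj_on_def Plus_def image_Un image_image)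
  have UW: "U \<union> W \<subseteq> pi0 ?\<Gamma>" using U by simp
  have "{e \<in> half_edges ?\<Gamma>. bdry ?\<Gamma> e \<in> \<Union>(U \<union> W)} =
      {e \<in> half_edges ?\<Gamma>. bdry ?\<Gamma> e \<in> \<Union>U} \<union> {e \<in> half_edges ?\<Gamma>. bdry ?\<Gamma> e \<in> \<Union>W}" by auto
  then have be: "bij_betw ?s ({e \<in> half_edges ?\<Gamma>. bdry ?\<Gamma> e \<in> \<Union>U} <+> {e \<in> half_edges ?\<Gamma>. bdry ?\<Gamma> e \<in> \<Union>W})
      {e \<in> half_edges ?\<Gamma>. bdry ?\<Gamma> e \<in> \<Union>(U \<union> W)}"
    using b[of "{e \<in> half_edges ?\<Gamma>. bdry ?\<Gamma> e \<in> \<Union>U}" "{e \<in> half_edges ?\<Gamma>. bdry ?\<Gamma> e \<in> \<Union>W}"] dis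
    by auto
  have bv: "bij_betw ?s (\<Union>U <+> \<Union>W) (\<Union>(U \<union> W))" using b[OF dis] by simp
  let ?D = "disjoint_union (spec_part G U) (spec_part G W)"
  have p: "pi0 (fst ?D) = (`) Inl ` U \<union> (`) Inr ` W"
    using spec_part_pi0_wf(1)[OF wf U(1)] spec_part_pi0_wf(1)[OF wf U(2)]
    by (simp add: pi0_union_graph spec_part_def)
  have l: "snd ?D (Inl ` C) = snd G C" if "C \<in> U" for C
    using disjoint_union_spec_Inl[of C "spec_part G U"] spec_part_pi0_wf(1)[OF wf U(1)] that
    by (simp add: spec_part_def)
  have r: "snd ?D (Inr ` C) = snd G C" if "C \<in> W" for C
    using disjoint_union_spec_Inr[of C "spec_part G W"] spec_part_pi0_wf(1)[OF wf U(2)] that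
    by (simp add: spec_part_def)
  have "iso_maps ?s ?s ?D (spec_part G (U \<union> W))"
    unfolding iso_maps_alt p
    using bv be l r by (auto simp: spec_part_def image_image)
  then show ?thesis
    using spec_part_pi0_wf(2)[OF wf] U UW by (auto simp: spec_iso_def wf_disjoint_union)
qed

lemma spec_part_all:
  assumes wf: "wf_spec G"
  shows "spec_iso (spec_part G (pi0 (fst G))) G"
proof -
  have wf\<Gamma>: "feynman_graph (fst G)" using wf by (simp add: wf_spec_def)
  have "{e \<in> half_edges (fst G). bdry (fst G) e \<in> vertices (fst G)} = half_edges (fst G)"
    using feynmanD(1)[OF wf\<Gamma>] by auto
  then have "iso_maps (\<lambda>v. v) (\<lambda>e. e) (spec_part G (pi0 (fst G))) G"
    using spec_part_pi0_wf(1)[OF wf subset_refl]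
    by (auto simp: iso_maps_alt spec_part_def Union_pi0[OF wf\<Gamma>] bij_betw_def)
  then show ?thesis using wf spec_part_pi0_wf(2)[OF wf subset_refl] by (auto simp: spec_iso_def)
qed

text \<open>
  In a graph without vertices there is no vertex to which a half-edge could be attached.
\<close>

lemma zero_sgraph_class: "wf_spec G \<Longrightarrow> vertices (fst G) = {} \<Longrightarrow> iso_class G = 0"
  unfolding zero_sgraph_def
  by (rule iso_class_eqI)
    (auto simp: spec_iso_def wf_empty_spec iso_maps_alt empty_spec_def pi0_def wf_spec_def
      feynman_graph_def Pi_iff bij_betw_def)

text \<open>
  In the monoid of isomorphism classes addition is disjoint union, so induction on sets of
  components with \<open>spec_part_Un\<close> writes a graph as the sum of its components.
\<close>

lemma iso_class_sum_components:
  assumes wf: "wf_spec G"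
  shows "iso_class G = sum_mset (component_classes G)"
proof -
  have fin: "finite (pi0 (fst G))" using wf finite_pi0 by (auto simp: wf_spec_def)
  have "iso_class (spec_part G U) = (\<Sum>C\<in>U. iso_class (spec_component G C))"
    if "finite U" "U \<subseteq> pi0 (fst G)" for U
    using that
  proof (induction U rule: finite_induct)
    case empty
    then show ?case using spec_part_pi0_wf(2)[OF wf, of "{}"]
      by (simp add: zero_sgraph_class) (simp add: zero_sgraph_class spec_part_def)
  next
    case (insert C U)
    have "iso_class (spec_part G ({C} \<union> U)) =
        iso_class (disjoint_union (spec_part G {C}) (spec_part G U))"
      using insert by (intro iso_class_eqI spec_iso_sym[OF spec_part_Un[OF wf]]) auto
    also have "\<dots> = iso_class (spec_part G {C}) + iso_class (spec_part G U)"
      using insert by (intro plus_iso_class[symmetric] spec_part_pi0_wf[OF wf]) auto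
    finally show ?case using insert by (simp add: spec_component_eq_part)
  qed
  from this[OF fin subset_refl] have "iso_class G = (\<Sum>C\<in>pi0 (fst G). iso_class (spec_component G C))"
    using iso_class_eqI[OF spec_part_all[OF wf]] by simp
  then show ?thesis by (simp add: component_classes_def sum_unfold_sum_mset)
qed

lemma pi0_spec_component: "wf_spec G \<Longrightarrow> C \<in> pi0 (fst G) \<Longrightarrow> pi0 (fst (spec_component G C)) = {C}"
  using spec_part_pi0_wf(1)[of G "{C}"] by (simp add: spec_component_def)

lemma wf_spec_component: "wf_spec G \<Longrightarrow> C \<in> pi0 (fst G) \<Longrightarrow> wf_spec (spec_component G C)"
  using spec_part_pi0_wf(2)[of G "{C}"] by (simp add: spec_component_eq_part)

lemma embedding_spec_component:
  assumes wf: "wf_spec G" "wf_spec G'" and em: "graph_embedding f g (fst G) (fst G')"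
    and C: "C \<in> pi0 (fst G)" and i: "snd G' (f ` C) = snd G C"
  shows "spec_iso (spec_component G C) (spec_component G' (f ` C))"
proof -
  have wf\<Gamma>: "feynman_graph (fst G)" using wf by (simp add: wf_spec_def)
  have CV: "C \<subseteq> vertices (fst G)" by (rule pi0_vertices[OF wf\<Gamma> C])
  note C' = embedding_pi0[OF wf\<Gamma> em C]
  have E: "{e' \<in> half_edges (fst G'). bdry (fst G') e' \<in> f ` C} =
      g ` {e \<in> half_edges (fst G). bdry (fst G) e \<in> C}"
    using embedding_half_edges[OF wf\<Gamma> em CV, of "\<lambda>_. True" "\<lambda>_. True"] by simp
  have "inj_on f C" "inj_on g {e \<in> half_edges (fst G). bdry (fst G) e \<in> C}"
    by (rule inj_on_subset[OF graph_embeddingD(1)[OF em] CV],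
        rule inj_on_subset[OF graph_embeddingD(2)[OF em]]) auto
  then have "iso_maps f g (spec_component G C) (spec_component G' (f ` C))"
    unfolding iso_maps_alt pi0_spec_component[OF wf(1) C]
    using i E CV graph_embeddingD(5,6,7,8)[OF em] by (auto simp: spec_component_def bij_betw_def)
  then show ?thesis
    using wf_spec_component[OF wf(1) C] wf_spec_component[OF wf(2) C'] by (auto simp: spec_iso_def)
qed

lemma component_classes_disjoint_union:
  assumes wf: "wf_spec G" "wf_spec H"
  shows "component_classes (disjoint_union G H) = component_classes G + component_classes H"
proof -
  let ?U = "disjoint_union G H"
  let ?K = "\<lambda>C. iso_class (spec_component ?U C)"
  have wfU: "wf_spec ?U" by (rule wf_disjoint_union[OF wf])
  have fin: "finite (pi0 (fst G))" "finite (pi0 (fst H))"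
    using wf finite_pi0 by (auto simp: wf_spec_def)
  have l: "?K (Inl ` C) = iso_class (spec_component G C)" if "C \<in> pi0 (fst G)" for C
    by (rule iso_class_eqI[OF embedding_spec_component, symmetric])
      (use wf wfU that Inl_embedding in \<open>auto simp: disjoint_union_spec_Inl\<close>)
  have r: "?K (Inr ` C) = iso_class (spec_component H C)" if "C \<in> pi0 (fst H)" for C
    by (rule iso_class_eqI[OF embedding_spec_component, symmetric])
      (use wf wfU that Inr_embedding in \<open>auto simp: disjoint_union_spec_Inr\<close>)
  have inj: "inj_on ((`) Inl) A" "inj_on ((`) Inr) B" for A :: "'a set set" and B :: "'d set set"
    by (auto intro!: inj_onI simp: inj_image_eq_iff)
  have dis: "(`) Inl ` pi0 (fst G) \<inter> (`) Inr ` pi0 (fst H) = {}"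
    using pi0_nonempty by fastforce
  have "component_classes ?U = image_mset ?K (mset_set ((`) Inl ` pi0 (fst G))) +
      image_mset ?K (mset_set ((`) Inr ` pi0 (fst H)))"
    using fin dis by (simp add: component_classes_def pi0_union_graph mset_set_Union)
  also have "\<dots> = image_mset (\<lambda>C. ?K (Inl ` C)) (mset_set (pi0 (fst G))) +
      image_mset (\<lambda>C. ?K (Inr ` C)) (mset_set (pi0 (fst H)))"
    by (simp add: image_mset_mset_set[OF inj(1), symmetric] image_mset_mset_set[OF inj(2), symmetric]
        multiset.map_comp comp_def)
  also have "\<dots> = component_classes G + component_classes H"
    unfolding component_classes_def using fin l r by (auto intro!: arg_cong2[of _ _ _ _ "(+)"] image_mset_cong)
  finally show ?thesis .
qed

lemma component_classes_iso:
  fixes G :: "('v, 'e, 'h) spec_graph" and G' :: "('w, 'f, 'h) spec_graph"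
  assumes "spec_iso G G'"
  shows "component_classes G = component_classes G'"
proof -
  obtain f g where wf: "wf_spec G" "wf_spec G'" and m: "iso_maps f g G G'"
    using assms by (auto simp: spec_iso_def)
  have wf\<Gamma>: "feynman_graph (fst G)" using wf by (simp add: wf_spec_def)
  have inj: "inj_on ((`) f) (pi0 (fst G))"
  proof (rule inj_on_image, rule inj_on_subset)
    show "inj_on f (vertices (fst G))" using m by (simp add: iso_maps_alt bij_betw_def)
    show "\<Union> (pi0 (fst G)) \<subseteq> vertices (fst G)" by (simp add: Union_pi0[OF wf\<Gamma>])
  qed
  have "iso_class (spec_component G' (f ` C)) = iso_class (spec_component G C)"
    if "C \<in> pi0 (fst G)" for C
    by (rule iso_class_eqI[OF embedding_spec_component, symmetric])
      (use wf that iso_maps_embedding[OF m] m in \<open>auto simp: iso_maps_alt\<close>)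
  then show ?thesis
    unfolding component_classes_def iso_maps_pi0[OF wf m] image_mset_mset_set[OF inj, symmetric]
    using finite_pi0[OF wf\<Gamma>] by (auto simp: multiset.map_comp comp_def intro!: image_mset_cong)
qed

lemma component_classes_connected:
  assumes wf: "wf_spec G" and c: "graph_connected (fst G)"
  shows "component_classes G = {#iso_class G#}"
proof -
  obtain C where C: "pi0 (fst G) = {C}" using c by (auto simp: graph_connected_def card_1_singleton_iff)
  then have "iso_class (spec_component G C) = iso_class G"
    using iso_class_eqI[OF spec_part_all[OF wf]] by (simp add: spec_component_eq_part)
  then show ?thesis by (simp add: component_classes_def C)
qed

section \<open>Isomorphism classes of specified graphs\<close>

definition sgraph_components :: "'h sgraph \<Rightarrow> 'h sgraph multiset" where
  "sgraph_components x = component_classes (rep_sgraph x)"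

lemma sgraph_components_iso_class: "wf_spec G \<Longrightarrow> sgraph_components (iso_class G) = component_classes G"
  unfolding sgraph_components_def by (rule component_classes_iso[OF rep_iso_class])

lemma rep_plus: "spec_iso (rep_sgraph (x + y)) (disjoint_union (rep_sgraph x) (rep_sgraph y))"
  unfolding plus_sgraph_def by (intro rep_iso_class wf_disjoint_union wf_rep_sgraph)

lemma sgraph_components_add: "sgraph_components (x + y) = sgraph_components x + sgraph_components y"
  unfolding sgraph_components_def component_classes_iso[OF rep_plus]
  by (intro component_classes_disjoint_union wf_rep_sgraph)

lemma sgraph_components_zero: "sgraph_components 0 = {#}"
proof -
  have "component_classes (empty_spec :: (nat, nat, 'h) spec_graph) = {#}"
    by (simp add: component_classes_def empty_spec_def pi0_def)
  then show ?thesis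
    unfolding zero_sgraph_def by (simp add: sgraph_components_iso_class wf_empty_spec)
qed

lemma sum_mset_sgraph_components: "sum_mset (sgraph_components x) = x"
  unfolding sgraph_components_def
  using iso_class_sum_components[OF wf_rep_sgraph, of x] by (simp add: iso_class_rep)

lemma mem_spec_basis: "x \<in> spec_basis T \<longleftrightarrow> specified_graph T (rep_sgraph x)"
proof
  assume "x \<in> spec_basis T"
  then obtain G :: "(nat, nat, 'a) spec_graph" where "x = iso_class G" "specified_graph T G"
    by (auto simp: spec_basis_def)
  then show "specified_graph T (rep_sgraph x)"
    using spec_iso_specified[OF rep_iso_class, of G T] specified_graph_wf by blast
next
  assume "specified_graph T (rep_sgraph x)"
  then show "x \<in> spec_basis T"
    unfolding spec_basis_def mem_Collect_eq
    by (intro exI[of _ "rep_sgraph x"]) (simp add: iso_class_rep)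
qed

lemma iso_class_mem_spec_basis: "wf_spec G \<Longrightarrow> iso_class G \<in> spec_basis T \<longleftrightarrow> specified_graph T G"
  unfolding mem_spec_basis using spec_iso_specified[OF rep_iso_class] by blast

lemma plus_mem_spec_basis: "x + y \<in> spec_basis T \<longleftrightarrow> x \<in> spec_basis T \<and> y \<in> spec_basis T"
  unfolding mem_spec_basis spec_iso_specified[OF rep_plus, symmetric]
  by (intro specified_disjoint_union wf_rep_sgraph)

lemma zero_mem_spec_basis: "0 \<in> spec_basis T"
proof -
  have "specified_graph T (empty_spec :: (nat, nat, 'a) spec_graph)"
    using wf_empty_spec by (simp add: empty_spec_def specified_graph_iff)
  then show ?thesis unfolding zero_sgraph_def by (simp add: iso_class_mem_spec_basis wf_empty_spec)
qed

lemma spec_iso_connected: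
  fixes G :: "('v, 'e, 'h) spec_graph" and G' :: "('w, 'f, 'h) spec_graph"
  assumes "spec_iso G G'" "graph_connected (fst G)"
  shows "graph_connected (fst G')"
proof -
  obtain f g where "wf_spec G" "wf_spec G'" "iso_maps f g G G'"
    using assms by (auto simp: spec_iso_def)
  from iso_maps_pi0[OF this] show ?thesis
    using assms(2) by (auto simp: graph_connected_def card_1_singleton_iff)
qed

lemma iso_class_mem_conn_basis:
  assumes "specified_graph T G" "graph_connected (fst G)"
  shows "iso_class G \<in> conn_basis T"
proof -
  have wf: "wf_spec G" by (rule specified_graph_wf[OF assms(1)])
  have "specified_graph T (rep_sgraph (iso_class G))" "graph_connected (fst (rep_sgraph (iso_class G)))"
    using spec_iso_specified[OF rep_iso_class[OF wf]] spec_iso_connected[OF spec_iso_sym[OF rep_iso_class[OF wf]]] assms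
    by auto
  then show ?thesis unfolding conn_basis_def mem_Collect_eq
    by (intro exI[of _ "rep_sgraph (iso_class G)"]) (simp add: iso_class_rep)
qed

lemma conn_basisD:
  assumes "x \<in> conn_basis T"
  shows "x \<in> spec_basis T" "sgraph_components x = {#x#}"
  using assms sgraph_components_iso_class specified_graph_wf component_classes_connected
  by (fastforce simp: conn_basis_def spec_basis_def)+

text \<open>
  A graph is the disjoint union of one of its components and the rest, and a disjoint union is
  specified only if both parts are.
\<close>

lemma component_classes_mem_sym_basis:
  assumes "specified_graph T G"
  shows "component_classes G \<in> sym_basis T"
proof -
  have wf: "wf_spec G" by (rule specified_graph_wf[OF assms])
  have "iso_class (spec_component G C) \<in> conn_basis T" if C: "C \<in> pi0 (fst G)" for C
  proof (rule iso_class_mem_conn_basis)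
    show "graph_connected (fst (spec_component G C))"
      unfolding graph_connected_def pi0_spec_component[OF wf C] by simp
    have "iso_class G = iso_class (spec_component G C) +
        sum_mset (image_mset (\<lambda>C. iso_class (spec_component G C)) (mset_set (pi0 (fst G) - {C})))"
      unfolding iso_class_sum_components[OF wf] component_classes_def
      using mset_set.remove[OF finite_pi0 C] wf by (simp add: wf_spec_def)
    then have "iso_class (spec_component G C) \<in> spec_basis T"
      using assms plus_mem_spec_basis iso_class_mem_spec_basis[OF wf] by metis
    then show "specified_graph T (spec_component G C)"
      using iso_class_mem_spec_basis[OF wf_spec_component[OF wf C]] by blast
  qed
  then show ?thesis
    using finite_pi0[of "fst G"] wf by (auto simp: sym_basis_def component_classes_def wf_spec_def)
qed

lemma sgraph_components_mem_sym_basis: "x \<in> spec_basis T \<Longrightarrow> sgraph_components x \<in> sym_basis T"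
  unfolding sgraph_components_def mem_spec_basis by (rule component_classes_mem_sym_basis)

lemma sym_basis_plus: "M + N \<in> sym_basis T \<longleftrightarrow> M \<in> sym_basis T \<and> N \<in> sym_basis T"
  by (auto simp: sym_basis_def)

text \<open>
  Together with \<open>sum_mset_sgraph_components\<close> this says that the specified graphs form the
  free commutative monoid on the connected ones.
\<close>

lemma sum_mset_sym_basis:
  assumes "M \<in> sym_basis T"
  shows "sum_mset M \<in> spec_basis T \<and> sgraph_components (sum_mset M) = M"
  using assms
proof (induction M)
  case empty
  then show ?case by (simp add: zero_mem_spec_basis sgraph_components_zero)
next
  case (add x M)
  then show ?case
    using conn_basisD[of x T] by (auto simp: sym_basis_def plus_mem_spec_basis sgraph_components_add)
qed

section \<open>Specified covering subgraphs and their contraction\<close>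

text \<open>
  A covering subgraph is determined by the set \<open>S\<close> of half-edges that are cut. A component
  of \<open>cut \<Gamma> S\<close> to which no element of \<open>S\<close> is attached is the same as a common
  component, so this predicate describes the specified covering subgraphs in terms of \<open>S\<close>
  (\<open>coproduct_subgraphs_eq\<close>).
\<close>

definition admissible_cut ::
    "'h qft \<Rightarrow> ('v, 'e, 'h) fgraph \<Rightarrow> ('v set \<Rightarrow> nat) \<Rightarrow> 'e set \<Rightarrow> ('v set \<Rightarrow> nat) \<Rightarrow> bool" where
  "admissible_cut T \<Gamma> i S j \<longleftrightarrow> edge_closed \<Gamma> S \<and> S \<subseteq> internal \<Gamma> \<and> specified_graph T (cut \<Gamma> S, j) \<and>
     (\<forall>C\<in>pi0 (cut \<Gamma> S). (\<forall>e\<in>S. bdry \<Gamma> e \<notin> C) \<longrightarrow> j C = i C)"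

text \<open>
  Such a component is closed along the edges of \<open>\<Gamma>\<close>, since none of its edges is missing.
\<close>

lemma uncut_component:
  assumes wf: "feynman_graph \<Gamma>" and S: "edge_closed \<Gamma> S"
    and C: "C \<in> pi0 (cut \<Gamma> S)" "\<forall>e\<in>S. bdry \<Gamma> e \<notin> C" and v: "v \<in> C"
  shows "component_of \<Gamma> v = C"
proof -
  have eq: "C = component_of (cut \<Gamma> S) v" by (rule pi0_eq_component_of[OF feynman_cut[OF wf S] C(1) v])
  have "component_of \<Gamma> v \<subseteq> C"
  proof (rule component_of_least)
    fix e assume e: "e \<in> half_edges \<Gamma>" "bdry \<Gamma> e \<in> C"
    then have "e \<notin> S" using C(2) by auto
    then show "bdry \<Gamma> (invol \<Gamma> e) \<in> C"
      using component_of_step[of e "cut \<Gamma> S" v] e eq by simp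
  qed (rule v)
  then show ?thesis using component_of_cut_subset[of \<Gamma> S v] eq by auto
qed

lemma uncut_component_pi0:
  assumes wf: "feynman_graph \<Gamma>" and S: "edge_closed \<Gamma> S"
    and C: "C \<in> pi0 (cut \<Gamma> S)" "\<forall>e\<in>S. bdry \<Gamma> e \<notin> C"
  shows "C \<in> pi0 \<Gamma>"
proof -
  obtain v where v: "v \<in> C" using pi0_nonempty[OF C(1)] by auto
  have "v \<in> vertices \<Gamma>" using pi0_vertices[OF feynman_cut[OF wf S] C(1)] v by auto
  then show ?thesis using component_of_pi0 uncut_component[OF assms v] by metis
qed

lemma specified_feynman: "specified_graph T G \<Longrightarrow> feynman_graph (fst G)"
  using specified_graph_wf wf_spec_def by blast

lemma specified_bridgeless: "specified_graph T (\<Gamma>, i) \<Longrightarrow> bridgeless \<Gamma>"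
  using locally_1PI_iff_bridgeless[of \<Gamma>] by (simp add: specified_graph_def)

lemma contract_pair:
  "contract (\<Gamma>, i) g = (contract_graph \<Gamma> g, \<lambda>D\<in>pi0 (contract_graph \<Gamma> g). i (\<Union>D))"
  by (simp add: contract_def)

lemma external_contract_graph:
  assumes "S \<subseteq> half_edges \<Gamma>"
  shows "external (contract_graph \<Gamma> (cut \<Gamma> S, j)) = external \<Gamma>"
  using assms by (auto simp: external_def)

lemma internal_contract_graph:
  assumes "S \<subseteq> internal \<Gamma>"
  shows "internal (contract_graph \<Gamma> (cut \<Gamma> S, j)) = S"
  using assms by (auto simp: internal_def external_def)

text \<open>
  Translates the local condition at the vertex \<open>C\<close> of \<open>\<Gamma>/\<gamma>\<close> into conditions
  on \<open>\<gamma>\<close> and \<open>\<Gamma>\<close>. It is used in both directions: to show that a contraction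
  is specified, and to recover a specified graph from its contraction.
\<close>

lemma spec_at_contract_graph:
  fixes j :: "'v set \<Rightarrow> nat"
  assumes wf: "feynman_graph \<Gamma>" and S: "edge_closed \<Gamma> S" "S \<subseteq> internal \<Gamma>" and v: "v \<in> vertices \<Gamma>"
  defines "\<gamma> \<equiv> cut \<Gamma> S"
  defines "Q \<equiv> contract_graph \<Gamma> (\<gamma>, j)" and "C \<equiv> component_of \<gamma> v"
  assumes k: "k (component_of \<gamma> ` component_of \<Gamma> v) = i (component_of \<Gamma> v)"
  shows "spec_at T Q k C \<longleftrightarrow> (residue_star \<gamma> C, j C) \<in> vertex_types T \<and>
    (residue_star \<Gamma> (component_of \<Gamma> v), i (component_of \<Gamma> v)) \<in> vertex_types T \<and>
    ((\<forall>e\<in>S. bdry \<Gamma> e \<notin> C) \<longrightarrow> i (component_of \<Gamma> v) = j C) \<and>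
    (\<forall>e\<in>external \<gamma>. bdry \<Gamma> e \<in> C \<longrightarrow> etype \<Gamma> e \<in> edge_types T \<and>
       bdry Q (invol Q e) \<in> component_of (cut Q {e, invol Q e}) (bdry Q e))"
proof -
  have wf\<gamma>: "feynman_graph \<gamma>" unfolding \<gamma>_def by (rule feynman_cut[OF wf S(1)])
  have SE: "S \<subseteq> half_edges \<Gamma>" using S(1) by (simp add: edge_closed_def)
  have bd: "component_of \<gamma> (bdry \<Gamma> e) = C \<longleftrightarrow> bdry \<Gamma> e \<in> C" for e
    unfolding C_def by (rule component_of_eq_iff[OF wf\<gamma>])
  have D: "component_of Q C = component_of \<gamma> ` component_of \<Gamma> v"
    unfolding Q_def C_def \<gamma>_def by (rule component_of_contract_graph[OF wf S(1) v])
  have 1: "vertex_type Q C = (residue_star \<gamma> C, j C)"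
    unfolding vertex_type_def residue_star_def by (simp add: Q_def bd) (simp add: \<gamma>_def)
  have "component_of \<gamma> (bdry \<Gamma> e) \<in> component_of \<gamma> ` component_of \<Gamma> v \<longleftrightarrow> bdry \<Gamma> e \<in> component_of \<Gamma> v" for e
  proof
    assume "component_of \<gamma> (bdry \<Gamma> e) \<in> component_of \<gamma> ` component_of \<Gamma> v"
    then obtain w where w: "w \<in> component_of \<Gamma> v" "component_of \<gamma> (bdry \<Gamma> e) = component_of \<gamma> w"
      by auto
    then have "bdry \<Gamma> e \<in> component_of \<Gamma> w"
      using component_of_cut_subset[of \<Gamma> S w] component_of_refl[of "bdry \<Gamma> e" \<gamma>] by (auto simp: \<gamma>_def)
    then show "bdry \<Gamma> e \<in> component_of \<Gamma> v" using component_of_eq[OF wf w(1)] by simp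
  qed simp
  then have 2: "residue_star Q (component_of \<gamma> ` component_of \<Gamma> v) = residue_star \<Gamma> (component_of \<Gamma> v)"
    unfolding residue_star_def Q_def \<gamma>_def external_contract_graph[OF SE] by simp
  have 3: "bare Q C \<longleftrightarrow> (\<forall>e\<in>S. bdry \<Gamma> e \<notin> C)"
  proof -
    have "bare Q C \<longleftrightarrow> (\<forall>e\<in>internal Q. bdry Q e \<noteq> C)" by (auto simp: bare_def internal_def)
    also have "internal Q = S" unfolding Q_def \<gamma>_def by (rule internal_contract_graph[OF S(2)])
    finally show ?thesis using bd by (simp add: Q_def)
  qed
  have 4: "half_edges Q = external \<gamma>" "etype Q = etype \<Gamma>" "bdry Q e = component_of \<gamma> (bdry \<Gamma> e)"
    "vindex Q = j" for e by (simp_all add: Q_def)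
  have 5: "(\<forall>e\<in>external \<gamma>. bdry Q e = C \<longrightarrow> etype \<Gamma> e \<in> edge_types T \<and>
        bdry Q (invol Q e) \<in> component_of (cut Q {e, invol Q e}) C) \<longleftrightarrow>
      (\<forall>e\<in>external \<gamma>. bdry \<Gamma> e \<in> C \<longrightarrow> etype \<Gamma> e \<in> edge_types T \<and>
        bdry Q (invol Q e) \<in> component_of (cut Q {e, invol Q e}) (bdry Q e))"
  proof (rule ball_cong[OF refl])
    fix e
    have "bdry Q e = C \<longleftrightarrow> bdry \<Gamma> e \<in> C" using bd[of e] 4(3)[of e] by simp
    then show "(bdry Q e = C \<longrightarrow> etype \<Gamma> e \<in> edge_types T \<and>
        bdry Q (invol Q e) \<in> component_of (cut Q {e, invol Q e}) C) \<longleftrightarrow>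
      (bdry \<Gamma> e \<in> C \<longrightarrow> etype \<Gamma> e \<in> edge_types T \<and>
        bdry Q (invol Q e) \<in> component_of (cut Q {e, invol Q e}) (bdry Q e))"
      by (cases "bdry \<Gamma> e \<in> C") simp_all
  qed
  show ?thesis
    unfolding spec_at_def 1 D 2 3 4(1,2,4) k 5 by blast
qed

text \<open>
  The vertex types of \<open>\<Gamma>/\<gamma>\<close> are residues of \<open>\<gamma>\<close> and its residues are
  those of \<open>\<Gamma>\<close>. A vertex of \<open>\<Gamma>/\<gamma>\<close> without internal edges is a common
  component of \<open>\<gamma>\<close> and \<open>\<Gamma>\<close>, where the two specifications agree.
\<close>

lemma specified_contract:
  assumes G: "specified_graph T (\<Gamma>, i)" and A: "admissible_cut T \<Gamma> i S j"
  shows "specified_graph T (contract (\<Gamma>, i) (cut \<Gamma> S, j))"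
proof -
  have wf: "feynman_graph \<Gamma>" using specified_feynman[OF G] by simp
  have S: "edge_closed \<Gamma> S" "S \<subseteq> internal \<Gamma>" and g: "specified_graph T (cut \<Gamma> S, j)"
    using A by (auto simp: admissible_cut_def)
  let ?Q = "contract_graph \<Gamma> (cut \<Gamma> S, j)" and ?k = "\<lambda>D\<in>pi0 (contract_graph \<Gamma> (cut \<Gamma> S, j)). i (\<Union>D)"
  have b: "bridgeless ?Q" by (rule bridgeless_contract_graph[OF wf S(1) specified_bridgeless[OF G]])
  have "spec_at T ?Q ?k (component_of (cut \<Gamma> S) v)" if v: "v \<in> vertices \<Gamma>" for v
  proof -
    have "component_of \<Gamma> v \<in> pi0 \<Gamma>" using v by auto
    then have "?k (component_of (cut \<Gamma> S) ` component_of \<Gamma> v) = i (component_of \<Gamma> v)"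
      using Union_image_component_of[OF wf] by (simp add: pi0_contract_graph[OF wf S(1)])
    note R = spec_at_contract_graph[where k = ?k and i = i, OF wf S v this]
    have "spec_at T (cut \<Gamma> S) j v" "spec_at T \<Gamma> i v"
      using G g v by (auto simp: specified_graph_iff)
    moreover have "i (component_of \<Gamma> v) = j (component_of (cut \<Gamma> S) v)"
      if "\<forall>e\<in>S. bdry \<Gamma> e \<notin> component_of (cut \<Gamma> S) v"
    proof -
      have C: "component_of (cut \<Gamma> S) v \<in> pi0 (cut \<Gamma> S)" using v by (intro component_of_pi0) simp
      show ?thesis
        using A uncut_component[OF wf S(1) C that component_of_refl] C that
        by (simp add: admissible_cut_def)
    qed
    moreover have "etype \<Gamma> e \<in> edge_types T" if "e \<in> external (cut \<Gamma> S)" for e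
      using G that by (auto simp: specified_graph_def external_def)
    moreover have "bdry ?Q (invol ?Q e) \<in> component_of (cut ?Q {e, invol ?Q e}) (bdry ?Q e)"
      if "e \<in> external (cut \<Gamma> S)" for e
      using b that unfolding bridgeless_def by simp
    ultimately show ?thesis unfolding R by (simp add: spec_at_def)
  qed
  then show ?thesis
    unfolding contract_pair specified_graph_iff wf_spec_def
    using feynman_contract_graph[OF wf S(1)] by (auto simp: pi0_def[of "cut \<Gamma> S"])
qed

text \<open>
  The condition on the contraction in \<open>coproduct_subgraphs\<close> is supplied by
  \<open>specified_contract\<close>.
\<close>

lemma coproduct_subgraphs_eq:
  assumes G: "specified_graph T (\<Gamma>, i)"
  shows "coproduct_subgraphs T (\<Gamma>, i) = {(cut \<Gamma> S, j) | S j. admissible_cut T \<Gamma> i S j}"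
proof -
  have wf: "feynman_graph \<Gamma>" using specified_feynman[OF G] by simp
  have "spec_covering_subgraph T (\<gamma>, j) (\<Gamma>, i) \<longleftrightarrow> (\<exists>S. \<gamma> = cut \<Gamma> S \<and> admissible_cut T \<Gamma> i S j)" for \<gamma> j
  proof -
    have common: "common_component (cut \<Gamma> S) \<Gamma> C \<longleftrightarrow> C \<in> pi0 (cut \<Gamma> S) \<and> (\<forall>e\<in>S. bdry \<Gamma> e \<notin> C)"
      if S: "edge_closed \<Gamma> S" "S \<subseteq> internal \<Gamma>" for S C
      using uncut_component_pi0[OF wf S(1)] S(2)
      by (auto simp: common_component_def internal_def)
    have ec: "S \<subseteq> internal \<Gamma> \<and> invol \<Gamma> ` S \<subseteq> S \<longleftrightarrow> edge_closed \<Gamma> S \<and> S \<subseteq> internal \<Gamma>" for S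
      by (auto simp: edge_closed_def internal_def)
    have adm: "admissible_cut T \<Gamma> i S j \<longleftrightarrow> (S \<subseteq> internal \<Gamma> \<and> invol \<Gamma> ` S \<subseteq> S) \<and>
        specified_graph T (cut \<Gamma> S, j) \<and> (\<forall>C. common_component (cut \<Gamma> S) \<Gamma> C \<longrightarrow> j C = i C)" for S
      unfolding ec admissible_cut_def using common[of S] by (simp add: Ball_def imp_conjL) blast
    have "spec_covering_subgraph T (\<gamma>, j) (\<Gamma>, i) \<longleftrightarrow> (\<exists>S. \<gamma> = cut \<Gamma> S \<and> (S \<subseteq> internal \<Gamma> \<and> invol \<Gamma> ` S \<subseteq> S) \<and>
        specified_graph T (\<gamma>, j) \<and> (\<forall>C. common_component \<gamma> \<Gamma> C \<longrightarrow> j C = i C))"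
      by (auto simp: spec_covering_subgraph_def covering_subgraph_def)
    then show ?thesis unfolding adm by auto
  qed
  then show ?thesis
    unfolding coproduct_subgraphs_def using specified_contract[OF G] by auto
qed

lemma coproduct_subgraphs_specified:
  assumes "specified_graph T G" "g \<in> coproduct_subgraphs T G"
  shows "specified_graph T g" "specified_graph T (contract G g)"
  using assms by (auto simp: coproduct_subgraphs_def spec_covering_subgraph_def split: prod.splits)

lemma finite_coproduct_subgraphs:
  assumes T: "physical_theory T" and G: "specified_graph T G"
  shows "finite (coproduct_subgraphs T G)"
proof -
  obtain \<Gamma> i where [simp]: "G = (\<Gamma>, i)" by (cases G)
  have wf: "feynman_graph \<Gamma>" using specified_feynman[OF G] by simp
  let ?B = "\<lambda>S. \<Pi>\<^sub>E C\<in>pi0 (cut \<Gamma> S). {n. (residue_star (cut \<Gamma> S) C, n) \<in> vertex_types T}"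
  have "coproduct_subgraphs T G \<subseteq> (\<Union>S\<in>{S. edge_closed \<Gamma> S}. {cut \<Gamma> S} \<times> ?B S)"
  proof
    fix g assume "g \<in> coproduct_subgraphs T G"
    then obtain S j where g: "g = (cut \<Gamma> S, j)" "admissible_cut T \<Gamma> i S j"
      using coproduct_subgraphs_eq[of T \<Gamma> i] G by auto
    then have "edge_closed \<Gamma> S" "j \<in> ?B S"
      by (auto simp: admissible_cut_def specified_graph_iff wf_spec_def spec_at_def PiE_iff pi0_def)
    then show "g \<in> (\<Union>S\<in>{S. edge_closed \<Gamma> S}. {cut \<Gamma> S} \<times> ?B S)" using g(1) by auto
  qed
  moreover have "finite {S. edge_closed \<Gamma> S}"
    by (rule finite_subset[of _ "Pow (half_edges \<Gamma>)"])
      (use wf in \<open>auto simp: edge_closed_def feynman_graph_def\<close>)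
  moreover have "finite (?B S)" if "edge_closed \<Gamma> S" for S
    using finite_pi0[OF feynman_cut[OF wf that]] T by (intro finite_PiE) (auto simp: physical_theory_def)
  ultimately show ?thesis by (auto elim!: finite_subset)
qed

section \<open>Transport along isomorphisms\<close>

text \<open>
  The same maps \<open>f\<close> and \<open>g\<close> serve for the graph and for its subgraph. The subgraph
  is therefore determined by its image (\<open>admissible_cut_iso_unique\<close>), and the isomorphism
  descends to the contractions (\<open>contract_iso\<close>).
\<close>

lemma admissible_cut_iso:
  assumes wf: "wf_spec (\<Gamma>, i)" "wf_spec (\<Gamma>', i')" and m: "iso_maps f g (\<Gamma>, i) (\<Gamma>', i')"
    and A: "admissible_cut T \<Gamma> i S j"
  shows "\<exists>S' j'. admissible_cut T \<Gamma>' i' S' j' \<and> iso_maps f g (cut \<Gamma> S, j) (cut \<Gamma>' S', j')"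
proof -
  have wf\<Gamma>: "feynman_graph \<Gamma>" "feynman_graph \<Gamma>'" using wf by (auto simp: wf_spec_def)
  have S: "edge_closed \<Gamma> S" "S \<subseteq> internal \<Gamma>" and sp: "specified_graph T (cut \<Gamma> S, j)"
    using A by (auto simp: admissible_cut_def)
  have SE: "S \<subseteq> half_edges \<Gamma>" using S(1) by (simp add: edge_closed_def)
  note em = iso_maps_embedding[OF m, unfolded fst_conv]
  have injf: "inj_on f (vertices \<Gamma>)" and injg: "inj_on g (half_edges \<Gamma>)"
    using m by (auto simp: iso_maps_alt bij_betw_def)
  have fV: "vertices \<Gamma>' = f ` vertices \<Gamma>" and gE: "half_edges \<Gamma>' = g ` half_edges \<Gamma>"
    using m by (auto simp: iso_maps_alt bij_betw_def)
  let ?\<gamma> = "cut \<Gamma> S" and ?\<gamma>' = "cut \<Gamma>' (g ` S)"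
  let ?f = "inv_into (vertices \<Gamma>) f"
  define j' where "j' = (\<lambda>C\<in>pi0 ?\<gamma>'. j (?f ` C))"
  have wf\<gamma>: "feynman_graph ?\<gamma>" by (rule feynman_cut[OF wf\<Gamma>(1) S(1)])
  have inv: "invol \<Gamma>' (g e) = g e \<longleftrightarrow> invol \<Gamma> e = e" if "e \<in> half_edges \<Gamma>" for e
    using that graph_embeddingD(2,6)[OF em] feynmanD(2)[OF wf\<Gamma>(1) that] by (auto dest: inj_onD)
  have S': "edge_closed \<Gamma>' (g ` S)" "g ` S \<subseteq> internal \<Gamma>'"
    using S SE graph_embeddingD(4,6)[OF em] inv
    by (fastforce simp: edge_closed_def internal_def subset_iff)+
  have wf\<gamma>': "feynman_graph ?\<gamma>'" by (rule feynman_cut[OF wf\<Gamma>(2) S'(1)])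
  have em\<gamma>: "graph_embedding f g ?\<gamma> ?\<gamma>'"
    by (rule embedding_cut[OF em]) (use inj_on_image_mem_iff[OF injg] SE in auto)
  have C: "C \<subseteq> vertices \<Gamma>" if "C \<in> pi0 ?\<gamma>" for C using pi0_vertices[OF wf\<gamma> that] by simp
  have j': "j' (f ` C) = j C" if "C \<in> pi0 ?\<gamma>" for C
    using embedding_pi0[OF wf\<gamma> em\<gamma> that] inv_into_image_cancel[OF injf C[OF that]]
    by (simp add: j'_def)
  have m\<gamma>: "iso_maps f g (?\<gamma>, j) (?\<gamma>', j')"
    unfolding iso_maps_alt
    using m graph_embeddingD(5-8)[OF em\<gamma>] j' by (auto simp: iso_maps_alt)
  have wfs: "wf_spec (?\<gamma>, j)" "wf_spec (?\<gamma>', j')"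
    using specified_graph_wf[OF sp] wf\<gamma>' by (auto simp: wf_spec_def j'_def)
  then have "specified_graph T (?\<gamma>', j')"
    using spec_iso_specified[of "(?\<gamma>, j)" "(?\<gamma>', j')"] m\<gamma> sp by (auto simp: spec_iso_def)
  moreover have "j' C' = i' C'" if C': "C' \<in> pi0 ?\<gamma>'" "\<forall>e\<in>g ` S. bdry \<Gamma>' e \<notin> C'" for C'
  proof -
    obtain C where C: "C \<in> pi0 ?\<gamma>" "C' = f ` C" using iso_maps_pi0[OF wfs m\<gamma>] C'(1) by auto
    have un: "\<forall>e\<in>S. bdry \<Gamma> e \<notin> C"
      using C'(2) C graph_embeddingD(5)[OF em] SE by (auto simp: subset_iff)
    then have "j C = i C" using A C by (auto simp: admissible_cut_def)
    moreover have "i' (f ` C) = i C"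
      using m uncut_component_pi0[OF wf\<Gamma>(1) S(1) C(1) un] by (auto simp: iso_maps_alt)
    ultimately show ?thesis using j' C by simp
  qed
  ultimately have "admissible_cut T \<Gamma>' i' (g ` S) j'" using S' by (auto simp: admissible_cut_def)
  then show ?thesis using m\<gamma> by blast
qed

lemma contract_iso:
  assumes wf: "wf_spec (\<Gamma>, i)" "wf_spec (\<Gamma>', i')" and m: "iso_maps f g (\<Gamma>, i) (\<Gamma>', i')"
    and S: "edge_closed \<Gamma> S" "edge_closed \<Gamma>' S'"
    and wfs: "wf_spec (cut \<Gamma> S, j)" "wf_spec (cut \<Gamma>' S', j')"
    and m\<gamma>: "iso_maps f g (cut \<Gamma> S, j) (cut \<Gamma>' S', j')"
  shows "spec_iso (contract (\<Gamma>, i) (cut \<Gamma> S, j)) (contract (\<Gamma>', i') (cut \<Gamma>' S', j'))"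
proof -
  have wf\<Gamma>: "feynman_graph \<Gamma>" "feynman_graph \<Gamma>'" using wf by (auto simp: wf_spec_def)
  let ?\<gamma> = "cut \<Gamma> S" and ?\<gamma>' = "cut \<Gamma>' S'"
  let ?Q = "contract_graph \<Gamma> (?\<gamma>, j)" and ?Q' = "contract_graph \<Gamma>' (?\<gamma>', j')"
  have wf\<gamma>: "feynman_graph ?\<gamma>" "feynman_graph ?\<gamma>'" using wfs by (auto simp: wf_spec_def)
  have wfQ: "feynman_graph ?Q" "feynman_graph ?Q'"
    using feynman_contract_graph[OF wf\<Gamma>(1) S(1)] feynman_contract_graph[OF wf\<Gamma>(2) S(2)] by auto
  note em = iso_maps_embedding[OF m, unfolded fst_conv]
  note em\<gamma> = iso_maps_embedding[OF m\<gamma>, unfolded fst_conv]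
  have injf: "inj_on f (vertices \<Gamma>)" and injg: "inj_on g (half_edges \<Gamma>)"
    using m by (auto simp: iso_maps_alt bij_betw_def)
  have gE: "half_edges \<Gamma>' = g ` half_edges \<Gamma>"
    using m by (auto simp: iso_maps_alt bij_betw_def)
  have "bij_betw ((`) f) (pi0 ?\<gamma>) (pi0 ?\<gamma>')"
  proof -
    have "inj_on ((`) f) (pi0 ?\<gamma>)"
      using pi0_vertices[OF wf\<gamma>(1)] by (intro inj_on_image inj_on_subset[OF injf]) auto
    then show ?thesis using iso_maps_pi0[OF wfs m\<gamma>] by (simp add: bij_betw_def)
  qed
  moreover have "bij_betw g (external ?\<gamma>) (external ?\<gamma>')"
  proof -
    have "invol ?\<gamma>' (g e) = g e \<longleftrightarrow> invol ?\<gamma> e = e" if "e \<in> half_edges \<Gamma>" for e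
      using that graph_embeddingD(2,6)[OF em\<gamma>] feynmanD(2)[OF wf\<gamma>(1), of e] by (auto dest: inj_onD)
    then have "external ?\<gamma>' = g ` external ?\<gamma>" 
      unfolding external_def cut_sel(2) gE by (auto simp del: cut_sel)
    moreover have "inj_on g (external ?\<gamma>)"
      by (rule inj_on_subset[OF injg]) (auto simp: external_def)
    ultimately show ?thesis by (simp add: bij_betw_def)
  qed
  moreover have E: "e \<in> half_edges \<Gamma>" if "e \<in> external ?\<gamma>" for e using that by (simp add: external_def)
  moreover have "component_of ?\<gamma>' (bdry \<Gamma>' (g e)) = f ` component_of ?\<gamma> (bdry \<Gamma> e)"
    if "e \<in> half_edges \<Gamma>" for e
    using embedding_component_of[OF wf\<gamma>(1) em\<gamma>, of "bdry \<Gamma> e"] graph_embeddingD(5)[OF em that]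
      feynmanD(1)[OF wf\<Gamma>(1) that] by simp
  moreover have "j' (f ` C) = j C" if "C \<in> pi0 ?\<gamma>" for C using m\<gamma> that by (simp add: iso_maps_alt)
  ultimately have 1: "bij_betw ((`) f) (vertices ?Q) (vertices ?Q') \<and>
     bij_betw g (half_edges ?Q) (half_edges ?Q') \<and>
     (\<forall>e\<in>half_edges ?Q. bdry ?Q' (g e) = f ` bdry ?Q e \<and>
        invol ?Q' (g e) = g (invol ?Q e) \<and> etype ?Q' (g e) = etype ?Q e) \<and>
     (\<forall>v\<in>vertices ?Q. vindex ?Q' (f ` v) = vindex ?Q v)"
    using graph_embeddingD(6,7)[OF em] by auto
  then have emQ: "graph_embedding ((`) f) g ?Q ?Q'"
    by (auto simp: graph_embedding_def bij_betw_def)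
  have "i' (\<Union> ((`) f ` D)) = i (\<Union>D)" if D: "D \<in> pi0 ?Q" for D
  proof -
    obtain C where C: "C \<in> pi0 \<Gamma>" "D = component_of ?\<gamma> ` C"
      using D unfolding pi0_contract_graph[OF wf\<Gamma>(1) S(1)] by auto
    have "\<Union>D = C" using Union_image_component_of[OF wf\<Gamma>(1) C(1)] C(2) by simp
    moreover have "\<Union> ((`) f ` D) = f ` \<Union>D" by auto
    ultimately show ?thesis using m C(1) by (simp add: iso_maps_alt)
  qed
  then have "iso_maps ((`) f) g (contract (\<Gamma>, i) (?\<gamma>, j)) (contract (\<Gamma>', i') (?\<gamma>', j'))"
    unfolding iso_maps_alt contract_pair fst_conv snd_conv
    using 1 embedding_pi0[OF wfQ(1) emQ] by auto
  then show ?thesis using wfQ by (auto simp: spec_iso_def contract_pair wf_spec_def)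
qed

lemma admissible_cut_iso_unique:
  assumes m: "iso_maps f g (\<Gamma>, i) (\<Gamma>', i')" and wf: "feynman_graph \<Gamma>"
    and A: "admissible_cut T \<Gamma> i S1 j1" "admissible_cut T \<Gamma> i S2 j2"
    and m12: "iso_maps f g (cut \<Gamma> S1, j1) b" "iso_maps f g (cut \<Gamma> S2, j2) b"
  shows "(cut \<Gamma> S1, j1) = (cut \<Gamma> S2, j2)"
proof -
  have injg: "inj_on g (half_edges \<Gamma>)" using m by (auto simp: iso_maps_alt bij_betw_def)
  have E: "S1 \<subseteq> internal \<Gamma>" "S2 \<subseteq> internal \<Gamma>" using A by (auto simp: admissible_cut_def)
  have "e \<in> S1 \<longleftrightarrow> e \<in> S2" if e: "e \<in> internal \<Gamma>" for e
  proof -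
    have eE: "e \<in> half_edges \<Gamma>" "invol \<Gamma> e \<noteq> e" using e by (auto simp: internal_def)
    have "g (invol (cut \<Gamma> S1) e) = g (invol (cut \<Gamma> S2) e)"
      using m12 eE unfolding iso_maps_alt by (metis cut_sel(2) fst_conv)
    then have "invol (cut \<Gamma> S1) e = invol (cut \<Gamma> S2) e"
      by (rule inj_onD[OF injg]) (use eE feynmanD(2)[OF wf] in auto)
    then show ?thesis using eE by (auto split: if_splits)
  qed
  then have S: "S1 = S2" using E by blast
  have "j1 C = j2 C" if "C \<in> pi0 (cut \<Gamma> S1)" for C
    using m12 that unfolding S iso_maps_alt by (metis fst_conv snd_conv)
  moreover have "j1 \<in> extensional (pi0 (cut \<Gamma> S1))" "j2 \<in> extensional (pi0 (cut \<Gamma> S1))"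
    using A S by (auto simp: admissible_cut_def specified_graph_iff wf_spec_def)
  ultimately have "j1 = j2" by (auto intro: extensionalityI)
  then show ?thesis using S by simp
qed

lemma coproduct_subgraphs_iso_inj:
  fixes G :: "('v, 'e, 'h) spec_graph" and G' :: "('w, 'f, 'h) spec_graph"
  assumes iso: "spec_iso G G'" and G: "specified_graph T G"
  shows "\<exists>F. inj_on F (coproduct_subgraphs T G) \<and> F ` coproduct_subgraphs T G \<subseteq> coproduct_subgraphs T G' \<and>
    (\<forall>g\<in>coproduct_subgraphs T G. spec_iso g (F g) \<and> spec_iso (contract G g) (contract G' (F g)))"
proof -
  obtain \<Gamma> i \<Gamma>' i' where [simp]: "G = (\<Gamma>, i)" "G' = (\<Gamma>', i')" by (cases G, cases G') auto
  obtain f g where wf: "wf_spec (\<Gamma>, i)" "wf_spec (\<Gamma>', i')" and m: "iso_maps f g (\<Gamma>, i) (\<Gamma>', i')"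
    using iso by (auto simp: spec_iso_def)
  have wf\<Gamma>: "feynman_graph \<Gamma>" using wf by (simp add: wf_spec_def)
  have G': "specified_graph T (\<Gamma>', i')" using spec_iso_specified[OF iso] G by simp
  let ?A = "coproduct_subgraphs T (\<Gamma>, i)" and ?B = "coproduct_subgraphs T (\<Gamma>', i')"
  have Aeq: "?A = {(cut \<Gamma> S, j) | S j. admissible_cut T \<Gamma> i S j}"
    using coproduct_subgraphs_eq G by simp
  have Beq: "?B = {(cut \<Gamma>' S, j) | S j. admissible_cut T \<Gamma>' i' S j}"
    by (rule coproduct_subgraphs_eq[OF G'])
  have ex: "\<exists>b\<in>?B. iso_maps f g a b \<and> spec_iso (contract G a) (contract G' b)" if "a \<in> ?A" for a
  proof -
    obtain S j where a: "a = (cut \<Gamma> S, j)" "admissible_cut T \<Gamma> i S j"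
      using \<open>a \<in> ?A\<close> unfolding Aeq by blast
    obtain S' j' where b: "admissible_cut T \<Gamma>' i' S' j'" "iso_maps f g (cut \<Gamma> S, j) (cut \<Gamma>' S', j')"
      using admissible_cut_iso[OF wf m a(2)] by blast
    have "spec_iso (contract (\<Gamma>, i) (cut \<Gamma> S, j)) (contract (\<Gamma>', i') (cut \<Gamma>' S', j'))"
      by (rule contract_iso[OF wf m _ _ _ _ b(2)])
        (use a b specified_graph_wf in \<open>auto simp: admissible_cut_def\<close>)
    then show ?thesis using a b Beq by auto
  qed
  then obtain F where F: "\<And>a. a \<in> ?A \<Longrightarrow> F a \<in> ?B \<and> iso_maps f g a (F a) \<and>
      spec_iso (contract G a) (contract G' (F a))" by metis
  have "inj_on F ?A"
  proof (rule inj_onI)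
    fix a b assume ab: "a \<in> ?A" "b \<in> ?A" "F a = F b"
    obtain S1 j1 S2 j2 where s: "a = (cut \<Gamma> S1, j1)" "admissible_cut T \<Gamma> i S1 j1"
      "b = (cut \<Gamma> S2, j2)" "admissible_cut T \<Gamma> i S2 j2" using ab unfolding Aeq by blast
    have "iso_maps f g a (F a)" "iso_maps f g b (F a)" using F[OF ab(1)] F[OF ab(2)] ab(3) by simp_all
    then show "a = b" unfolding s by (rule admissible_cut_iso_unique[OF m wf\<Gamma> s(2,4)])
  qed
  moreover have "spec_iso a (F a)" if "a \<in> ?A" for a
  proof -
    have "wf_spec a" using coproduct_subgraphs_specified(1)[OF G, of a] that by (auto intro: specified_graph_wf)
    moreover have "wf_spec (F a)"
      using coproduct_subgraphs_specified(1)[OF G', of "F a"] F[OF that] by (auto intro: specified_graph_wf)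
    ultimately show ?thesis using F[OF that] unfolding spec_iso_def by blast
  qed
  ultimately show ?thesis using F by (intro exI[of _ F]) auto
qed

text \<open>
  Isomorphic graphs have finitely many and, by the injections in both directions, equally many
  subgraphs, so one of these injections is a bijection.
\<close>

lemma coproduct_subgraphs_sum_iso:
  fixes G :: "('v, 'e, 'h) spec_graph" and G' :: "('w, 'f, 'h) spec_graph"
  assumes T: "physical_theory T" and iso: "spec_iso G G'" and G: "specified_graph T G"
    and \<Phi>: "\<And>g h. g \<in> coproduct_subgraphs T G \<Longrightarrow> h \<in> coproduct_subgraphs T G' \<Longrightarrow> spec_iso g h \<Longrightarrow>
      spec_iso (contract G g) (contract G' h) \<Longrightarrow> \<Phi> g = \<Psi> h"
  shows "(\<Sum>g\<in>coproduct_subgraphs T G. \<Phi> g) = (\<Sum>h\<in>coproduct_subgraphs T G'. \<Psi> h)"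
proof -
  let ?A = "coproduct_subgraphs T G" and ?B = "coproduct_subgraphs T G'"
  have G': "specified_graph T G'" using spec_iso_specified[OF iso] G by simp
  have fin: "finite ?A" "finite ?B" by (rule finite_coproduct_subgraphs[OF T G], rule finite_coproduct_subgraphs[OF T G'])
  obtain F where F: "inj_on F ?A" "F ` ?A \<subseteq> ?B"
    "\<forall>g\<in>?A. spec_iso g (F g) \<and> spec_iso (contract G g) (contract G' (F g))"
    using coproduct_subgraphs_iso_inj[OF iso G] by blast
  obtain F' where F': "inj_on F' ?B" "F' ` ?B \<subseteq> ?A"
    using coproduct_subgraphs_iso_inj[OF spec_iso_sym[OF iso] G'] by blast
  have "card ?B \<le> card (F ` ?A)"
    using card_inj_on_le[OF F' fin(1)] card_image[OF F(1)] by simp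
  then have "F ` ?A = ?B" by (intro card_seteq[OF fin(2) F(2)])
  then have "(\<Sum>h\<in>?B. \<Psi> h) = (\<Sum>g\<in>?A. \<Psi> (F g))"
    using sum.reindex[OF F(1), of \<Psi>] by simp
  also have "\<dots> = (\<Sum>g\<in>?A. \<Phi> g)" using F \<Phi> by (intro sum.cong refl) (metis image_subset_iff)
  finally show ?thesis by simp
qed

section \<open>Subgraphs of subgraphs\<close>

text \<open>
  A component of \<open>\<delta>\<close> without cut edges is a common component of \<open>\<delta>\<close>,
  \<open>\<gamma>\<close> and \<open>\<Gamma>\<close>, so the specifications agree by comparing both with that of
  \<open>\<gamma>\<close>.
\<close>

lemma admissible_cut_trans:
  assumes wf: "feynman_graph \<Gamma>" and A: "admissible_cut T \<Gamma> i S k" "admissible_cut T (cut \<Gamma> S) k R j"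
  shows "admissible_cut T \<Gamma> i (S \<union> R) j"
proof -
  have S: "edge_closed \<Gamma> S" "S \<subseteq> internal \<Gamma>" using A(1) by (auto simp: admissible_cut_def)
  have R: "edge_closed (cut \<Gamma> S) R" "R \<subseteq> internal \<Gamma> - S"
    using A(2) by (auto simp: admissible_cut_def internal_cut)
  have SR: "edge_closed \<Gamma> (S \<union> R)" "S \<union> R \<subseteq> internal \<Gamma>"
  proof -
    have "invol \<Gamma> e \<in> R" if e: "e \<in> R" for e
    proof -
      have "invol (cut \<Gamma> S) e \<in> R" using R(1) e unfolding edge_closed_def by blast
      moreover have "e \<notin> S" using R(2) e by blast
      ultimately show ?thesis by simp
    qed
    then show "edge_closed \<Gamma> (S \<union> R)" using S R(1) by (auto simp: edge_closed_def)
    show "S \<union> R \<subseteq> internal \<Gamma>" using S R(2) by blast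
  qed
  have "j C = i C" if C: "C \<in> pi0 (cut \<Gamma> (S \<union> R))" "\<forall>e\<in>S \<union> R. bdry \<Gamma> e \<notin> C" for C
  proof -
    have "j C = k C" using A(2) C by (auto simp: admissible_cut_def cut_cut)
    moreover have "C \<in> pi0 (cut \<Gamma> S)"
      using uncut_component_pi0[OF feynman_cut[OF wf S(1)] R(1)] C by (auto simp: cut_cut)
    then have "k C = i C" using A(1) C by (auto simp: admissible_cut_def)
    ultimately show ?thesis by simp
  qed
  then show ?thesis using A(2) SR by (auto simp: admissible_cut_def cut_cut)
qed

lemma contract_subgraph_cut:
  "contract_graph (cut \<Gamma> S) (cut (cut \<Gamma> S) R, j) = cut (contract_graph \<Gamma> (cut (cut \<Gamma> S) R, j)) S"
  by (rule fgraph.equality) (auto simp: contract_graph_def cut_def)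

text \<open>
  The edges in which \<open>\<gamma>\<close> differs from \<open>\<Gamma>\<close> are cut in \<open>\<delta>\<close> as well,
  hence are still edges of \<open>\<Gamma>/\<delta>\<close>, and cutting them there gives
  \<open>\<gamma>/\<delta>\<close> by \<open>contract_subgraph_cut\<close>.
\<close>

lemma contract_subgraph_mem:
  assumes G: "specified_graph T (\<Gamma>, i)" and A: "admissible_cut T \<Gamma> i S k" "admissible_cut T (cut \<Gamma> S) k R j"
  shows "contract (cut \<Gamma> S, k) (cut (cut \<Gamma> S) R, j) \<in>
    coproduct_subgraphs T (contract (\<Gamma>, i) (cut (cut \<Gamma> S) R, j))"
proof -
  have wf: "feynman_graph \<Gamma>" using specified_feynman[OF G] by simp
  let ?\<gamma> = "cut \<Gamma> S" and ?\<delta> = "cut (cut \<Gamma> S) R"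
  let ?Q = "contract_graph \<Gamma> (?\<delta>, j)" and ?K = "contract_graph ?\<gamma> (?\<delta>, j)"
  have \<delta>: "?\<delta> = cut \<Gamma> (S \<union> R)" by (rule cut_cut)
  note SR = admissible_cut_trans[OF wf A]
  have SRc: "edge_closed \<Gamma> (S \<union> R)" "S \<union> R \<subseteq> internal \<Gamma>" using SR by (auto simp: admissible_cut_def)
  have S: "edge_closed \<Gamma> S" "S \<subseteq> internal \<Gamma>" and g: "specified_graph T (?\<gamma>, k)"
    using A(1) by (auto simp: admissible_cut_def)
  have R: "edge_closed ?\<gamma> R" using A(2) by (auto simp: admissible_cut_def)
  have wf\<gamma>: "feynman_graph ?\<gamma>" by (rule feynman_cut[OF wf S(1)])
  have wf\<delta>: "feynman_graph ?\<delta>" by (rule feynman_cut[OF wf\<gamma> R])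
  have K: "?K = cut ?Q S" by (rule contract_subgraph_cut)
  have spQ: "specified_graph T (contract (\<Gamma>, i) (?\<delta>, j))"
    unfolding \<delta> by (rule specified_contract[OF G SR])
  have spK: "specified_graph T (contract (?\<gamma>, k) (?\<delta>, j))"
    by (rule specified_contract[OF g A(2)])
  have SQ: "S \<subseteq> internal ?Q" "edge_closed ?Q S"
    using internal_contract_graph[OF SRc(2), of j] S(1) external_cut[of "S \<union> R" \<Gamma>] SRc
    unfolding \<delta> by (auto simp: edge_closed_def)
  have "k (\<Union>D) = (\<lambda>D\<in>pi0 ?Q. i (\<Union>D)) D"
    if D: "D \<in> pi0 (cut ?Q S)" "\<forall>e\<in>S. bdry ?Q e \<notin> D" for D
  proof -
    obtain C where C: "C \<in> pi0 ?\<gamma>" "D = component_of ?\<delta> ` C"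
      using D(1) unfolding K[symmetric] pi0_contract_graph[OF wf\<gamma> R] by auto
    have un: "\<forall>e\<in>S. bdry \<Gamma> e \<notin> C" using D(2) C(2) by auto
    have C\<Gamma>: "C \<in> pi0 \<Gamma>" by (rule uncut_component_pi0[OF wf S(1) C(1) un])
    have "D \<in> pi0 ?Q" unfolding \<delta> pi0_contract_graph[OF wf SRc(1)] using C\<Gamma> C(2) \<delta> by auto
    moreover have "\<Union>D = C" using Union_image_component_of[OF wf\<gamma> C(1)] C(2) by simp
    moreover have "k C = i C" using A(1) C(1) un by (auto simp: admissible_cut_def)
    ultimately show ?thesis by simp
  qed
  then have "admissible_cut T ?Q (\<lambda>D\<in>pi0 ?Q. i (\<Union>D)) S (\<lambda>D\<in>pi0 ?K. k (\<Union>D))"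
    using SQ spK unfolding admissible_cut_def K contract_pair by auto
  then show ?thesis
    using coproduct_subgraphs_eq[OF spQ[unfolded contract_pair]] K by (auto simp: contract_pair)
qed

text \<open>
  A vertex of \<open>(\<Gamma>/\<delta>)/(\<gamma>/\<delta>)\<close> is a set of components of \<open>\<delta>\<close>; its
  union is a component of \<open>\<gamma>\<close>, that is, a vertex of \<open>\<Gamma>/\<gamma>\<close>. Both
  contractions have the external half-edges of \<open>\<gamma>\<close> as half-edges. The isomorphism is
  therefore given by \<open>Union\<close> and the identity.
\<close>

lemma contract_contract:
  assumes G: "specified_graph T (\<Gamma>, i)" and A: "admissible_cut T \<Gamma> i S k" "admissible_cut T (cut \<Gamma> S) k R j"
  shows "spec_iso (contract (contract (\<Gamma>, i) (cut (cut \<Gamma> S) R, j)) (contract (cut \<Gamma> S, k) (cut (cut \<Gamma> S) R, j)))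
    (contract (\<Gamma>, i) (cut \<Gamma> S, k))"
proof -
  have wf: "feynman_graph \<Gamma>" using specified_feynman[OF G] by simp
  let ?\<gamma> = "cut \<Gamma> S" and ?\<delta> = "cut (cut \<Gamma> S) R"
  define Q where "Q = contract_graph \<Gamma> (?\<delta>, j)"
  define K where "K = contract_graph ?\<gamma> (?\<delta>, j)"
  let ?kK = "\<lambda>D\<in>pi0 K. k (\<Union>D)" and ?iQ = "\<lambda>D\<in>pi0 Q. i (\<Union>D)"
  have \<delta>: "?\<delta> = cut \<Gamma> (S \<union> R)" by (rule cut_cut)
  note SR = admissible_cut_trans[OF wf A]
  have SRc: "edge_closed \<Gamma> (S \<union> R)" using SR by (auto simp: admissible_cut_def)
  have S: "edge_closed \<Gamma> S" and g: "specified_graph T (?\<gamma>, k)"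
    using A(1) by (auto simp: admissible_cut_def)
  have R: "edge_closed ?\<gamma> R" using A(2) by (auto simp: admissible_cut_def)
  have wf\<gamma>: "feynman_graph ?\<gamma>" by (rule feynman_cut[OF wf S])
  have K: "K = cut Q S" unfolding K_def Q_def by (rule contract_subgraph_cut)
  have wfQ: "feynman_graph Q" unfolding Q_def \<delta> by (rule feynman_contract_graph[OF wf SRc])
  have SQ: "edge_closed Q S"
    unfolding Q_def \<delta> using S external_cut[of "S \<union> R" \<Gamma>] SRc by (auto simp: edge_closed_def)
  let ?L = "contract_graph Q (K, ?kK)" and ?M = "contract_graph \<Gamma> (?\<gamma>, k)"
  have wfL: "feynman_graph ?L" unfolding K by (rule feynman_contract_graph[OF wfQ SQ])
  have wfM: "feynman_graph ?M" by (rule feynman_contract_graph[OF wf S])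
  have pK: "pi0 K = (\<lambda>C. component_of ?\<delta> ` C) ` pi0 ?\<gamma>"
    unfolding K_def by (rule pi0_contract_graph[OF wf\<gamma> R])
  have U: "\<Union> (component_of ?\<delta> ` C) = C" if "C \<in> pi0 ?\<gamma>" for C
    by (rule Union_image_component_of[OF wf\<gamma> that])
  have bv: "bij_betw Union (pi0 K) (pi0 ?\<gamma>)"
    by (rule bij_betw_byWitness[where f' = "\<lambda>C. component_of ?\<delta> ` C"]) (auto simp: pK U)
  have eK: "external K = external ?\<gamma>"
    unfolding K_def by (rule external_contract_graph) (use R in \<open>simp add: edge_closed_def\<close>)
  have bd: "\<Union> (component_of K (bdry Q e)) = component_of ?\<gamma> (bdry \<Gamma> e)" if "e \<in> half_edges \<Gamma>" for e
    using Union_component_of_contract_graph[OF wf\<gamma> R, of "bdry \<Gamma> e" j] feynmanD(1)[OF wf that]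
    by (simp add: K_def Q_def)
  have E: "e \<in> half_edges \<Gamma>" if "e \<in> external ?\<gamma>" for e using that by (simp add: external_def)
  have 1: "bij_betw Union (vertices ?L) (vertices ?M) \<and>
     bij_betw (\<lambda>e. e) (half_edges ?L) (half_edges ?M) \<and>
     (\<forall>e\<in>half_edges ?L. bdry ?M e = \<Union> (bdry ?L e) \<and>
        invol ?M e = invol ?L e \<and> etype ?M e = etype ?L e) \<and>
     (\<forall>v\<in>vertices ?L. vindex ?M (\<Union>v) = vindex ?L v)"
    using bv bd E by (simp add: eK) (simp add: Q_def bij_betw_def)
  then have em: "graph_embedding Union (\<lambda>e. e) ?L ?M"
    by (auto simp: graph_embedding_def bij_betw_def)
  have "snd (contract (\<Gamma>, i) (?\<gamma>, k)) (Union ` D) = snd (contract (Q, ?iQ) (K, ?kK)) D"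
    if D: "D \<in> pi0 ?L" for D
  proof -
    obtain B where B: "B \<in> pi0 Q" "D = component_of K ` B"
      using D unfolding K pi0_contract_graph[OF wfQ SQ] by auto
    have "\<Union>D = B" using Union_image_component_of[OF wfQ B(1), of S] B(2) by (simp add: K)
    moreover have "\<Union> (Union ` D) = \<Union> (\<Union>D)" by auto
    ultimately have "?iQ (\<Union>D) = i (\<Union> (Union ` D))" using B(1) by simp
    then show ?thesis using embedding_pi0[OF wfL em D] D by (simp add: contract_pair)
  qed
  then have "iso_maps Union (\<lambda>e. e) (contract (Q, ?iQ) (K, ?kK)) (contract (\<Gamma>, i) (?\<gamma>, k))"
    unfolding iso_maps_alt using 1 by (simp add: contract_pair)
  moreover have "contract (contract (\<Gamma>, i) (?\<delta>, j)) (contract (?\<gamma>, k) (?\<delta>, j)) =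
      contract (Q, ?iQ) (K, ?kK)"
    by (simp add: contract_pair Q_def K_def)
  moreover have "wf_spec (contract (Q, ?iQ) (K, ?kK))" "wf_spec (contract (\<Gamma>, i) (?\<gamma>, k))"
    using wfL wfM by (simp_all add: contract_pair wf_spec_def)
  ultimately show ?thesis unfolding spec_iso_def by auto
qed

text \<open>
  Conversely, a subgraph of \<open>\<Gamma>/\<delta>\<close> is \<open>\<gamma>/\<delta>\<close> for the graph \<open>\<gamma>\<close>
  obtained by cutting the same edges in \<open>\<Gamma>\<close>, with the specification pulled back along
  the contraction of \<open>\<delta>\<close>. This is where extensions of bridgeless graphs have to be
  bridgeless.
\<close>

lemma lift_contracted_subgraph:
  assumes G: "specified_graph T (\<Gamma>, i)" and A: "admissible_cut T \<Gamma> i P j"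
    and B: "admissible_cut T (contract_graph \<Gamma> (cut \<Gamma> P, j))
      (\<lambda>D\<in>pi0 (contract_graph \<Gamma> (cut \<Gamma> P, j)). i (\<Union>D)) S l"
  shows "\<exists>k. admissible_cut T \<Gamma> i S k \<and> admissible_cut T (cut \<Gamma> S) k (P - S) j \<and>
    cut (cut \<Gamma> S) (P - S) = cut \<Gamma> P \<and>
    contract (cut \<Gamma> S, k) (cut \<Gamma> P, j) = (cut (contract_graph \<Gamma> (cut \<Gamma> P, j)) S, l)"
proof -
  have wf: "feynman_graph \<Gamma>" using specified_feynman[OF G] by simp
  define \<delta> where "\<delta> = cut \<Gamma> P"
  define \<gamma> where "\<gamma> = cut \<Gamma> S"
  define Q where "Q = contract_graph \<Gamma> (\<delta>, j)"
  define K where "K = cut Q S"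
  define k where "k = (\<lambda>C\<in>pi0 \<gamma>. l (component_of \<delta> ` C))"
  let ?R = "P - S"
  have P: "edge_closed \<Gamma> P" "P \<subseteq> internal \<Gamma>" and d: "specified_graph T (\<delta>, j)"
    using A by (auto simp: admissible_cut_def \<delta>_def)
  have "internal Q = P" unfolding Q_def \<delta>_def by (rule internal_contract_graph[OF P(2)])
  then have SP: "S \<subseteq> P" and SQ: "edge_closed Q S" and spK: "specified_graph T (K, l)"
    using B by (auto simp: admissible_cut_def Q_def \<delta>_def K_def)
  have S: "edge_closed \<Gamma> S" "S \<subseteq> internal \<Gamma>"
    using SQ SP P by (auto simp: edge_closed_def Q_def)
  have wf\<gamma>: "feynman_graph \<gamma>" unfolding \<gamma>_def by (rule feynman_cut[OF wf S(1)])
  have \<delta>: "cut \<gamma> ?R = \<delta>" using SP by (simp add: \<gamma>_def \<delta>_def cut_cut Un_absorb1)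
  have R: "edge_closed \<gamma> ?R" "?R \<subseteq> internal \<gamma>"
    using P edge_closed_iff[OF wf S(1)] by (auto simp: edge_closed_def \<gamma>_def internal_cut)
  have K: "contract_graph \<gamma> (\<delta>, j) = K"
    using contract_subgraph_cut[of \<Gamma> S ?R j] by (simp add: K_def Q_def \<delta>[symmetric] \<gamma>_def)
  have pK: "pi0 K = (\<lambda>C. component_of \<delta> ` C) ` pi0 \<gamma>"
    using pi0_contract_graph[OF wf\<gamma> R(1), of j] by (simp add: \<delta> K)
  have V: "vertices \<gamma> = vertices \<Gamma>" "vertices \<delta> = vertices \<Gamma>" "vertices K = pi0 \<delta>"
    by (simp_all add: \<gamma>_def \<delta>_def K_def Q_def)
  have k: "k C = l (component_of \<delta> ` C)" if "C \<in> pi0 \<gamma>" for C using that by (simp add: k_def)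
  have loc: "(residue_star \<gamma> (component_of \<gamma> v), k (component_of \<gamma> v)) \<in> vertex_types T"
    "(\<forall>e\<in>?R. bdry \<Gamma> e \<notin> component_of \<delta> v) \<Longrightarrow> k (component_of \<gamma> v) = j (component_of \<delta> v)"
    if v: "v \<in> vertices \<Gamma>" for v
  proof -
    have "component_of \<delta> v \<in> vertices K" unfolding V using v V by auto
    then have "spec_at T K l (component_of \<delta> v)" using spK by (simp add: specified_graph_iff)
    moreover have "l (component_of \<delta> ` component_of \<gamma> v) = k (component_of \<gamma> v)"
      using k[of "component_of \<gamma> v"] component_of_pi0[of v \<gamma>] v V by simp
    ultimately show "(residue_star \<gamma> (component_of \<gamma> v), k (component_of \<gamma> v)) \<in> vertex_types T"
      "(\<forall>e\<in>?R. bdry \<Gamma> e \<notin> component_of \<delta> v) \<Longrightarrow> k (component_of \<gamma> v) = j (component_of \<delta> v)"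
      using spec_at_contract_graph[where v = v and k = l and i = k and j = j and T = T, OF wf\<gamma> R] v unfolding \<delta> K V by (auto simp: \<gamma>_def)
  qed
  have b: "bridgeless \<gamma>"
    by (rule bridgeless_extension[OF wf\<gamma> R(1), of j])
      (use specified_bridgeless[OF d] specified_bridgeless[OF spK] \<delta> K in auto)
  have sp\<gamma>: "specified_graph T (\<gamma>, k)"
    unfolding specified_graph_iff
  proof (intro conjI ballI)
    show "wf_spec (\<gamma>, k)" using wf\<gamma> by (simp add: wf_spec_def k_def)
    fix v assume v: "v \<in> vertices \<gamma>"
    then have dv: "spec_at T \<delta> j v" using d by (simp add: specified_graph_iff V)
    (* a vertex without internal edges in \<gamma> is a common component of \<gamma> and \<delta>, whose index
       in \<delta> is its own *)
    have "k (component_of \<gamma> v) = vindex \<gamma> v" if bare: "bare \<gamma> v"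
    proof -
      have "bare \<delta> v" using bare by (auto simp: bare_def \<delta>[symmetric])
      then have "j {v} = vindex \<delta> v" using dv by (simp add: spec_at_def component_of_bare)
      moreover have "\<forall>e\<in>?R. bdry \<Gamma> e \<notin> component_of \<delta> v"
        using bare R(2) component_of_bare[OF \<open>bare \<delta> v\<close>] by (auto simp: bare_def internal_def \<gamma>_def)
      ultimately show ?thesis
        using loc(2)[of v] v component_of_bare[OF \<open>bare \<delta> v\<close>] by (simp add: V) (simp add: \<gamma>_def \<delta>_def)
    qed
    moreover have "vertex_type \<gamma> v \<in> vertex_types T"
      using dv by (simp add: spec_at_def vertex_type_def \<delta>_def \<gamma>_def)
    moreover have "etype \<gamma> e \<in> edge_types T" if "e \<in> half_edges \<gamma>" "bdry \<gamma> e = v" for e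
      using dv that by (simp add: spec_at_def \<delta>_def \<gamma>_def)
    moreover have "bdry \<gamma> (invol \<gamma> e) \<in> component_of (cut \<gamma> {e, invol \<gamma> e}) v"
      if "e \<in> half_edges \<gamma>" "bdry \<gamma> e = v" for e
      using b that unfolding bridgeless_def by blast
    ultimately show "spec_at T \<gamma> k v" unfolding spec_at_def using loc(1)[of v] v V by auto
  qed
  have "k C = i C" if C: "C \<in> pi0 \<gamma>" "\<forall>e\<in>S. bdry \<Gamma> e \<notin> C" for C
  proof -
    let ?D = "component_of \<delta> ` C"
    have C\<Gamma>: "C \<in> pi0 \<Gamma>" using uncut_component_pi0[OF wf S(1)] C by (simp add: \<gamma>_def)
    have U: "\<Union>?D = C" unfolding \<delta>_def by (rule Union_image_component_of[OF wf C\<Gamma>])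
    have "bdry Q e \<notin> ?D" if "e \<in> S" for e
    proof
      assume "bdry Q e \<in> ?D"
      then have "bdry \<Gamma> e \<in> \<Union>?D" using component_of_refl[of "bdry \<Gamma> e" \<delta>] by (auto simp: Q_def)
      then show False using C(2) that U by blast
    qed
    moreover have "?D \<in> pi0 K" using C(1) by (simp add: pK)
    moreover have "?D \<in> pi0 Q" using C\<Gamma> pi0_contract_graph[OF wf P(1)] by (simp add: Q_def \<delta>_def)
    ultimately have "l ?D = i (\<Union>?D)"
      using B by (auto simp: admissible_cut_def K_def Q_def \<delta>_def)
    then show ?thesis using k[OF C(1)] U by simp
  qed
  then have 1: "admissible_cut T \<Gamma> i S k" using S sp\<gamma> by (simp add: admissible_cut_def \<gamma>_def)
  have "j C = k C" if C: "C \<in> pi0 \<delta>" "\<forall>e\<in>?R. bdry \<Gamma> e \<notin> C" for C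
  proof -
    obtain v where v: "v \<in> vertices \<Gamma>" "C = component_of \<delta> v" using C(1) V by (auto simp: pi0_def)
    have "component_of \<gamma> v = C"
      by (rule uncut_component[OF wf\<gamma> R(1)]) (use C v \<delta> in \<open>auto simp: \<gamma>_def\<close>)
    then show ?thesis using loc(2)[OF v(1)] C(2) v(2) by simp
  qed
  then have 2: "admissible_cut T \<gamma> k ?R j"
    using R d by (simp add: admissible_cut_def \<delta>) (simp add: \<gamma>_def)
  have "(\<lambda>D\<in>pi0 K. k (\<Union>D)) = l"
  proof (rule extensionalityI)
    show "l \<in> extensional (pi0 K)" using spK by (simp add: specified_graph_iff wf_spec_def)
    fix D assume "D \<in> pi0 K"
    then obtain C where C: "C \<in> pi0 \<gamma>" "D = component_of \<delta> ` C" by (auto simp: pK)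
    have "\<Union>D = C" using Union_image_component_of[OF wf\<gamma> C(1), of ?R] C(2) by (simp add: \<delta>)
    then show "(\<lambda>D\<in>pi0 K. k (\<Union>D)) D = l D" using C k \<open>D \<in> pi0 K\<close> by simp
  qed simp
  then have 3: "contract (\<gamma>, k) (\<delta>, j) = (K, l)" by (simp add: contract_pair K)
  show ?thesis using 1 2 3 \<delta> by (auto simp: \<gamma>_def \<delta>_def K_def Q_def)
qed

text \<open>
  A chain \<open>\<delta> \<subseteq> \<gamma> \<subseteq> \<Gamma>\<close> amounts to a subgraph \<open>\<delta>\<close> of
  \<open>\<Gamma>\<close> together with the subgraph \<open>\<gamma>/\<delta>\<close> of \<open>\<Gamma>/\<delta>\<close>:
  \<open>\<gamma>/\<delta>\<close> has the involution of \<open>\<gamma>\<close>, and its specification is that of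
  \<open>\<gamma>\<close> read on sets of components of \<open>\<delta>\<close>, so \<open>\<gamma>\<close> can be recovered.
\<close>

lemma coassociativity_bij:
  assumes G: "specified_graph T G"
  shows "bij_betw (\<lambda>(g, d). (d, contract g d))
    (Sigma (coproduct_subgraphs T G) (coproduct_subgraphs T))
    (Sigma (coproduct_subgraphs T G) (\<lambda>d. coproduct_subgraphs T (contract G d)))"
    (is "bij_betw ?F ?X ?Y")
    and "g \<in> coproduct_subgraphs T G \<Longrightarrow> d \<in> coproduct_subgraphs T g \<Longrightarrow>
      spec_iso (contract (contract G d) (contract g d)) (contract G g)"
proof -
  obtain \<Gamma> i where GG: "G = (\<Gamma>, i)" by (cases G)
  note G' = G[unfolded GG]
  have wf: "feynman_graph \<Gamma>" using specified_feynman[OF G'] by simp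
  note sub = coproduct_subgraphs_eq[OF G', folded GG]
  have X: "\<exists>S k R j. g = (cut \<Gamma> S, k) \<and> d = (cut (cut \<Gamma> S) R, j) \<and> admissible_cut T \<Gamma> i S k \<and>
      admissible_cut T (cut \<Gamma> S) k R j"
    if "g \<in> coproduct_subgraphs T G" "d \<in> coproduct_subgraphs T g" for g d
  proof -
    obtain S k where g: "g = (cut \<Gamma> S, k)" "admissible_cut T \<Gamma> i S k" using \<open>g \<in> _\<close> sub by blast
    then have "specified_graph T (cut \<Gamma> S, k)" by (simp add: admissible_cut_def)
    from coproduct_subgraphs_eq[OF this] show ?thesis using g \<open>d \<in> _\<close> by blast
  qed
  show "spec_iso (contract (contract G d) (contract g d)) (contract G g)"
    if "g \<in> coproduct_subgraphs T G" "d \<in> coproduct_subgraphs T g"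
    using X[OF that] contract_contract[OF G'] GG by auto
  have "inj_on ?F ?X"
  proof (rule inj_onI)
    fix x y assume "x \<in> ?X" "y \<in> ?X" and F: "?F x = ?F y"
    then obtain \<gamma>1 k1 \<delta>1 j1 \<gamma>2 k2 \<delta>2 j2 where xy: "x = ((\<gamma>1, k1), (\<delta>1, j1))" "y = ((\<gamma>2, k2), (\<delta>2, j2))"
      and g: "(\<gamma>1, k1) \<in> coproduct_subgraphs T G" "(\<delta>1, j1) \<in> coproduct_subgraphs T (\<gamma>1, k1)"
      "(\<gamma>2, k2) \<in> coproduct_subgraphs T G" "(\<delta>2, j2) \<in> coproduct_subgraphs T (\<gamma>2, k2)"
      by (cases x; cases y) auto
    have eq: "\<delta>1 = \<delta>2" "j1 = j2" "contract (\<gamma>1, k1) (\<delta>1, j1) = contract (\<gamma>2, k2) (\<delta>2, j2)"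
      using F unfolding xy prod.case prod.inject by blast+
    obtain S1 R1 where 1: "\<gamma>1 = cut \<Gamma> S1" "\<delta>1 = cut \<gamma>1 R1" "admissible_cut T \<Gamma> i S1 k1"
      "admissible_cut T \<gamma>1 k1 R1 j1" using X[OF g(1,2)] by auto
    obtain S2 where 2: "\<gamma>2 = cut \<Gamma> S2" "admissible_cut T \<Gamma> i S2 k2" using X[OF g(3,4)] by auto
    have e: "contract_graph \<gamma>1 (\<delta>1, j1) = contract_graph \<gamma>2 (\<delta>1, j1) \<and>
      (\<lambda>D\<in>pi0 (contract_graph \<gamma>1 (\<delta>1, j1)). k1 (\<Union>D)) =
        (\<lambda>D\<in>pi0 (contract_graph \<gamma>2 (\<delta>1, j1)). k2 (\<Union>D))"
      by (rule eq(3)[unfolded contract_pair prod.inject, folded eq(1,2)])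
    then have c: "contract_graph \<gamma>1 (\<delta>1, j1) = contract_graph \<gamma>2 (\<delta>1, j1)"
      "(\<lambda>D\<in>pi0 (contract_graph \<gamma>1 (\<delta>1, j1)). k1 (\<Union>D)) =
        (\<lambda>D\<in>pi0 (contract_graph \<gamma>1 (\<delta>1, j1)). k2 (\<Union>D))"
      by (rule conjunct1, use conjunct2[OF e] in \<open>unfold conjunct1[OF e]\<close>)
    have "invol \<gamma>1 = invol \<gamma>2" using arg_cong[OF c(1), of invol] by simp
    then have \<gamma>: "\<gamma>1 = \<gamma>2" using 1(1) 2(1) by (intro fgraph.equality) auto
    have wf\<gamma>: "feynman_graph \<gamma>1"
      using 1(3) specified_feynman[of T "(\<gamma>1, k1)"] by (simp add: admissible_cut_def 1(1))
    have R1: "edge_closed \<gamma>1 R1" using 1(4) by (simp add: admissible_cut_def)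
    have "k1 C = k2 C" if C: "C \<in> pi0 \<gamma>1" for C
    proof -
      have "component_of \<delta>1 ` C \<in> pi0 (contract_graph \<gamma>1 (\<delta>1, j1))"
        unfolding 1(2) pi0_contract_graph[OF wf\<gamma> R1] using C by simp
      moreover have "\<Union> (component_of \<delta>1 ` C) = C"
        unfolding 1(2) by (rule Union_image_component_of[OF wf\<gamma> C])
      ultimately show ?thesis using fun_cong[OF c(2), of "component_of \<delta>1 ` C"] by simp
    qed
    moreover have "k1 \<in> extensional (pi0 \<gamma>1)" "k2 \<in> extensional (pi0 \<gamma>1)"
      using 1(1,3) 2 \<gamma> by (auto simp: admissible_cut_def specified_graph_iff wf_spec_def)
    ultimately have "k1 = k2" by (auto intro: extensionalityI)
    then show "x = y" using \<gamma> eq by (simp add: xy)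
  qed
  moreover have "?F ` ?X \<subseteq> ?Y"
  proof (rule image_subsetI)
    fix x assume "x \<in> ?X"
    then obtain \<gamma> k \<delta> j where x: "x = ((\<gamma>, k), (\<delta>, j))"
      "(\<gamma>, k) \<in> coproduct_subgraphs T G" "(\<delta>, j) \<in> coproduct_subgraphs T (\<gamma>, k)" by auto
    then obtain S R where s: "\<gamma> = cut \<Gamma> S" "\<delta> = cut (cut \<Gamma> S) R" "admissible_cut T \<Gamma> i S k"
      "admissible_cut T (cut \<Gamma> S) k R j" using X by blast
    have "(\<delta>, j) \<in> coproduct_subgraphs T G"
      unfolding sub s(2) cut_cut using admissible_cut_trans[OF wf s(3,4)] by blast
    moreover have "contract (\<gamma>, k) (\<delta>, j) \<in> coproduct_subgraphs T (contract G (\<delta>, j))"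
      unfolding GG s(1,2) by (rule contract_subgraph_mem[OF G' s(3,4)])
    ultimately show "?F x \<in> ?Y" unfolding x(1) by simp
  qed
  moreover have "?Y \<subseteq> ?F ` ?X"
  proof clarify
    fix \<delta> j \<eta> l
    assume d: "(\<delta>, j) \<in> coproduct_subgraphs T G" and h: "(\<eta>, l) \<in> coproduct_subgraphs T (contract G (\<delta>, j))"
    obtain P where P: "\<delta> = cut \<Gamma> P" "admissible_cut T \<Gamma> i P j" using d unfolding sub by blast
    have "specified_graph T (contract (\<Gamma>, i) (cut \<Gamma> P, j))" by (rule specified_contract[OF G' P(2)])
    from coproduct_subgraphs_eq[OF this[unfolded contract_pair]] h
    obtain S where S: "\<eta> = cut (contract_graph \<Gamma> (cut \<Gamma> P, j)) S"
      "admissible_cut T (contract_graph \<Gamma> (cut \<Gamma> P, j))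
        (\<lambda>D\<in>pi0 (contract_graph \<Gamma> (cut \<Gamma> P, j)). i (\<Union>D)) S l"
      unfolding GG P(1) contract_pair by blast
    obtain k where k: "admissible_cut T \<Gamma> i S k" "admissible_cut T (cut \<Gamma> S) k (P - S) j"
      "cut (cut \<Gamma> S) (P - S) = cut \<Gamma> P"
      "contract (cut \<Gamma> S, k) (cut \<Gamma> P, j) = (cut (contract_graph \<Gamma> (cut \<Gamma> P, j)) S, l)"
      using lift_contracted_subgraph[OF G' P(2) S(2)] by blast
    have "(cut \<Gamma> S, k) \<in> coproduct_subgraphs T G" unfolding sub using k(1) by blast
    moreover have "specified_graph T (cut \<Gamma> S, k)" using k(1) by (simp add: admissible_cut_def)
    from coproduct_subgraphs_eq[OF this] have "(\<delta>, j) \<in> coproduct_subgraphs T (cut \<Gamma> S, k)"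
      using k(2) unfolding P(1) k(3)[symmetric] by blast
    ultimately show "((\<delta>, j), (\<eta>, l)) \<in> ?F ` ?X"
      using k(4) unfolding P(1) S(1) by (intro image_eqI[of _ _ "((cut \<Gamma> S, k), (cut \<Gamma> P, j))"]) auto
  qed
  ultimately show "bij_betw ?F ?X ?Y" unfolding bij_betw_def by blast
qed

section \<open>The subgraph without internal edges\<close>

lemma spec_iso_internal_empty:
  fixes G :: "('v, 'e, 'h) spec_graph" and G' :: "('w, 'f, 'h) spec_graph"
  assumes "spec_iso G G'" "internal (fst G) = {}"
  shows "internal (fst G') = {}"
proof -
  obtain f g where m: "iso_maps f g G G'" using assms by (auto simp: spec_iso_def)
  then have "half_edges (fst G') = g ` half_edges (fst G)" by (simp add: iso_maps_alt bij_betw_def)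
  then show ?thesis using m assms(2) by (auto simp: iso_maps_alt internal_def)
qed

text \<open>
  When all edges are cut, every component is a single vertex, whose index is forced to be its
  own; contracting such components only renames \<open>v\<close> to \<open>{v}\<close>.
\<close>

lemma edgeless_subgraph:
  assumes G: "specified_graph T G"
  shows "\<exists>g\<in>coproduct_subgraphs T G. spec_iso (contract G g) G \<and>
    (\<forall>h\<in>coproduct_subgraphs T G. internal (fst h) = {} \<longleftrightarrow> h = g)"
proof -
  obtain \<Gamma> i where GG: "G = (\<Gamma>, i)" by (cases G)
  note G' = G[unfolded GG]
  have wf: "feynman_graph \<Gamma>" using specified_feynman[OF G'] by simp
  let ?I = "internal \<Gamma>"
  define \<gamma> where "\<gamma> = cut \<Gamma> ?I"
  have I: "edge_closed \<Gamma> ?I" using feynmanD[OF wf] by (auto simp: edge_closed_def internal_def)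
  have wf\<gamma>: "feynman_graph \<gamma>" unfolding \<gamma>_def by (rule feynman_cut[OF wf I])
  have inv: "invol \<gamma> e = e" if "e \<in> half_edges \<Gamma>" for e
    using that by (simp add: \<gamma>_def internal_def)
  have bare: "bare \<gamma> v" for v using inv by (simp add: bare_def) (simp add: \<gamma>_def)
  have comp: "component_of \<gamma> v = {v}" for v by (rule component_of_bare[OF bare])
  have p: "pi0 \<gamma> = (\<lambda>v. {v}) ` vertices \<Gamma>" by (simp add: pi0_def comp) (simp add: \<gamma>_def)
  define j where "j = (\<lambda>C\<in>pi0 \<gamma>. vindex \<Gamma> (the_elem C))"
  have jv: "j {v} = vindex \<Gamma> v" if "v \<in> vertices \<Gamma>" for v using that by (simp add: j_def p)
  have "spec_at T \<gamma> j v" if v: "v \<in> vertices \<Gamma>" for v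
  proof -
    have "spec_at T \<Gamma> i v" using G' v by (simp add: specified_graph_iff)
    moreover have "vertex_type \<gamma> v = vertex_type \<Gamma> v" by (simp add: vertex_type_def \<gamma>_def)
    moreover have "(residue_star \<gamma> {v}, j {v}) = vertex_type \<gamma> v"
      using residue_star_bare[OF bare, of v] jv[OF v] by (simp add: \<gamma>_def)
    ultimately show ?thesis
      using jv[OF v] inv by (auto simp: spec_at_def comp) (auto simp: \<gamma>_def internal_def split: if_splits)
  qed
  then have sp: "specified_graph T (\<gamma>, j)"
    using wf\<gamma> by (simp add: specified_graph_iff wf_spec_def j_def) (simp add: \<gamma>_def)
  have "j C = i C" if C: "C \<in> pi0 \<gamma>" "\<forall>e\<in>?I. bdry \<Gamma> e \<notin> C" for C
  proof -
    obtain v where v: "v \<in> vertices \<Gamma>" "C = {v}" using C(1) p by auto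
    then have "bare \<Gamma> v" using C(2) by (auto simp: bare_def internal_def)
    moreover have "spec_at T \<Gamma> i v" using G' v by (simp add: specified_graph_iff)
    ultimately show ?thesis using v jv component_of_bare[of \<Gamma> v] by (simp add: spec_at_def)
  qed
  then have "admissible_cut T \<Gamma> i ?I j" using I sp by (simp add: admissible_cut_def \<gamma>_def)
  then have mem: "(\<gamma>, j) \<in> coproduct_subgraphs T G"
    unfolding GG coproduct_subgraphs_eq[OF G'] \<gamma>_def by blast
  have "h = (\<gamma>, j)" if h: "h \<in> coproduct_subgraphs T G" "internal (fst h) = {}" for h
  proof -
    obtain S l where s: "h = (cut \<Gamma> S, l)" "admissible_cut T \<Gamma> i S l"
      using h unfolding GG coproduct_subgraphs_eq[OF G'] by blast
    then have "S = ?I" using h(2) by (auto simp: internal_cut admissible_cut_def)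
    then have h\<gamma>: "h = (\<gamma>, l)" and l: "specified_graph T (\<gamma>, l)"
      using s by (auto simp: \<gamma>_def admissible_cut_def)
    have "l C = j C" if C: "C \<in> pi0 \<gamma>" for C
    proof -
      obtain v where v: "v \<in> vertices \<Gamma>" "C = {v}" using C p by auto
      have "v \<in> vertices \<gamma>" using v by (simp add: \<gamma>_def)
      then have "spec_at T \<gamma> l v" using l by (simp add: specified_graph_iff)
      then show ?thesis using v jv bare by (simp add: spec_at_def comp) (simp add: \<gamma>_def)
    qed
    moreover have "l \<in> extensional (pi0 \<gamma>)" using l by (simp add: specified_graph_iff wf_spec_def)
    ultimately have "l = j" by (auto intro: extensionalityI simp: j_def)
    then show ?thesis using h\<gamma> by simp
  qed
  moreover have "internal \<gamma> = {}" by (simp add: \<gamma>_def internal_cut)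
  moreover have "spec_iso (contract (\<Gamma>, i) (\<gamma>, j)) (\<Gamma>, i)"
  proof -
    let ?Q = "contract_graph \<Gamma> (\<gamma>, j)"
    have ext: "external \<gamma> = half_edges \<Gamma>"
      unfolding \<gamma>_def using external_cut[of ?I \<Gamma>] by (auto simp: external_def internal_def)
    have wfQ: "feynman_graph ?Q" unfolding \<gamma>_def by (rule feynman_contract_graph[OF wf I])
    have wf\<Gamma>: "wf_spec (\<Gamma>, i)" by (rule specified_graph_wf[OF G'])
    have bv: "bij_betw the_elem (pi0 \<gamma>) (vertices \<Gamma>)"
      by (rule bij_betw_byWitness[where f' = "\<lambda>v. {v}"]) (auto simp: p)
    have "pi0 ?Q = (\<lambda>C. (\<lambda>v. {v}) ` C) ` pi0 \<Gamma>"
      using pi0_contract_graph[OF wf I, of j] unfolding \<gamma>_def[symmetric] by (simp add: comp)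
    then have "\<forall>D\<in>pi0 ?Q. i (the_elem ` D) = i (\<Union>D)"
      by (auto simp: image_image)
    then have "iso_maps the_elem (\<lambda>e. e) (contract (\<Gamma>, i) (\<gamma>, j)) (\<Gamma>, i)"
      unfolding iso_maps_alt
      using bv by (auto simp: contract_pair ext comp p jv bij_betw_def)
    moreover have "wf_spec (contract (\<Gamma>, i) (\<gamma>, j))" using wfQ by (simp add: wf_spec_def contract_pair)
    ultimately show ?thesis using wf\<Gamma> unfolding spec_iso_def by blast
  qed
  ultimately have "spec_iso (contract G (\<gamma>, j)) G \<and>
      (\<forall>h\<in>coproduct_subgraphs T G. internal (fst h) = {} \<longleftrightarrow> h = (\<gamma>, j))"
    unfolding GG by (metis fst_conv)
  then show ?thesis using mem by (rule bexI)
qed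

section \<open>Subgraphs of a disjoint union\<close>

lemma external_union_graph: "external (union_graph \<Gamma> \<Gamma>') = external \<Gamma> <+> external \<Gamma>'"
  by (auto simp: external_def)

lemma cut_union_graph: "cut (union_graph \<Gamma> \<Gamma>') (S <+> S') = union_graph (cut \<Gamma> S) (cut \<Gamma>' S')"
proof -
  have "invol (cut (union_graph \<Gamma> \<Gamma>') (S <+> S')) e = invol (union_graph (cut \<Gamma> S) (cut \<Gamma>' S')) e" for e
    by (cases e) auto
  then show ?thesis by (intro fgraph.equality) auto
qed

lemma disjoint_union_eq_iff:
  assumes wf: "wf_spec g" "wf_spec g'" "wf_spec h" "wf_spec h'"
    and p: "pi0 (fst g) = pi0 (fst g')" "pi0 (fst h) = pi0 (fst h')"
    and eq: "snd (disjoint_union g h) = snd (disjoint_union g' h')"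
  shows "snd g = snd g' \<and> snd h = snd h'"
proof -
  have "snd g C = snd g' C" if "C \<in> pi0 (fst g)" for C
    using fun_cong[OF eq, of "Inl ` C"] disjoint_union_spec_Inl[of C g h] disjoint_union_spec_Inl[of C g' h']
      that p by simp
  moreover have "snd h C = snd h' C" if "C \<in> pi0 (fst h)" for C
    using fun_cong[OF eq, of "Inr ` C"] disjoint_union_spec_Inr[of C h g] disjoint_union_spec_Inr[of C h' g']
      that p by simp
  ultimately show ?thesis
    using wf p by (auto simp: wf_spec_def intro!: extensionalityI)
qed

text \<open>
  A set of half-edges of a disjoint union splits into a part on either side, and so does every
  condition on the cut graph, because it is local. The pairs correspond to literal equality of
  graphs, not only to isomorphism, since \<open>cut_union_graph\<close> is an equation.
\<close>

lemma coproduct_subgraphs_disjoint_union: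
  assumes G: "specified_graph T G" and H: "specified_graph T H"
  shows "bij_betw (\<lambda>(g, h). disjoint_union g h) (coproduct_subgraphs T G \<times> coproduct_subgraphs T H)
    (coproduct_subgraphs T (disjoint_union G H))" (is "bij_betw ?F ?X ?Y")
proof -
  obtain \<Gamma> i \<Gamma>' i' where GG: "G = (\<Gamma>, i)" "H = (\<Gamma>', i')" by (cases G, cases H) auto
  let ?U = "union_graph \<Gamma> \<Gamma>'"
  define u where "u = snd (disjoint_union G H)"
  note G' = G[unfolded GG] and H' = H[unfolded GG]
  have wf: "wf_spec G" "wf_spec H" using G H by (auto intro: specified_graph_wf)
  have D: "specified_graph T (disjoint_union G H)" using specified_disjoint_union[OF wf] G H by simp
  have DU: "disjoint_union G H = (?U, u)" by (simp add: prod_eq_iff GG u_def)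
  note subG = coproduct_subgraphs_eq[OF G', folded GG(1)]
  note subH = coproduct_subgraphs_eq[OF H', folded GG(2)]
  note subD = coproduct_subgraphs_eq[OF D[unfolded DU], folded DU]
  have ul: "u (Inl ` C) = i C" if "C \<in> pi0 \<Gamma>" for C
    using disjoint_union_spec_Inl[of C G H] that by (simp add: GG u_def)
  have ur: "u (Inr ` C) = i' C" if "C \<in> pi0 \<Gamma>'" for C
    using disjoint_union_spec_Inr[of C H G] that by (simp add: GG u_def)
  have adm: "admissible_cut T ?U u (S <+> S') (snd (disjoint_union (cut \<Gamma> S, j) (cut \<Gamma>' S', j'))) \<longleftrightarrow>
      admissible_cut T \<Gamma> i S j \<and> admissible_cut T \<Gamma>' i' S' j'"
    if wfs: "wf_spec (cut \<Gamma> S, j)" "wf_spec (cut \<Gamma>' S', j')"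
      and cl: "edge_closed \<Gamma> S \<and> S \<subseteq> internal \<Gamma>" "edge_closed \<Gamma>' S' \<and> S' \<subseteq> internal \<Gamma>'" for S j S' j'
  proof -
    let ?d = "disjoint_union (cut \<Gamma> S, j) (cut \<Gamma>' S', j')"
    have d: "(cut ?U (S <+> S'), snd ?d) = ?d" by (simp add: prod_eq_iff cut_union_graph)
    have wf\<Gamma>: "feynman_graph \<Gamma>" "feynman_graph \<Gamma>'" using wf GG by (auto simp: wf_spec_def)
    have cl': "edge_closed ?U (S <+> S') \<and> S <+> S' \<subseteq> internal ?U"
      using cl by (fastforce simp: edge_closed_def internal_def)
    have l: "snd ?d (Inl ` C) = j C" if "C \<in> pi0 (cut \<Gamma> S)" for C
      using disjoint_union_spec_Inl[of C "(cut \<Gamma> S, j)"] that by simp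
    have r: "snd ?d (Inr ` C) = j' C" if "C \<in> pi0 (cut \<Gamma>' S')" for C
      using disjoint_union_spec_Inr[of C "(cut \<Gamma>' S', j')"] that by simp
    have "(\<forall>C\<in>pi0 (cut ?U (S <+> S')). (\<forall>e\<in>S <+> S'. bdry ?U e \<notin> C) \<longrightarrow> snd ?d C = u C) \<longleftrightarrow>
      (\<forall>C\<in>pi0 (cut \<Gamma> S). (\<forall>e\<in>S. bdry \<Gamma> e \<notin> C) \<longrightarrow> j C = i C) \<and>
      (\<forall>C\<in>pi0 (cut \<Gamma>' S'). (\<forall>e\<in>S'. bdry \<Gamma>' e \<notin> C) \<longrightarrow> j' C = i' C)"
    proof -
      have "(\<forall>e\<in>S <+> S'. bdry ?U e \<notin> Inl ` C) \<longleftrightarrow> (\<forall>e\<in>S. bdry \<Gamma> e \<notin> C)"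
        "(\<forall>e\<in>S <+> S'. bdry ?U e \<notin> Inr ` C') \<longleftrightarrow> (\<forall>e\<in>S'. bdry \<Gamma>' e \<notin> C')" for C C'
        by (auto simp: Plus_def ball_Un)
      moreover have "u (Inl ` C) = i C" if "C \<in> pi0 (cut \<Gamma> S)" "\<forall>e\<in>S. bdry \<Gamma> e \<notin> C" for C
        using ul uncut_component_pi0[OF wf\<Gamma>(1)] cl that by blast
      moreover have "u (Inr ` C) = i' C" if "C \<in> pi0 (cut \<Gamma>' S')" "\<forall>e\<in>S'. bdry \<Gamma>' e \<notin> C" for C
        using ur uncut_component_pi0[OF wf\<Gamma>(2)] cl that by blast
      ultimately show ?thesis
        unfolding cut_union_graph pi0_union_graph ball_Un ball_simps(9) using l r by simp
    qed
    then show ?thesis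
      unfolding admissible_cut_def d specified_disjoint_union[OF wfs] using cl cl' by blast
  qed
  have wfA: "wf_spec (cut \<Gamma> S, j)" if "admissible_cut T \<Gamma> i S j" for \<Gamma> :: "('x, 'y, 'a) fgraph" and i S j
    using that specified_graph_wf by (auto simp: admissible_cut_def)
  have inj: "inj_on ?F ?X"
  proof (rule inj_onI)
    fix x y assume x: "x \<in> ?X" and y: "y \<in> ?X" and eq: "?F x = ?F y"
    obtain S j S' j' where 1: "x = ((cut \<Gamma> S, j), (cut \<Gamma>' S', j'))" "admissible_cut T \<Gamma> i S j"
      "admissible_cut T \<Gamma>' i' S' j'" using x unfolding subG subH by blast
    obtain R k R' k' where 2: "y = ((cut \<Gamma> R, k), (cut \<Gamma>' R', k'))" "admissible_cut T \<Gamma> i R k"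
      "admissible_cut T \<Gamma>' i' R' k'" using y unfolding subG subH by blast
    have "fst (?F x) = fst (?F y)" "snd (?F x) = snd (?F y)" using eq by simp_all
    then have f: "union_graph (cut \<Gamma> S) (cut \<Gamma>' S') = union_graph (cut \<Gamma> R) (cut \<Gamma>' R')"
      and s: "snd (disjoint_union (cut \<Gamma> S, j) (cut \<Gamma>' S', j')) =
        snd (disjoint_union (cut \<Gamma> R, k) (cut \<Gamma>' R', k'))"
      by (simp_all add: 1(1) 2(1))
    have "invol (union_graph (cut \<Gamma> S) (cut \<Gamma>' S')) z = invol (union_graph (cut \<Gamma> R) (cut \<Gamma>' R')) z" for z
      using f by simp
    from this[of "Inl _"] this[of "Inr _"] have c: "cut \<Gamma> S = cut \<Gamma> R" "cut \<Gamma>' S' = cut \<Gamma>' R'"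
      by (auto intro!: fgraph.equality)
    have "j = k \<and> j' = k'"
      using disjoint_union_eq_iff[OF wfA[OF 1(2)] wfA[OF 2(2)] wfA[OF 1(3)] wfA[OF 2(3)] _ _ s] c by simp
    then show "x = y" using c by (simp add: 1(1) 2(1))
  qed
  have img: "?F ` ?X \<subseteq> ?Y"
  proof (rule image_subsetI)
    fix x assume "x \<in> ?X"
    then obtain \<gamma> j \<gamma>' j' where x: "x = ((\<gamma>, j), (\<gamma>', j'))"
      "(\<gamma>, j) \<in> coproduct_subgraphs T G" "(\<gamma>', j') \<in> coproduct_subgraphs T H" by auto
    then obtain S S' where s: "\<gamma> = cut \<Gamma> S" "admissible_cut T \<Gamma> i S j" "\<gamma>' = cut \<Gamma>' S'"
      "admissible_cut T \<Gamma>' i' S' j'" unfolding subG subH by blast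
    let ?d = "disjoint_union (\<gamma>, j) (\<gamma>', j')"
    have "?d = (cut ?U (S <+> S'), snd ?d)" by (simp add: prod_eq_iff cut_union_graph s)
    moreover have "edge_closed \<Gamma> S \<and> S \<subseteq> internal \<Gamma>" "edge_closed \<Gamma>' S' \<and> S' \<subseteq> internal \<Gamma>'"
      using s by (auto simp: admissible_cut_def)
    then have "admissible_cut T ?U u (S <+> S') (snd ?d)"
      unfolding s(1,3) using adm[OF wfA[OF s(2)] wfA[OF s(4)]] s(2,4) by blast
    ultimately have "?d \<in> ?Y" unfolding subD by blast
    then show "?F x \<in> ?Y" unfolding x(1) by simp
  qed
  have "?Y \<subseteq> ?F ` ?X"
  proof
    fix y assume "y \<in> ?Y"
    then obtain W l where y: "y = (cut ?U W, l)" "admissible_cut T ?U u W l" unfolding subD by blast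
    define S where "S = Inl -` W"
    define S' where "S' = Inr -` W"
    have W: "W = S <+> S'" unfolding S_def S'_def Plus_def
    proof (intro equalityI subsetI)
      fix x assume "x \<in> W" then show "x \<in> Inl ` (Inl -` W) \<union> Inr ` (Inr -` W)" by (cases x) auto
    qed auto
    define j where "j = (\<lambda>C\<in>pi0 (cut \<Gamma> S). l (Inl ` C))"
    define j' where "j' = (\<lambda>C\<in>pi0 (cut \<Gamma>' S'). l (Inr ` C))"
    have wf\<Gamma>: "feynman_graph \<Gamma>" "feynman_graph \<Gamma>'" using wf GG by (auto simp: wf_spec_def)
    have "edge_closed ?U W" "W \<subseteq> internal ?U" using y(2) by (auto simp: admissible_cut_def)
    then have cl: "edge_closed \<Gamma> S \<and> S \<subseteq> internal \<Gamma>" "edge_closed \<Gamma>' S' \<and> S' \<subseteq> internal \<Gamma>'"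
      unfolding W by (fastforce simp: edge_closed_def internal_def)+
    have wfs: "wf_spec (cut \<Gamma> S, j)" "wf_spec (cut \<Gamma>' S', j')"
      using feynman_cut[OF wf\<Gamma>(1)] feynman_cut[OF wf\<Gamma>(2)] cl by (auto simp: wf_spec_def j_def j'_def)
    let ?d = "disjoint_union (cut \<Gamma> S, j) (cut \<Gamma>' S', j')"
    have "snd ?d = l"
    proof (rule extensionalityI)
      show "snd ?d \<in> extensional (pi0 (fst ?d))" using wf_disjoint_union[OF wfs] by (simp add: wf_spec_def)
      show "l \<in> extensional (pi0 (fst ?d))"
        using y(2) by (simp add: admissible_cut_def specified_graph_iff wf_spec_def W cut_union_graph)
      fix C assume "C \<in> pi0 (fst ?d)"
      then show "snd ?d C = l C"
        using disjoint_union_spec_Inl[of _ "(cut \<Gamma> S, j)" "(cut \<Gamma>' S', j')"]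
          disjoint_union_spec_Inr[of _ "(cut \<Gamma>' S', j')" "(cut \<Gamma> S, j)"]
        by (auto simp: pi0_union_graph j_def j'_def)
    qed
    then have "admissible_cut T \<Gamma> i S j" "admissible_cut T \<Gamma>' i' S' j'" "y = ?d"
      using adm[OF wfs cl] y by (auto simp: W prod_eq_iff cut_union_graph)
    then have "((cut \<Gamma> S, j), (cut \<Gamma>' S', j')) \<in> ?X" "y = ?F ((cut \<Gamma> S, j), (cut \<Gamma>' S', j'))"
      unfolding subG subH by auto
    then show "y \<in> ?F ` ?X" by blast
  qed
  then show ?thesis using inj img unfolding bij_betw_def by blast
qed

text \<open>
  The two sides differ only in the names of the vertices: a component of \<open>g\<close> is a vertex on
  the left, and its image under \<open>Inl\<close> is the corresponding vertex on the right.
\<close>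

lemma contract_disjoint_union:
  assumes G: "specified_graph T G" and H: "specified_graph T H"
    and g: "g \<in> coproduct_subgraphs T G" and h: "h \<in> coproduct_subgraphs T H"
  shows "spec_iso (disjoint_union (contract G g) (contract H h))
    (contract (disjoint_union G H) (disjoint_union g h))"
proof -
  obtain \<Gamma> i \<Gamma>' i' where GG: "G = (\<Gamma>, i)" "H = (\<Gamma>', i')" by (cases G, cases H) auto
  obtain S j where S: "g = (cut \<Gamma> S, j)" "admissible_cut T \<Gamma> i S j"
    using g G unfolding GG by (auto simp: coproduct_subgraphs_eq)
  obtain S' j' where S': "h = (cut \<Gamma>' S', j')" "admissible_cut T \<Gamma>' i' S' j'"
    using h H unfolding GG by (auto simp: coproduct_subgraphs_eq)
  let ?\<gamma> = "cut \<Gamma> S" and ?\<gamma>' = "cut \<Gamma>' S'"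
  let ?U = "disjoint_union G H" and ?u = "disjoint_union g h"
  let ?A = "disjoint_union (contract G g) (contract H h)" and ?B = "contract ?U ?u"
  have wf: "wf_spec G" "wf_spec H" using G H by (auto intro: specified_graph_wf)
  have wf\<Gamma>: "feynman_graph \<Gamma>" "feynman_graph \<Gamma>'" using wf GG by (auto simp: wf_spec_def)
  have cl: "edge_closed \<Gamma> S" "edge_closed \<Gamma>' S'" using S S' by (auto simp: admissible_cut_def)
  have wfA: "wf_spec ?A"
    using coproduct_subgraphs_specified(2)[OF G g] coproduct_subgraphs_specified(2)[OF H h]
    by (intro wf_disjoint_union specified_graph_wf)
  have "?u \<in> coproduct_subgraphs T ?U"
    using bij_betw_imp_surj_on[OF coproduct_subgraphs_disjoint_union[OF G H]] g h by blast
  moreover have "specified_graph T ?U" using specified_disjoint_union[OF wf] G H by simp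
  ultimately have wfB: "wf_spec ?B"
    using coproduct_subgraphs_specified(2) specified_graph_wf by blast
  let ?f = "case_sum ((`) Inl) ((`) Inr)"
  have fA: "fst (contract G g) = contract_graph \<Gamma> (?\<gamma>, j)"
    "fst (contract H h) = contract_graph \<Gamma>' (?\<gamma>', j')"
    by (simp_all add: GG S(1) S'(1) contract_pair)
  have fB: "fst ?B = contract_graph (union_graph \<Gamma> \<Gamma>') (union_graph ?\<gamma> ?\<gamma>', snd ?u)"
    by (simp add: contract_def GG S(1) S'(1) disjoint_union_def)
  have V: "vertices (fst ?A) = pi0 ?\<gamma> <+> pi0 ?\<gamma>'" "vertices (fst ?B) = pi0 (union_graph ?\<gamma> ?\<gamma>')"
    by (simp_all add: fA fB)
  have bv: "bij_betw ?f (pi0 ?\<gamma> <+> pi0 ?\<gamma>') (pi0 (union_graph ?\<gamma> ?\<gamma>'))"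
    unfolding bij_betw_def
  proof
    (* the two images can only meet in the empty set, which is not a component *)
    have ne: "Inl ` A \<noteq> Inr ` B" "Inr ` B \<noteq> Inl ` A" if "A \<in> pi0 ?\<gamma>" for A and B :: "'d set"
      using pi0_nonempty[OF that] by auto
    show "inj_on ?f (pi0 ?\<gamma> <+> pi0 ?\<gamma>')"
    proof (rule inj_onI)
      fix x y assume "x \<in> pi0 ?\<gamma> <+> pi0 ?\<gamma>'" "y \<in> pi0 ?\<gamma> <+> pi0 ?\<gamma>'" "?f x = ?f y"
      then show "x = y" by (cases x; cases y) (auto simp: ne inj_image_eq_iff Plus_def)
    qed
    show "?f ` (pi0 ?\<gamma> <+> pi0 ?\<gamma>') = pi0 (union_graph ?\<gamma> ?\<gamma>')"
      by (simp add: Plus_def image_Un image_image pi0_union_graph)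
  qed
  have bd: "bdry (fst ?B) e = ?f (bdry (fst ?A) e)" for e
    by (cases e) (simp_all add: fA fB component_of_union_Inl component_of_union_Inr)
  have inv: "invol (fst ?B) e = invol (fst ?A) e" "etype (fst ?B) e = etype (fst ?A) e" for e
    by (cases e; simp add: fA fB)+
  have gh: "fst g = ?\<gamma>" "snd g = j" "fst h = ?\<gamma>'" "snd h = j'" by (simp_all add: S(1) S'(1))
  have vi: "vindex (fst ?B) (?f v) = vindex (fst ?A) v" if "v \<in> vertices (fst ?A)" for v
    using that disjoint_union_spec_Inl[of _ g h] disjoint_union_spec_Inr[of _ h g]
    unfolding V gh by (auto simp: fA fB)
  have he: "half_edges (fst ?B) = half_edges (fst ?A)"
    by (simp add: fA fB external_union_graph)
  have m: "bij_betw ?f (vertices (fst ?A)) (vertices (fst ?B)) \<and>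
     bij_betw (\<lambda>e. e) (half_edges (fst ?A)) (half_edges (fst ?B)) \<and>
     (\<forall>e\<in>half_edges (fst ?A). bdry (fst ?B) e = ?f (bdry (fst ?A) e) \<and>
        invol (fst ?B) e = invol (fst ?A) e \<and> etype (fst ?B) e = etype (fst ?A) e) \<and>
     (\<forall>v\<in>vertices (fst ?A). vindex (fst ?B) (?f v) = vindex (fst ?A) v)"
    using bv bd inv vi he V by (simp add: bij_betw_def)
  then have em: "graph_embedding ?f (\<lambda>e. e) (fst ?A) (fst ?B)"
    by (auto simp: graph_embedding_def bij_betw_def)
  have "snd ?B (?f ` D) = snd ?A D" if D: "D \<in> pi0 (fst ?A)" for D
  proof -
    have "?f ` D \<in> pi0 (fst ?B)" using embedding_pi0[OF _ em D] wfA by (simp add: wf_spec_def)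
    then have B: "snd ?B (?f ` D) = snd ?U (\<Union> (?f ` D))" by (simp add: contract_def split: prod.splits)
    consider (l) E where "E \<in> pi0 (contract_graph \<Gamma> (?\<gamma>, j))" "D = Inl ` E"
      | (r) E where "E \<in> pi0 (contract_graph \<Gamma>' (?\<gamma>', j'))" "D = Inr ` E"
      using D unfolding fst_disjoint_union fA pi0_union_graph by auto
    then show ?thesis
    proof cases
      case l
      obtain C where C: "C \<in> pi0 \<Gamma>" "E = component_of ?\<gamma> ` C"
        using l(1) unfolding pi0_contract_graph[OF wf\<Gamma>(1) cl(1)] by auto
      have UE: "\<Union>E = C" using Union_image_component_of[OF wf\<Gamma>(1) C(1)] C(2) by simp
      have "\<Union> (?f ` D) = Inl ` \<Union>E" using l(2) by auto
      then have "snd ?B (?f ` D) = i C"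
        using B disjoint_union_spec_Inl[of C G H] C(1) by (simp add: UE GG)
      moreover have "snd ?A D = i C"
        using disjoint_union_spec_Inl[of E "contract G g" "contract H h"] l UE
        by (simp add: GG S(1) contract_pair)
      ultimately show ?thesis by simp
    next
      case r
      obtain C where C: "C \<in> pi0 \<Gamma>'" "E = component_of ?\<gamma>' ` C"
        using r(1) unfolding pi0_contract_graph[OF wf\<Gamma>(2) cl(2)] by auto
      have UE: "\<Union>E = C" using Union_image_component_of[OF wf\<Gamma>(2) C(1)] C(2) by simp
      have "\<Union> (?f ` D) = Inr ` \<Union>E" using r(2) by auto
      then have "snd ?B (?f ` D) = i' C"
        using B disjoint_union_spec_Inr[of C H G] C(1) by (simp add: UE GG)
      moreover have "snd ?A D = i' C"
        using disjoint_union_spec_Inr[of E "contract H h" "contract G g"] r UE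
        by (simp add: GG S'(1) contract_pair)
      ultimately show ?thesis by simp
    qed
  qed
  then have "iso_maps ?f (\<lambda>e. e) ?A ?B" unfolding iso_maps_alt using m by blast
  then show ?thesis using wfA wfB by (auto simp: spec_iso_def)
qed

section \<open>Coproduct and coaction on basis elements\<close>

lemma iso_class_eqD:
  assumes "wf_spec G" "wf_spec G'" "iso_class G = iso_class G'"
  shows "spec_iso G G'"
  using spec_iso_trans[OF spec_iso_sym[OF rep_iso_class[OF assms(1)]]] rep_iso_class[OF assms(2)]
  by (simp add: assms(3))

lemma coproduct_graph_elem:
  assumes T: "physical_theory T" and G: "specified_graph T G"
  shows "coproduct T (graph_elem G) =
    (\<Sum>g\<in>coproduct_subgraphs T G. graph_elem g \<otimes> graph_elem (contract G g))"
proof -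
  have i: "spec_iso (rep_sgraph (iso_class G)) G"
    by (rule rep_iso_class[OF specified_graph_wf[OF G]])
  have "(\<Sum>g\<in>coproduct_subgraphs T (rep_sgraph (iso_class G)).
        graph_elem g \<otimes> graph_elem (contract (rep_sgraph (iso_class G)) g)) =
      (\<Sum>g\<in>coproduct_subgraphs T G. graph_elem g \<otimes> graph_elem (contract G g))"
    by (rule coproduct_subgraphs_sum_iso[OF T i])
      (use spec_iso_specified[OF i] G in \<open>simp_all add: graph_elem_def iso_class_eqI\<close>)
  then show ?thesis by (simp add: coproduct_def graph_elem_def[of G] Let_def)
qed

text \<open>
  A graph with the same components as \<open>G\<close> is isomorphic to \<open>G\<close>, so the sum does not
  depend on the representative chosen in the definition.
\<close>

lemma coaction_sym_elem:
  assumes T: "physical_theory T" and G: "specified_graph T G"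
  shows "coaction T (sym_elem G) =
    (\<Sum>g\<in>coproduct_subgraphs T G. graph_elem g \<otimes> sym_elem (contract G g))"
proof -
  let ?P = "\<lambda>H :: (nat, nat, 'a) spec_graph. specified_graph T H \<and> component_classes H = component_classes G"
  define H where "H = (SOME H. ?P H)"
  have wf: "wf_spec G" by (rule specified_graph_wf[OF G])
  have "?P (rep_sgraph (iso_class G))"
    using spec_iso_specified[OF rep_iso_class[OF wf]] component_classes_iso[OF rep_iso_class[OF wf]] G
    by simp
  then have H: "?P H" unfolding H_def by (rule someI)
  then have "iso_class H = iso_class G"
    using iso_class_sum_components[OF wf] iso_class_sum_components[of H] specified_graph_wf[of T H]
    by simp
  then have i: "spec_iso H G" using H wf by (intro iso_class_eqD) (auto intro: specified_graph_wf)
  have "(\<Sum>g\<in>coproduct_subgraphs T H. graph_elem g \<otimes> sym_elem (contract H g)) =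
      (\<Sum>g\<in>coproduct_subgraphs T G. graph_elem g \<otimes> sym_elem (contract G g))"
    by (rule coproduct_subgraphs_sum_iso[OF T i])
      (use H in \<open>simp_all add: graph_elem_def sym_elem_def iso_class_eqI component_classes_iso\<close>)
  then show ?thesis by (simp add: coaction_def sym_elem_def[of G] Let_def H_def)
qed

lemma sym_basis_graph:
  assumes "M \<in> sym_basis T"
  obtains G :: "(nat, nat, 'h) spec_graph" where "specified_graph T G" "component_classes G = M"
    "sum_mset M = iso_class G"
  using sum_mset_sym_basis[OF assms] that[of "rep_sgraph (sum_mset M)"]
  by (simp add: mem_spec_basis sgraph_components_def iso_class_rep)

lemma coaction_component_classes:
  assumes "physical_theory T" "specified_graph T G"
  shows "coaction T (Poly_Mapping.single (component_classes G) (1 :: 'k::field)) =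
    (\<Sum>g\<in>coproduct_subgraphs T G. Poly_Mapping.single (iso_class g, component_classes (contract G g)) 1)"
  using coaction_sym_elem[OF assms] by (simp add: sym_elem_def graph_elem_def)

lemma coproduct_iso_class:
  assumes "physical_theory T" "specified_graph T G"
  shows "coproduct T (Poly_Mapping.single (iso_class G) 1) =
    (\<Sum>g\<in>coproduct_subgraphs T G. Poly_Mapping.single (iso_class g, iso_class (contract G g)) 1)"
  using coproduct_graph_elem[OF assms] by (simp add: graph_elem_def)

lemma counit_iso_class:
  assumes "wf_spec G"
  shows "counit (Poly_Mapping.single (iso_class G) 1) = (if internal (fst G) = {} then 1 else 0)"
proof -
  have "internal (fst (rep_sgraph (iso_class G))) = {} \<longleftrightarrow> internal (fst G) = {}"
    using spec_iso_internal_empty[OF rep_iso_class[OF assms]]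
      spec_iso_internal_empty[OF spec_iso_sym[OF rep_iso_class[OF assms]]] by blast
  then show ?thesis by (simp add: counit_def)
qed

section \<open>The coaction\<close>

lemma coaction_free_on:
  assumes T: "physical_theory T" and x: "x \<in> free_on (sym_basis T)"
  shows "coaction T x \<in> free_on (spec_basis T \<times> sym_basis T)"
  unfolding linear_expand[OF linear_maps(1), of T x]
proof (rule lin_ext_free_on[OF x])
  fix M assume "M \<in> sym_basis T"
  then obtain G :: "(nat, nat, 'a) spec_graph" where G: "specified_graph T G" "component_classes G = M"
    by (rule sym_basis_graph)
  have "iso_class g \<in> spec_basis T \<and> component_classes (contract G g) \<in> sym_basis T"
    if "g \<in> coproduct_subgraphs T G" for g
    using coproduct_subgraphs_specified[OF G(1) that] component_classes_mem_sym_basis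
      iso_class_mem_spec_basis[OF specified_graph_wf] by blast
  then show "coaction T (Poly_Mapping.single M 1) \<in> free_on (spec_basis T \<times> sym_basis T)"
    unfolding G(2)[symmetric] coaction_component_classes[OF T G(1)]
    by (intro free_on_sum free_on_single) auto
qed

text \<open>
  Both sides are the sum of
  \<open>\<delta> \<otimes> \<gamma>/\<delta> \<otimes> \<Gamma>/\<gamma>\<close> over the chains
  \<open>\<delta> \<subseteq> \<gamma> \<subseteq> \<Gamma>\<close>, indexed by the two sets related in
  \<open>coassociativity_bij\<close>.
\<close>

lemma coaction_coassociative:
  assumes T: "physical_theory T" and G: "specified_graph T G"
  shows "tensor_assoc (tensor_map (coproduct T) (\<lambda>z. z) (coaction T (Poly_Mapping.single (component_classes G) 1))) =
    tensor_map (\<lambda>z. z) (coaction T) (coaction T (Poly_Mapping.single (component_classes G) (1 :: 'k::field)))"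
proof -
  let ?A = "coproduct_subgraphs T" and ?s = "\<lambda>a. Poly_Mapping.single a (1 :: 'k)"
  note sp = coproduct_subgraphs_specified[OF G]
  have fin: "finite (?A G)" "g \<in> ?A G \<Longrightarrow> finite (?A g)" "g \<in> ?A G \<Longrightarrow> finite (?A (contract G g))" for g
    using finite_coproduct_subgraphs[OF T] G sp by blast+
  have "tensor_assoc (tensor_map (coproduct T) (\<lambda>z. z) (coaction T (?s (component_classes G)))) =
      (\<Sum>g\<in>?A G. \<Sum>d\<in>?A g. ?s (iso_class d, iso_class (contract g d), component_classes (contract G g)))"
    unfolding coaction_component_classes[OF T G] tensor_map_sum tensor_assoc_def lin_ext_sum
    by (rule sum.cong[OF refl])
      (simp add: coproduct_iso_class[OF T sp(1)] tensor_sum_left lin_ext_sum)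
  also have "\<dots> = (\<Sum>(g, d)\<in>Sigma (?A G) ?A.
      ?s (iso_class d, iso_class (contract g d), component_classes (contract G g)))"
    using fin by (intro sum.Sigma) auto
  also have "\<dots> = (\<Sum>(g, d)\<in>Sigma (?A G) ?A. (\<lambda>(d, h). ?s (iso_class d, iso_class h,
      component_classes (contract (contract G d) h))) (d, contract g d))"
    using component_classes_iso[OF coassociativity_bij(2)[OF G]] by (intro sum.cong) auto
  also have "\<dots> = (\<Sum>(d, h)\<in>Sigma (?A G) (\<lambda>d. ?A (contract G d)).
      ?s (iso_class d, iso_class h, component_classes (contract (contract G d) h)))"
    using sum.reindex_bij_betw[OF coassociativity_bij(1)[OF G], of "\<lambda>(d, h). ?s (iso_class d, iso_class h,
      component_classes (contract (contract G d) h))"]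
    by (simp add: case_prod_unfold)
  also have "\<dots> = (\<Sum>d\<in>?A G. \<Sum>h\<in>?A (contract G d).
      ?s (iso_class d, iso_class h, component_classes (contract (contract G d) h)))"
    using fin by (intro sum.Sigma[symmetric]) auto
  also have "\<dots> = tensor_map (\<lambda>z. z) (coaction T) (coaction T (?s (component_classes G)))"
    unfolding coaction_component_classes[OF T G] tensor_map_sum
    by (rule sum.cong[OF refl])
      (simp add: coaction_component_classes[OF T sp(2)] tensor_sum_right)
  finally show ?thesis .
qed

lemma coaction_counital:
  assumes T: "physical_theory T" and G: "specified_graph T G"
  shows "functional_tensor_id counit (coaction T (Poly_Mapping.single (component_classes G) 1)) =
    Poly_Mapping.single (component_classes G) (1 :: 'k::field)"
proof -
  let ?A = "coproduct_subgraphs T G"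
  obtain g0 where g0: "g0 \<in> ?A" "spec_iso (contract G g0) G"
    "\<And>h. h \<in> ?A \<Longrightarrow> internal (fst h) = {} \<longleftrightarrow> h = g0"
    using edgeless_subgraph[OF G] by blast
  have fin: "finite ?A" by (rule finite_coproduct_subgraphs[OF T G])
  have counit: "counit (Poly_Mapping.single (iso_class g) (1 :: 'k)) = (if g = g0 then 1 else 0)"
    if "g \<in> ?A" for g
    using counit_iso_class[OF specified_graph_wf[OF coproduct_subgraphs_specified(1)[OF G that]]] g0(3)[OF that]
    by simp
  have "functional_tensor_id counit (coaction T (Poly_Mapping.single (component_classes G) 1)) =
      (\<Sum>g\<in>?A. if g = g0 then Poly_Mapping.single (component_classes G) (1 :: 'k) else 0)"
    unfolding coaction_component_classes[OF T G] functional_tensor_id_def lin_ext_sum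
    using counit component_classes_iso[OF g0(2)] by (intro sum.cong refl) simp
  also have "\<dots> = Poly_Mapping.single (component_classes G) 1" using fin g0(1) by simp
  finally show ?thesis .
qed

text \<open>
  Represent the two monomials by graphs \<open>G\<close> and \<open>H\<close>. Their product is the disjoint
  union, whose covering subgraphs are pairs, and contraction commutes with disjoint unions.
\<close>

lemma coaction_mult:
  assumes T: "physical_theory T" and M: "M \<in> sym_basis T" "N \<in> sym_basis T"
  shows "coaction T (Poly_Mapping.single (M + N) 1) =
    coaction T (Poly_Mapping.single M 1) * coaction T (Poly_Mapping.single N (1 :: 'k::field))"
proof -
  obtain G :: "(nat, nat, 'a) spec_graph" where G: "specified_graph T G" "component_classes G = M"
    using M(1) by (rule sym_basis_graph)
  obtain H :: "(nat, nat, 'a) spec_graph" where H: "specified_graph T H" "component_classes H = N"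
    using M(2) by (rule sym_basis_graph)
  have wf: "wf_spec G" "wf_spec H" using G H by (auto intro: specified_graph_wf)
  let ?U = "disjoint_union G H" and ?A = "coproduct_subgraphs T" and ?s = "\<lambda>a. Poly_Mapping.single a (1 :: 'k)"
  have U: "specified_graph T ?U" "component_classes ?U = M + N"
    using specified_disjoint_union[OF wf] component_classes_disjoint_union[OF wf] G H by auto
  have summand: "?s (iso_class (disjoint_union g h), component_classes (contract ?U (disjoint_union g h))) =
      ?s (iso_class g, component_classes (contract G g)) * ?s (iso_class h, component_classes (contract H h))"
    if gh: "g \<in> ?A G" "h \<in> ?A H" for g h
  proof -
    have wfs: "wf_spec g" "wf_spec h" "wf_spec (contract G g)" "wf_spec (contract H h)"
      using coproduct_subgraphs_specified[OF G(1) gh(1)] coproduct_subgraphs_specified[OF H(1) gh(2)]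
        by (auto intro: specified_graph_wf)
    show ?thesis
      using component_classes_iso[OF contract_disjoint_union[OF G(1) H(1) gh]]
      by (simp add: mult_single plus_prod_def plus_iso_class[OF wfs(1,2)]
          component_classes_disjoint_union[OF wfs(3,4)])
  qed
  have "coaction T (?s (M + N)) =
      (\<Sum>u\<in>?A ?U. ?s (iso_class u, component_classes (contract ?U u)))"
    using coaction_component_classes[OF T U(1)] U(2) by simp
  also have "\<dots> = (\<Sum>(g, h)\<in>?A G \<times> ?A H.
      ?s (iso_class (disjoint_union g h), component_classes (contract ?U (disjoint_union g h))))"
    using sum.reindex_bij_betw[OF coproduct_subgraphs_disjoint_union[OF G(1) H(1)],
        of "\<lambda>u. ?s (iso_class u, component_classes (contract ?U u))"]
    by (simp add: case_prod_unfold)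
  also have "\<dots> = (\<Sum>(g, h)\<in>?A G \<times> ?A H. ?s (iso_class g, component_classes (contract G g)) *
      ?s (iso_class h, component_classes (contract H h)))"
    using summand by (intro sum.cong) auto
  also have "\<dots> = coaction T (?s M) * coaction T (?s N)"
    using coaction_component_classes[OF T G(1), where 'k = 'k]
      coaction_component_classes[OF T H(1), where 'k = 'k] G(2) H(2)
    by (simp add: sum_product sum.cartesian_product)
  finally show ?thesis .
qed

text \<open>
  The only covering subgraph of the empty graph is the empty graph.
\<close>

lemma coaction_one:
  assumes T: "physical_theory T"
  shows "coaction T (Poly_Mapping.single {#} 1) = (1 :: _ \<Rightarrow>\<^sub>0 'k::field)"
proof -
  let ?E = "empty_spec :: (nat, nat, 'a) spec_graph"
  have E: "specified_graph T ?E" "component_classes ?E = {#}"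
    using wf_empty_spec by (simp_all add: empty_spec_def specified_graph_iff component_classes_def pi0_def)
  obtain g0 where g0: "g0 \<in> coproduct_subgraphs T ?E" "spec_iso (contract ?E g0) ?E"
    "\<And>h. h \<in> coproduct_subgraphs T ?E \<Longrightarrow> internal (fst h) = {} \<longleftrightarrow> h = g0"
    using edgeless_subgraph[OF E(1)] by blast
  obtain \<Gamma> i where e: "?E = (\<Gamma>, i)" "vertices \<Gamma> = {}" "half_edges \<Gamma> = {}"
    by (cases ?E) (auto simp: empty_spec_def)
  have sub: "vertices (fst h) = {}" "internal (fst h) = {}" if "h \<in> coproduct_subgraphs T ?E" for h
    using that coproduct_subgraphs_eq[of T \<Gamma> i] E(1) e by (auto simp: internal_def)
  have "coproduct_subgraphs T ?E = {g0}" using g0 sub by blast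
  moreover have "iso_class g0 = 0"
    using zero_sgraph_class[OF specified_graph_wf[OF coproduct_subgraphs_specified(1)[OF E(1) g0(1)]]]
      sub(1)[OF g0(1)] by simp
  moreover have "component_classes (contract ?E g0) = {#}"
    using component_classes_iso[OF g0(2)] E(2) by simp
  ultimately show ?thesis
    using coaction_component_classes[OF T E(1), where 'k = 'k] E(2)
    by (simp add: zero_prod_def[symmetric])
qed

section \<open>Compatibility with the unshuffling coproduct\<close>

lemma unshuffle_add:
  "unshuffle (Poly_Mapping.single (M + N) 1) =
    unshuffle (Poly_Mapping.single M 1) * unshuffle (Poly_Mapping.single N (1 :: 'k::field))"
  by (simp add: unshuffle_single)

lemma one_multiset: "(1 :: 'b multiset \<Rightarrow>\<^sub>0 'k::field) = Poly_Mapping.single {#} 1"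
  by (simp flip: single_one)

lemma unshuffle_generator:
  "unshuffle (Poly_Mapping.single {#x#} (1 :: 'k::field)) =
    Poly_Mapping.single ({#x#}, {#}) 1 + Poly_Mapping.single ({#}, {#x#}) 1"
  by (simp add: unshuffle_single one_multiset del: single_one)

lemma unshuffle_empty: "unshuffle (Poly_Mapping.single {#} (1 :: 'k::field)) = 1"
  unfolding unshuffle_single by simp

text \<open>
  Needed because the coaction is known to be multiplicative only on \<open>sym_basis T\<close>.
\<close>

lemma unshuffle_free_on:
  assumes "M \<in> sym_basis T"
  shows "unshuffle (Poly_Mapping.single M (1 :: 'k::field)) \<in> free_on (sym_basis T \<times> sym_basis T)"
  using assms
proof (induction M)
  case empty
  then show ?case by (simp add: unshuffle_empty flip: single_one add: zero_prod_def)
next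
  case (add x M)
  then have x: "{#x#} \<in> sym_basis T" "{#} \<in> sym_basis T" "M \<in> sym_basis T" by (auto simp: sym_basis_def)
  have "unshuffle (Poly_Mapping.single {#x#} (1 :: 'k)) * unshuffle (Poly_Mapping.single M 1)
      \<in> free_on (sym_basis T \<times> sym_basis T)"
    by (rule free_on_mult)
      (use add.IH x in \<open>auto simp: unshuffle_generator sym_basis_plus intro!: free_on_add\<close>)
  then show ?case using unshuffle_add[where 'k = 'k and M = "{#x#}" and N = M] by simp
qed

lemma m13_single: "m13 (Poly_Mapping.single ((a, b), (c, d)) 1) = Poly_Mapping.single (a + c, (b, d)) (1 :: 'k::field)"
  by (simp add: m13_def tau23_def mult_map_def mult_single)

lemma m13_sum: "m13 (\<Sum>a\<in>A. f a) = (\<Sum>a\<in>A. m13 (f a))"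
  by (simp add: m13_def tau23_def tensor_map_def lin_ext_sum)

lemma m13_add: "m13 (x + y) = m13 x + m13 y"
  by (simp add: m13_def tau23_def tensor_map_def lin_ext_add)

lemma m13_mult:
  fixes x y :: "('a::comm_monoid_add \<times> 'b::comm_monoid_add) \<times> ('a \<times> 'd::comm_monoid_add) \<Rightarrow>\<^sub>0 'k::field"
  shows "m13 (x * y) = m13 x * m13 y"
  by (rule linear_mult[OF linear_maps(6), of UNIV])
    (auto simp: m13_single mult_single plus_prod_def add_ac free_on_def)

text \<open>
  The components of \<open>\<Gamma>/\<gamma>\<close> are the images of those of \<open>\<Gamma>\<close>.
\<close>

lemma graph_connected_contract:
  assumes G: "specified_graph T G" and c: "graph_connected (fst G)" and g: "g \<in> coproduct_subgraphs T G"
  shows "graph_connected (fst (contract G g))"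
proof -
  obtain \<Gamma> i where GG: "G = (\<Gamma>, i)" by (cases G)
  obtain S j where S: "g = (cut \<Gamma> S, j)" "admissible_cut T \<Gamma> i S j"
    using g G unfolding GG by (auto simp: coproduct_subgraphs_eq)
  have "pi0 (contract_graph \<Gamma> (cut \<Gamma> S, j)) = (\<lambda>C. component_of (cut \<Gamma> S) ` C) ` pi0 \<Gamma>"
    using specified_feynman[OF G] S(2)
    by (intro pi0_contract_graph) (auto simp: admissible_cut_def GG)
  then show ?thesis
    using c by (auto simp: graph_connected_def card_1_singleton_iff GG S(1) contract_pair)
qed

text \<open>
  Both sides of the compatibility condition are multiplicative in the monomial, so it suffices to
  check it for a connected graph. There it holds because contractions of connected graphs are
  connected, hence primitive.
\<close>

lemma coaction_unshuffle:
  assumes T: "physical_theory T" and M: "M \<in> sym_basis T"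
  shows "tensor_map (\<lambda>z. z) unshuffle (coaction T (Poly_Mapping.single M (1 :: 'k::field))) =
    m13 (tensor_map (coaction T) (coaction T) (unshuffle (Poly_Mapping.single M 1)))"
  (is "?L M = ?R M")
proof -
  let ?c = "coaction T :: _ \<Rightarrow> (_ \<Rightarrow>\<^sub>0 'k)" and ?s = "\<lambda>a. Poly_Mapping.single a (1 :: 'k)"
  have L: "?L (M + N) = ?L M * ?L N" if "M \<in> sym_basis T" "N \<in> sym_basis T" for M N
    unfolding coaction_mult[OF T that]
    by (rule linear_mult[OF linear_maps(2), of UNIV])
      (auto simp: plus_prod_def unshuffle_add tensor_mult mult_single free_on_def)
  have "tensor_map ?c ?c (x * y) = tensor_map ?c ?c x * tensor_map ?c ?c y"
    if "x \<in> free_on (sym_basis T \<times> sym_basis T)" "y \<in> free_on (sym_basis T \<times> sym_basis T)" for x y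
    using linear_maps(2) _ that
    by (rule linear_mult) (auto simp: plus_prod_def coaction_mult[OF T] tensor_mult)
  then have R: "?R (M + N) = ?R M * ?R N" if "M \<in> sym_basis T" "N \<in> sym_basis T" for M N
    using unshuffle_free_on[OF that(1), where 'k = 'k] unshuffle_free_on[OF that(2), where 'k = 'k]
    by (simp add: unshuffle_add m13_mult)
  have zero: "?L {#} = ?R {#}"
    unfolding unshuffle_empty coaction_one[OF T]
    by (simp flip: single_one add: zero_prod_def unshuffle_empty coaction_one[OF T] m13_single)
  have gen: "?L {#x#} = ?R {#x#}" if x: "{#x#} \<in> sym_basis T" for x
  proof -
    have "x \<in> conn_basis T" using x by (simp add: sym_basis_def)
    then obtain G :: "(nat, nat, 'a) spec_graph" where
      G: "x = iso_class G" "specified_graph T G" "graph_connected (fst G)"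
      by (auto simp: conn_basis_def)
    let ?A = "coproduct_subgraphs T G"
    have cx: "?c (?s {#x#}) = (\<Sum>g\<in>?A. ?s (iso_class g, {#iso_class (contract G g)#}))"
    proof -
      have "component_classes (contract G g) = {#iso_class (contract G g)#}" if "g \<in> ?A" for g
        by (intro component_classes_connected graph_connected_contract[OF G(2,3) that]
            specified_graph_wf[OF coproduct_subgraphs_specified(2)[OF G(2) that]])
      moreover have "component_classes G = {#x#}"
        unfolding G(1) by (intro component_classes_connected specified_graph_wf[OF G(2)] G(3))
      ultimately show ?thesis using coaction_component_classes[OF T G(2), where 'k = 'k] by simp
    qed
    have "?c (?s {#}) = ?s (0, {#})"
      unfolding coaction_one[OF T] by (simp flip: single_one add: zero_prod_def)
    then have c0: "?c 1 = ?s (0, {#})" by simp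
    have "?L {#x#} = (\<Sum>g\<in>?A. ?s (iso_class g, ({#iso_class (contract G g)#}, {#})) +
        ?s (iso_class g, ({#}, {#iso_class (contract G g)#})))"
      by (simp add: cx tensor_map_sum unshuffle_generator tensor_add_right)
    also have "\<dots> = ?R {#x#}"
      by (simp add: unshuffle_generator tensor_map_add cx c0 tensor_sum_left tensor_sum_right sum.distrib
          m13_sum m13_add m13_single)
    finally show ?thesis .
  qed
  show ?thesis using M
  proof (induction M)
    case empty
    show ?case by (rule zero)
  next
    case (add x M)
    then have x: "{#x#} \<in> sym_basis T" "M \<in> sym_basis T" by (auto simp: sym_basis_def)
    have "?L ({#x#} + M) = ?R ({#x#} + M)"
      unfolding L[OF x] R[OF x] gen[OF x(1)] add.IH[OF x(2)] ..
    then show ?case by simp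
  qed
qed

section \<open>The two algebras\<close>

definition to_sym :: "('h sgraph \<Rightarrow>\<^sub>0 'k::field) \<Rightarrow> ('h sgraph multiset \<Rightarrow>\<^sub>0 'k)" where
  "to_sym = lin_ext (\<lambda>x. Poly_Mapping.single (sgraph_components x) 1)"

definition from_sym :: "('h sgraph multiset \<Rightarrow>\<^sub>0 'k::field) \<Rightarrow> ('h sgraph \<Rightarrow>\<^sub>0 'k)" where
  "from_sym = lin_ext (\<lambda>M. Poly_Mapping.single (sum_mset M) 1)"

text \<open>
  The basis of \<open>S(V)\<close> consists of the multisets of connected graphs, and decomposing a graph
  into components is an isomorphism of monoids from the specified graphs to them, with inverse
  \<open>sum_mset\<close>.
\<close>

lemma to_sym_algebra_iso: "algebra_iso (free_on (spec_basis T)) (free_on (sym_basis T)) to_sym"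
proof -
  let ?A = "free_on (spec_basis T) :: ('a sgraph \<Rightarrow>\<^sub>0 'b) set" and ?B = "free_on (sym_basis T) :: (_ \<Rightarrow>\<^sub>0 'b) set"
  have A: "unital_subalgebra ?A"
    unfolding unital_subalgebra_def
    by (auto intro!: free_on_add free_on_mult free_on_scale
        simp: plus_mem_spec_basis zero_mem_spec_basis simp flip: single_one)
  have "{#} \<in> sym_basis T" by (simp add: sym_basis_def)
  then have B: "unital_subalgebra ?B"
    unfolding unital_subalgebra_def
    by (auto intro!: free_on_add free_on_mult free_on_scale simp: sym_basis_plus simp flip: single_one)
  have "bij_betw to_sym ?A ?B"
  proof (rule bij_betw_byWitness[where f' = from_sym])
    show "\<forall>x\<in>?A. from_sym (to_sym x) = x"
      by (simp add: from_sym_def to_sym_def lin_ext_lin_ext sum_mset_sgraph_components lin_ext_singles)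
    show "\<forall>x\<in>?B. to_sym (from_sym x) = x"
    proof
      fix x :: "_ \<Rightarrow>\<^sub>0 'b" assume "x \<in> ?B"
      then have "to_sym (from_sym x) = lin_ext (\<lambda>M. Poly_Mapping.single M 1) x"
        unfolding from_sym_def to_sym_def lin_ext_lin_ext
        by (rule lin_ext_cong) (simp add: sum_mset_sym_basis)
      then show "to_sym (from_sym x) = x" by (simp add: lin_ext_singles)
    qed
    show "to_sym ` ?A \<subseteq> ?B"
      unfolding to_sym_def by (auto intro!: lin_ext_free_on free_on_single sgraph_components_mem_sym_basis)
    show "from_sym ` ?B \<subseteq> ?A"
      unfolding from_sym_def using sum_mset_sym_basis by (auto intro!: lin_ext_free_on free_on_single)
  qed
  moreover have "to_sym (1 :: 'a sgraph \<Rightarrow>\<^sub>0 'b) = 1"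
    by (simp flip: single_one add: to_sym_def sgraph_components_zero)
  moreover have "to_sym (x * y) = to_sym x * to_sym y" for x y :: "'a sgraph \<Rightarrow>\<^sub>0 'b"
    unfolding to_sym_def
    by (rule lin_ext_mult[of UNIV]) (simp_all add: sgraph_components_add mult_single free_on_def)
  ultimately show ?thesis
    unfolding algebra_iso_def using A B by (simp add: to_sym_def lin_ext_add lin_ext_scale)
qed

theorem theorem8:
  fixes T :: "'h qft"
  assumes "physical_theory T"
  shows "(\<exists>\<phi> :: ('h sgraph \<Rightarrow>\<^sub>0 'k::field) \<Rightarrow> ('h sgraph multiset \<Rightarrow>\<^sub>0 'k).
            algebra_iso (free_on (spec_basis T)) (free_on (sym_basis T)) \<phi> \<and>
            (\<forall>G :: ('v, 'e, 'h) spec_graph. specified_graph T G \<longrightarrow> \<phi> (graph_elem G) = sym_elem G)) \<and>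
         (\<forall>G :: ('v, 'e, 'h) spec_graph. specified_graph T G \<longrightarrow>
            coproduct T (graph_elem G :: 'h sgraph \<Rightarrow>\<^sub>0 'k) =
              (\<Sum>g\<in>coproduct_subgraphs T G. graph_elem g \<otimes> graph_elem (contract G g))) \<and>
         (\<forall>G :: ('v, 'e, 'h) spec_graph. specified_graph T G \<longrightarrow>
            coaction T (sym_elem G :: 'h sgraph multiset \<Rightarrow>\<^sub>0 'k) =
              (\<Sum>g\<in>coproduct_subgraphs T G. graph_elem g \<otimes> sym_elem (contract G g))) \<and>
         comodule_coalgebra
           (spec_basis T) (coproduct T :: ('h sgraph \<Rightarrow>\<^sub>0 'k) \<Rightarrow> _) counit
           (sym_basis T) unshuffle (coaction T)"
proof (intro conjI)
  have "to_sym (graph_elem G :: 'h sgraph \<Rightarrow>\<^sub>0 'k) = sym_elem G"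
    if "specified_graph T G" for G :: "('v, 'e, 'h) spec_graph"
    using sgraph_components_iso_class[OF specified_graph_wf[OF that]]
    by (simp add: to_sym_def graph_elem_def sym_elem_def)
  then show "\<exists>\<phi> :: ('h sgraph \<Rightarrow>\<^sub>0 'k) \<Rightarrow> ('h sgraph multiset \<Rightarrow>\<^sub>0 'k).
      algebra_iso (free_on (spec_basis T)) (free_on (sym_basis T)) \<phi> \<and>
      (\<forall>G :: ('v, 'e, 'h) spec_graph. specified_graph T G \<longrightarrow> \<phi> (graph_elem G) = sym_elem G)"
    using to_sym_algebra_iso by blast
  show "\<forall>G :: ('v, 'e, 'h) spec_graph. specified_graph T G \<longrightarrow>
      coproduct T (graph_elem G :: 'h sgraph \<Rightarrow>\<^sub>0 'k) =
        (\<Sum>g\<in>coproduct_subgraphs T G. graph_elem g \<otimes> graph_elem (contract G g))"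
    using coproduct_graph_elem[OF assms] by blast
  show "\<forall>G :: ('v, 'e, 'h) spec_graph. specified_graph T G \<longrightarrow>
      coaction T (sym_elem G :: 'h sgraph multiset \<Rightarrow>\<^sub>0 'k) =
        (\<Sum>g\<in>coproduct_subgraphs T G. graph_elem g \<otimes> sym_elem (contract G g))"
    using coaction_sym_elem[OF assms] by blast
  show "comodule_coalgebra (spec_basis T) (coproduct T :: ('h sgraph \<Rightarrow>\<^sub>0 'k) \<Rightarrow> _) counit
      (sym_basis T) unshuffle (coaction T)"
    unfolding comodule_coalgebra_def left_coaction_def
  proof (intro conjI ballI funcsetI)
    show "Vector_Spaces.linear scale scale (coaction T :: ('h sgraph multiset \<Rightarrow>\<^sub>0 'k) \<Rightarrow> _)"
      by (rule linear_maps)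
    fix x :: "'h sgraph multiset \<Rightarrow>\<^sub>0 'k" assume x: "x \<in> free_on (sym_basis T)"
    show "coaction T x \<in> free_on (spec_basis T \<times> sym_basis T)" by (rule coaction_free_on[OF assms x])
    show "tensor_assoc (tensor_map (coproduct T) (\<lambda>z. z) (coaction T x)) =
        tensor_map (\<lambda>z. z) (coaction T) (coaction T x)"
    proof (rule linear_eq_on_free_on[OF _ _ _ x])
      fix M assume "M \<in> sym_basis T"
      then obtain G :: "(nat, nat, 'h) spec_graph" where G: "specified_graph T G" "component_classes G = M"
        by (rule sym_basis_graph)
      show "tensor_assoc (tensor_map (coproduct T) (\<lambda>z. z) (coaction T (Poly_Mapping.single M 1))) =
          tensor_map (\<lambda>z. z) (coaction T) (coaction T (Poly_Mapping.single M (1 :: 'k)))"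
        unfolding G(2)[symmetric] by (rule coaction_coassociative[OF assms G(1)])
    qed (rule linear_comp[OF linear_maps(3) linear_comp[OF linear_maps(2,1)]],
        rule linear_comp[OF linear_maps(2,1)])
    show "functional_tensor_id counit (coaction T x) = x"
    proof (rule linear_eq_on_free_on[OF _ _ _ x])
      fix M assume "M \<in> sym_basis T"
      then obtain G :: "(nat, nat, 'h) spec_graph" where G: "specified_graph T G" "component_classes G = M"
        by (rule sym_basis_graph)
      show "functional_tensor_id counit (coaction T (Poly_Mapping.single M 1)) = Poly_Mapping.single M (1 :: 'k)"
        unfolding G(2)[symmetric] by (rule coaction_counital[OF assms G(1)])
    qed (rule linear_comp[OF linear_maps(4,1)], rule linear_maps(7))
    show "tensor_map (\<lambda>z. z) unshuffle (coaction T x) =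
        m13 (tensor_map (coaction T) (coaction T) (unshuffle x))"
      by (rule linear_eq_on_free_on[OF linear_comp[OF linear_maps(2,1)]
            linear_comp[OF linear_maps(6) linear_comp[OF linear_maps(2,5)]] coaction_unshuffle[OF assms] x])
  qed
qed

end
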